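(* Let $g\in\mathfrak F$ and let $\mu_g$ be its unique ergodic invariant probability measure absolutely continuous with respect to Lebesgue measure. Then $\mu_g$ satisfies the Pesin entropy formula $$h_{\mu_g}(g)=\int\log|g'|\,d\mu_g ,$$ where $h_{\mu_g}(g)$ is the measure-theoretic entropy of $g$ with respect to $\mu_g$.
   Context: Let $I=[-1,1]$, $I_-=[-1,0]$, $I_+=[0,1]$, and let $\mathring J$ denote the interior of an interval $J$. The class $\widehat{\mathfrak F}$ is the set of all maps $g:I\to I$ satisfying (A0), (A1), (A2) below. (Values at $0,\pm1$ are understood by continuous extension of the relevant branch.) (A0) The restrictions $g_-:\mathring I_-\to\mathring I$ and $g_+:\mathring I_+\to\mathring I$ are orientation preserving $C^2$ diffeomorphisms, and the only fixed points are the endpoints $\pm1$ of $I$. (A1) There are constants $\ell_1,\ell_2\ge 0$ and $\iota,k_1,k_2,a_1,a_2,b_1,b_2>0$ such that, with $U_{0-}=(-\iota,0]$, $U_{0+}=[0,\iota)$, $U_{-1}=g(U_{0+})$, $U_{+1}=g(U_{0-})$: - on $U_{-1}$: if $\ell_1>0$, $g(x)=x+b_1(1+x)^{1+\ell_1}$; if $\ell_1=0$, $g(x)=-1+(1+b_1)(x+1)+\xi(x)$ with $\xi$ of class $C^2$, $\xi(-1)=\xi'(-1)=0$, $\xi''>0$ on $U_{-1}$; - on $U_{+1}$: if $\ell_2>0$, $g(x)=x-b_2(1-x)^{1+\ell_2}$; if $\ell_2=0$, $g(x)=1+(1+b_2)(x-1)+\xi(x)$ with $\xi$ of class $C^2$,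 $\xi(1)=\xi'(1)=0$, $\xi''<0$ on $U_{+1}$; - on $U_{0-}$: if $k_1\ne1$, $g(x)=1-a_1|x|^{k_1}$; if $k_1=1$, $g'(0_-)=a_1>1$ and $g'$ is monotone on $U_{0-}$; - on $U_{0+}$: if $k_2\neq 1$, $g(x)=-1+a_2x^{k_2}$; if $k_2=1$, $g'(0_+)=a_2>1$ and $g'$ is monotone on $U_{0+}$. Let $\Delta_0^-=g^{-1}(0,1)\cap I_-$, $\Delta_0^+=g^{-1}(-1,0)\cap I_+$, and for $n\ge1$ let $\Delta_n^\pm=g^{-1}(\Delta_{n-1}^\pm)\cap I_\pm$, $\delta_n^-=g^{-1}(\Delta_{n-1}^+)\cap\Delta_0^-$, $\delta_n^+=g^{-1}(\Delta_{n-1}^-)\cap\Delta_0^+$. Set $n_\pm=0$ if $\Delta_0^\pm\subseteq U_{0\pm}$, and otherwise $n_\pm=\min\{n:\delta_n^\pm\subset U_{0\pm}\}$. (A2) There is $\lambda>1$ such that $(g^n)'(x)>\lambda$ for all $1\le n\le n_\pm$ and all $x\in\delta_n^\pm$ (for each choice of sign). Put $\beta=\max\{k_2\ell_1,k_1\ell_2\}$ and $\mathfrak F=\{g\in\widehat{\mathfrak F}:\beta<1\}$. Every $g\in\mathfrak F$ has a unique ergodic invariant probability measure $\mu_g$ absolutely continuous with respect to Lebesgue measure. *)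

theory Defs
  imports "HOL-Probability.Probability"
begin

section \<open>Measure-theoretic (Kolmogorov--Sinai) entropy\<close>

definition finite_measurable_partition :: "'a measure \<Rightarrow> 'a set set \<Rightarrow> bool" where
  "finite_measurable_partition M P \<longleftrightarrow>
     finite P \<and> P \<subseteq> sets M \<and> partition_on (space M) P"

definition partition_entropy :: "'a measure \<Rightarrow> 'a set set \<Rightarrow> real" where
  "partition_entropy M P = - (\<Sum>A\<in>P. measure M A * ln (measure M A))"

definition preimage_partition :: "'a measure \<Rightarrow> ('a \<Rightarrow> 'a) \<Rightarrow> 'a set set \<Rightarrow> 'a set set" where
  "preimage_partition M T P = (\<lambda>A. T -` A \<inter> space M) ` P - {{}}"

text \<open>The join of \<open>P\<close>, \<open>T\<^sup>-\<^sup>1 P\<close>, \<dots>, \<open>T\<^bsup>-(n-1)\<^esup> P\<close>, for \<open>n \<ge> 1\<close>.\<close>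

definition iterated_join :: "'a measure \<Rightarrow> ('a \<Rightarrow> 'a) \<Rightarrow> 'a set set \<Rightarrow> nat \<Rightarrow> 'a set set" where
  "iterated_join M T P n =
     common_refinement ((\<lambda>i. preimage_partition M (T ^^ i) P) ` {..<n})"

definition entropy_wrt_partition :: "'a measure \<Rightarrow> ('a \<Rightarrow> 'a) \<Rightarrow> 'a set set \<Rightarrow> real" where
  "entropy_wrt_partition M T P = lim (\<lambda>n. partition_entropy M (iterated_join M T P n) / real n)"

definition metric_entropy :: "'a measure \<Rightarrow> ('a \<Rightarrow> 'a) \<Rightarrow> ereal" where
  "metric_entropy M T =
     (SUP P \<in> {P. finite_measurable_partition M P}. ereal (entropy_wrt_partition M T P))"


section \<open>Invariance and ergodicity\<close>

definition invariant_measure :: "'a measure \<Rightarrow> ('a \<Rightarrow> 'a) \<Rightarrow> bool" where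
  "invariant_measure M T \<longleftrightarrow> T \<in> M \<rightarrow>\<^sub>M M \<and> distr M M T = M"

definition ergodic_measure :: "'a measure \<Rightarrow> ('a \<Rightarrow> 'a) \<Rightarrow> bool" where
  "ergodic_measure M T \<longleftrightarrow>
     (\<forall>A\<in>sets M. T -` A \<inter> space M = A \<longrightarrow> measure M A = 0 \<or> measure M A = 1)"


section \<open>Functions of class C2\<close>

text \<open>One-sided derivatives are used at those end points of an interval that belong to it.\<close>

definition C2_derivs ::
  "real set \<Rightarrow> (real \<Rightarrow> real) \<Rightarrow> (real \<Rightarrow> real) \<Rightarrow> (real \<Rightarrow> real) \<Rightarrow> bool" where
  "C2_derivs S f f' f'' \<longleftrightarrow>
     (\<forall>x\<in>S. (f has_real_derivative f' x) (at x within S)) \<and>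
     (\<forall>x\<in>S. (f' has_real_derivative f'' x) (at x within S)) \<and>
     continuous_on S f''"

definition C2_on :: "real set \<Rightarrow> (real \<Rightarrow> real) \<Rightarrow> bool" where
  "C2_on S f \<longleftrightarrow> (\<exists>f' f''. C2_derivs S f f' f'')"

definition orientation_preserving_C2_diffeo ::
  "real set \<Rightarrow> real set \<Rightarrow> (real \<Rightarrow> real) \<Rightarrow> bool" where
  "orientation_preserving_C2_diffeo S T f \<longleftrightarrow>
     bij_betw f S T \<and> C2_on S f \<and> C2_on T (inv_into S f) \<and> (\<forall>x\<in>S. deriv f x > 0)"


section \<open>The class of maps\<close>

abbreviation II :: "real set" where "II \<equiv> {-1..1}"
abbreviation I_minus :: "real set" where "I_minus \<equiv> {-1..0}"
abbreviation I_plus :: "real set" where "I_plus \<equiv> {0..1}"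

text \<open>
  A map \<open>g\<close> of \<open>[-1,1]\<close> is a function on the reals of which only the values on \<open>[-1,1]\<close> matter.
  The two branches have different limits at 0, so \<open>g 0\<close> agrees with only one of them;
  \<open>branch J g\<close> is the continuous extension to \<open>J\<close> of the restriction of \<open>g\<close> to the interior of \<open>J\<close>.
\<close>

definition branch :: "real set \<Rightarrow> (real \<Rightarrow> real) \<Rightarrow> real \<Rightarrow> real" where
  "branch J g x = (if x \<in> interior J then g x else Lim (at x within interior J) g)"

text \<open>
  At \<open>-1\<close> and \<open>1\<close> the agreement of \<open>g\<close> with the continuous extension is contained in the clause on
  fixed points.
\<close>

definition cond_A0 :: "(real \<Rightarrow> real) \<Rightarrow> bool" where
  "cond_A0 g \<longleftrightarrow>
     g ` II \<subseteq> II \<and>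
     g 0 \<in> {branch I_minus g 0, branch I_plus g 0} \<and>
     orientation_preserving_C2_diffeo (interior I_minus) (interior II) g \<and>
     orientation_preserving_C2_diffeo (interior I_plus) (interior II) g \<and>
     {x \<in> II. g x = x} = {-1, 1}"

definition U0_minus :: "real \<Rightarrow> real set" where
  "U0_minus \<iota> = {-\<iota><..0}"

definition U0_plus :: "real \<Rightarrow> real set" where
  "U0_plus \<iota> = {0..<\<iota>}"

definition U_minus1 :: "(real \<Rightarrow> real) \<Rightarrow> real \<Rightarrow> real set" where
  "U_minus1 g \<iota> = branch I_plus g ` U0_plus \<iota>"

definition U_plus1 :: "(real \<Rightarrow> real) \<Rightarrow> real \<Rightarrow> real set" where
  "U_plus1 g \<iota> = branch I_minus g ` U0_minus \<iota>"

definition cond_A1_at_minus1 :: "(real \<Rightarrow> real) \<Rightarrow> real set \<Rightarrow> real \<Rightarrow> real \<Rightarrow> bool" where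
  "cond_A1_at_minus1 g U l b \<longleftrightarrow>
     (if l = 0
      then \<exists>\<xi> \<xi>' \<xi>''. C2_derivs U \<xi> \<xi>' \<xi>'' \<and> \<xi> (-1) = 0 \<and> \<xi>' (-1) = 0 \<and>
             (\<forall>x\<in>U. \<xi>'' x > 0) \<and>
             (\<forall>x\<in>U. g x = -1 + (1 + b) * (x + 1) + \<xi> x)
      else \<forall>x\<in>U. g x = x + b * (1 + x) powr (1 + l))"

definition cond_A1_at_plus1 :: "(real \<Rightarrow> real) \<Rightarrow> real set \<Rightarrow> real \<Rightarrow> real \<Rightarrow> bool" where
  "cond_A1_at_plus1 g U l b \<longleftrightarrow>
     (if l = 0
      then \<exists>\<xi> \<xi>' \<xi>''. C2_derivs U \<xi> \<xi>' \<xi>'' \<and> \<xi> 1 = 0 \<and> \<xi>' 1 = 0 \<and>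
             (\<forall>x\<in>U. \<xi>'' x < 0) \<and>
             (\<forall>x\<in>U. g x = 1 + (1 + b) * (x - 1) + \<xi> x)
      else \<forall>x\<in>U. g x = x - b * (1 - x) powr (1 + l))"

text \<open>A branch \<open>h\<close> with \<open>h'(0) = a > 1\<close> (one-sided) and monotone derivative, in either direction.\<close>

definition monotone_derivative_at_0 :: "(real \<Rightarrow> real) \<Rightarrow> real set \<Rightarrow> real \<Rightarrow> bool" where
  "monotone_derivative_at_0 h U a \<longleftrightarrow>
     (\<exists>h'. (\<forall>x\<in>U. (h has_real_derivative h' x) (at x within U)) \<and>
           h' 0 = a \<and> a > 1 \<and> (mono_on U h' \<or> antimono_on U h'))"

definition cond_A1_at_0_minus :: "(real \<Rightarrow> real) \<Rightarrow> real set \<Rightarrow> real \<Rightarrow> real \<Rightarrow> bool" where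
  "cond_A1_at_0_minus g U k a \<longleftrightarrow>
     (if k = 1 then monotone_derivative_at_0 (branch I_minus g) U a
      else \<forall>x\<in>U. branch I_minus g x = 1 - a * \<bar>x\<bar> powr k)"

definition cond_A1_at_0_plus :: "(real \<Rightarrow> real) \<Rightarrow> real set \<Rightarrow> real \<Rightarrow> real \<Rightarrow> bool" where
  "cond_A1_at_0_plus g U k a \<longleftrightarrow>
     (if k = 1 then monotone_derivative_at_0 (branch I_plus g) U a
      else \<forall>x\<in>U. branch I_plus g x = -1 + a * x powr k)"

text \<open>
  The bound \<open>\<iota> \<le> 1\<close> says that the one-sided neighbourhoods of 0 are contained in \<open>[-1,0]\<close>
  and \<open>[0,1]\<close>, so that \<open>g\<close> is defined on them.
\<close>

definition cond_A1 ::
  "(real \<Rightarrow> real) \<Rightarrow> real \<Rightarrow> real \<Rightarrow> real \<Rightarrow> real \<Rightarrow> real \<Rightarrow> real \<Rightarrow> real \<Rightarrow> real \<Rightarrow> real \<Rightarrow> bool" where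
  "cond_A1 g \<iota> l1 l2 k1 k2 a1 a2 b1 b2 \<longleftrightarrow>
     l1 \<ge> 0 \<and> l2 \<ge> 0 \<and> 0 < \<iota> \<and> \<iota> \<le> 1 \<and>
     k1 > 0 \<and> k2 > 0 \<and> a1 > 0 \<and> a2 > 0 \<and> b1 > 0 \<and> b2 > 0 \<and>
     cond_A1_at_minus1 g (U_minus1 g \<iota>) l1 b1 \<and>
     cond_A1_at_plus1 g (U_plus1 g \<iota>) l2 b2 \<and>
     cond_A1_at_0_minus g (U0_minus \<iota>) k1 a1 \<and>
     cond_A1_at_0_plus g (U0_plus \<iota>) k2 a2"

primrec Delta_minus :: "(real \<Rightarrow> real) \<Rightarrow> nat \<Rightarrow> real set" where
  "Delta_minus g 0 = g -` {0<..<1} \<inter> I_minus"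
| "Delta_minus g (Suc n) = g -` Delta_minus g n \<inter> I_minus"

primrec Delta_plus :: "(real \<Rightarrow> real) \<Rightarrow> nat \<Rightarrow> real set" where
  "Delta_plus g 0 = g -` {-1<..<0} \<inter> I_plus"
| "Delta_plus g (Suc n) = g -` Delta_plus g n \<inter> I_plus"

text \<open>The sets \<open>delta_minus g n\<close> and \<open>delta_plus g n\<close> are only meaningful for \<open>n \<ge> 1\<close>.\<close>

definition delta_minus :: "(real \<Rightarrow> real) \<Rightarrow> nat \<Rightarrow> real set" where
  "delta_minus g n = g -` Delta_plus g (n - 1) \<inter> Delta_minus g 0"

definition delta_plus :: "(real \<Rightarrow> real) \<Rightarrow> nat \<Rightarrow> real set" where
  "delta_plus g n = g -` Delta_minus g (n - 1) \<inter> Delta_plus g 0"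

definition n_minus :: "(real \<Rightarrow> real) \<Rightarrow> real \<Rightarrow> nat" where
  "n_minus g \<iota> = (if Delta_minus g 0 \<subseteq> U0_minus \<iota> then 0
                  else (LEAST n. 1 \<le> n \<and> delta_minus g n \<subseteq> U0_minus \<iota>))"

definition n_plus :: "(real \<Rightarrow> real) \<Rightarrow> real \<Rightarrow> nat" where
  "n_plus g \<iota> = (if Delta_plus g 0 \<subseteq> U0_plus \<iota> then 0
                 else (LEAST n. 1 \<le> n \<and> delta_plus g n \<subseteq> U0_plus \<iota>))"

definition cond_A2 :: "(real \<Rightarrow> real) \<Rightarrow> real \<Rightarrow> bool" where
  "cond_A2 g \<iota> \<longleftrightarrow>
     (\<exists>\<Lambda>>1.
        (\<forall>n x. 1 \<le> n \<and> n \<le> n_minus g \<iota> \<and> x \<in> delta_minus g n \<longrightarrow> deriv (g ^^ n) x > \<Lambda>) \<and>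
        (\<forall>n x. 1 \<le> n \<and> n \<le> n_plus g \<iota> \<and> x \<in> delta_plus g n \<longrightarrow> deriv (g ^^ n) x > \<Lambda>))"

text \<open>
  The exponents \<open>l1\<close>, \<open>l2\<close>, \<open>k1\<close>, \<open>k2\<close> are determined by \<open>g\<close>, so the last clause is
  a condition on \<open>g\<close>.
\<close>

definition class_F :: "(real \<Rightarrow> real) set" where
  "class_F = {g. cond_A0 g \<and>
     (\<exists>\<iota> l1 l2 k1 k2 a1 a2 b1 b2.
        cond_A1 g \<iota> l1 l2 k1 k2 a1 a2 b1 b2 \<and> cond_A2 g \<iota> \<and>
        max (k2 * l1) (k1 * l2) < 1)}"

definition ergodic_acip :: "(real \<Rightarrow> real) \<Rightarrow> real measure \<Rightarrow> bool" where
  "ergodic_acip g \<mu> \<longleftrightarrow>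
     sets \<mu> = sets (restrict_space borel II) \<and> prob_space \<mu> \<and>
     invariant_measure \<mu> g \<and> ergodic_measure \<mu> g \<and>
     absolutely_continuous (restrict_space lborel II) \<mu>"

end

theory Submission
  imports Defs
begin

text \<open>
  Let \<open>w b y\<close> be the conditional probability that a point with image \<open>y\<close> lies in the branch \<open>b\<close>.
  With \<open>\<rho>\<close> the density of \<open>\<mu>\<close>, the information \<open>- ln (w (0 < x) (g x))\<close> equals
  \<open>ln (g' x) + ln (\<rho> (g x)) - ln (\<rho> x)\<close> almost everywhere. It is nonnegative, so as soon as \<open>ln g'\<close> is
  integrable the coboundary is bounded below by an integrable function and hence has integral 0.

  Integrability of \<open>ln g'\<close>: it is controlled by the logarithm of the distance from \<open>g x\<close> to the fixed
  point that \<open>g x\<close> approaches as \<open>x\<close> tends to 0, and this logarithm is at most a multiple of the time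
  the orbit spends in the other half of the interval, which is integrable by Kac's argument.

  Entropy is at least the integral of the information: over a branch cylinder of length \<open>n\<close> the product
  of the \<open>1 / w\<close> has integral at most 1, and Jensen's inequality applies. For the converse and an
  arbitrary partition \<open>Q\<close>, Gibbs' inequality compares \<open>\<mu>\<close> with weights on words built by a transfer
  operator whose branch and emission probabilities are step functions approximating \<open>w\<close> and the
  indicators of \<open>Q\<close>. Averaging the end point of the orbits over a grid whose size is linear in \<open>n\<close>
  makes these weights nearly as large as the product of the step functions along the actual orbit.
\<close>

section \<open>Entropy of itineraries\<close>

text \<open>The obstacle is the lack of control at the ends of the branches: \<open>deriv g\<close>
  may tend to 0 or to infinity at 0, the fixed points may be neutral, and no integrability of
  \<open>ln \<rho>\<close> is available. Invariance of the measure takes the place of distortion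
  estimates and of a generating partition. In the upper bound \<open>w\<close> is merely measurable,
  so its values along a nearby orbit say nothing about those along the actual one. A step function
  agrees at two points that no breakpoint separates, and a monotone branch carries a breakpoint
  between two points to a point between their images. So only forward images of breakpoints matter.
  There are linearly many of them, whereas preimages could be exponentially many; the grid therefore
  costs a factor linear in \<open>n\<close>, whose logarithm disappears after division by
  \<open>n\<close>. A step function may vanish where the function it approximates does not, so it is
  shifted by \<open>\<epsilon>\<close> and normalised. The logarithm then costs the L1 error divided
  by \<open>\<epsilon>\<close>, which is why that error is taken of order
  \<open>\<epsilon> ^ 2\<close>.\<close>

definition label_entropy :: "'a measure \<Rightarrow> ('a \<Rightarrow> 'l) \<Rightarrow> real" where
  "label_entropy M W =
     - (\<Sum>l\<in>W ` space M. measure M {x\<in>space M. W x = l} * ln (measure M {x\<in>space M. W x = l}))"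

definition cell :: "'a set set \<Rightarrow> 'a \<Rightarrow> 'a set" where
  "cell P x = (THE A. A \<in> P \<and> x \<in> A)"

text \<open>Itineraries are listed with the most recent symbol first, matching the recursion of the
  transfer operator below.\<close>

primrec itinerary :: "('a \<Rightarrow> 'a) \<Rightarrow> ('a \<Rightarrow> 'l) \<Rightarrow> nat \<Rightarrow> 'a \<Rightarrow> 'l list" where
  "itinerary T c 0 x = []"
| "itinerary T c (Suc n) x = c ((T ^^ n) x) # itinerary T c n x"

lemma itinerary_eq_iff:
  "itinerary T c n x = itinerary T c n y \<longleftrightarrow> (\<forall>i<n. c ((T ^^ i) x) = c ((T ^^ i) y))"
  by (induction n) (auto simp: less_Suc_eq)

lemma length_itinerary [simp]: "length (itinerary T c n x) = n"
  by (induction n) auto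

lemma itinerary_add:
  "itinerary T c (n + m) x = itinerary T c n ((T ^^ m) x) @ itinerary T c m x"
  by (induction n) (auto simp: funpow_add)

lemma set_itinerary:
  assumes "\<And>x. x \<in> S \<Longrightarrow> T x \<in> S" "\<And>x. x \<in> S \<Longrightarrow> c x \<in> L" "x \<in> S"
  shows "set (itinerary T c n x) \<subseteq> L"
proof -
  have "(T ^^ i) x \<in> S" for i
    using assms(1,3) by (induction i) auto
  then show ?thesis
    using assms(2) by (induction n) auto
qed

lemma cell_eqI:
  assumes "partition_on X P" "A \<in> P" "x \<in> A"
  shows "cell P x = A"
  unfolding cell_def
proof (rule the_equality)
  fix B assume "B \<in> P \<and> x \<in> B"
  then show "B = A"
    using assms disjointD[of P A B] unfolding partition_on_def by blast
qed (use assms in auto)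

lemma cell_mem:
  assumes "partition_on X P" "x \<in> X"
  shows "cell P x \<in> P" "x \<in> cell P x"
proof -
  obtain A where "A \<in> P" "x \<in> A"
    using assms unfolding partition_on_def by blast
  then show "cell P x \<in> P" "x \<in> cell P x"
    using cell_eqI[OF assms(1)] by auto
qed

lemma partition_on_preimage_partition:
  assumes "partition_on (space M) P" "T \<in> space M \<rightarrow> space M"
  shows "partition_on (space M) (preimage_partition M T P)"
  unfolding preimage_partition_def
proof (rule partition_onI)
  show "\<Union> ((\<lambda>A. T -` A \<inter> space M) ` P - {{}}) = space M"
  proof (intro equalityI subsetI)
    fix x assume x: "x \<in> space M"
    then have "T x \<in> \<Union>P"
      using assms unfolding partition_on_def by auto
    then show "x \<in> \<Union> ((\<lambda>A. T -` A \<inter> space M) ` P - {{}})"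
      using x by blast
  qed auto
  fix p q assume "p \<in> (\<lambda>A. T -` A \<inter> space M) ` P - {{}}" "q \<in> (\<lambda>A. T -` A \<inter> space M) ` P - {{}}" "p \<noteq> q"
  then obtain A B where AB: "A \<in> P" "B \<in> P" "p = T -` A \<inter> space M" "q = T -` B \<inter> space M"
    by (elim DiffE imageE) auto
  then have "A \<inter> B = {}"
    using assms(1) disjointD[of P A B] \<open>p \<noteq> q\<close> unfolding partition_on_def by blast
  then show "disjnt p q"
    unfolding disjnt_def AB by blast
qed auto

text \<open>A block of the join is an intersection of one block per time, and any point in it
  determines all of them through the cells of its iterates. The hypothesis \<open>n \<ge> 1\<close>
  excludes the join of an empty family, where the intersection over no blocks would be
  \<open>UNIV\<close>.\<close>

lemma iterated_join_eq_fibres: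
  assumes P: "partition_on (space M) P" and T: "T \<in> space M \<rightarrow> space M" and n: "n \<ge> 1"
  defines "W \<equiv> itinerary T (cell P) n"
  shows "iterated_join M T P n = (\<lambda>l. {x\<in>space M. W x = l}) ` W ` space M"
proof -
  define R where "R i = preimage_partition M (T ^^ i) P" for i
  have Tn: "(T ^^ i) x \<in> space M" if "x \<in> space M" for i x
    using T that by (induction i) auto
  have R: "partition_on (space M) (R i)" for i
    unfolding R_def by (rule partition_on_preimage_partition[OF P]) (auto intro: Tn)
  have part: "partition_on (space M) (common_refinement (R ` {..<n}))"
    by (rule partition_on_common_refinement) (use R n in \<open>auto simp: lessThan_empty_iff\<close>)
  have eq: "X = {y\<in>space M. W y = W x}" if X: "X \<in> common_refinement (R ` {..<n})" "x \<in> X" for X x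
  proof -
    obtain f where f: "\<And>Q. Q \<in> R ` {..<n} \<Longrightarrow> f Q \<in> Q" and X_eq: "X = \<Inter> (f ` R ` {..<n})"
      using X(1) unfolding common_refinement by fastforce
    have xs: "x \<in> space M"
      using part X unfolding partition_on_def by blast
    have fR: "f (R i) = {y\<in>space M. cell P ((T ^^ i) y) = cell P ((T ^^ i) x)}" if i: "i < n" for i
    proof -
      from f[of "R i"] i obtain A where A: "A \<in> P" "f (R i) = (T ^^ i) -` A \<inter> space M"
        unfolding R_def preimage_partition_def by auto
      have "x \<in> f (R i)"
        using X(2) X_eq i by auto
      then have c: "cell P ((T ^^ i) x) = A"
        using A by (intro cell_eqI[OF P]) auto
      have iff: "cell P z = A \<longleftrightarrow> z \<in> A" if "z \<in> space M" for z
        using cell_mem[OF P that] cell_eqI[OF P A(1), of z] by metis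
      show ?thesis
        unfolding A(2) c using iff Tn by blast
    qed
    show ?thesis
    proof (intro set_eqI iffI)
      fix y assume y: "y \<in> X"
      then have "y \<in> f (R i)" if "i < n" for i
        using X_eq that by blast
      then show "y \<in> {y \<in> space M. W y = W x}"
        using fR n unfolding W_def itinerary_eq_iff by fastforce
    next
      fix y assume "y \<in> {y \<in> space M. W y = W x}"
      then show "y \<in> X"
        unfolding X_eq W_def itinerary_eq_iff using fR by auto
    qed
  qed
  show ?thesis
    unfolding iterated_join_def R_def[symmetric]
  proof (intro equalityI subsetI)
    fix X assume X: "X \<in> common_refinement (R ` {..<n})"
    then have "X \<noteq> {}" by (auto simp: common_refinement_def)
    then obtain x where "x \<in> X" by blast
    moreover have "x \<in> space M"
      using part X \<open>x \<in> X\<close> unfolding partition_on_def by blast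
    ultimately show "X \<in> (\<lambda>l. {x\<in>space M. W x = l}) ` W ` space M"
      using eq[OF X \<open>x \<in> X\<close>] by blast
  next
    fix X assume "X \<in> (\<lambda>l. {x\<in>space M. W x = l}) ` W ` space M"
    then obtain x where x: "x \<in> space M" "X = {y\<in>space M. W y = W x}"
      by auto
    then obtain Y where Y: "Y \<in> common_refinement (R ` {..<n})" "x \<in> Y"
      using part unfolding partition_on_def by blast
    from Y(1) show "X \<in> common_refinement (R ` {..<n})"
      unfolding eq[OF Y] x(2) .
  qed
qed

lemma partition_entropy_iterated_join:
  assumes P: "partition_on (space M) P" and T: "T \<in> space M \<rightarrow> space M" and n: "n \<ge> 1"
  shows "partition_entropy M (iterated_join M T P n) = label_entropy M (itinerary T (cell P) n)"
proof -
  let ?W = "itinerary T (cell P) n"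
  have "inj_on (\<lambda>l. {x\<in>space M. ?W x = l}) (?W ` space M)"
    by (rule inj_onI) blast
  then show ?thesis
    unfolding partition_entropy_def label_entropy_def iterated_join_eq_fibres[OF assms]
    by (subst sum.reindex) auto
qed

text \<open>Gibbs' inequality: among all subprobability vectors the cross entropy is smallest for
  the distribution of \<open>W\<close> itself. The pointwise bound \<open>B\<close> admits estimates
  of \<open>- ln (q (W x))\<close> that depend on the orbit of \<open>x\<close> and not only on its
  label.\<close>

lemma (in prob_space) label_entropy_le_integral:
  assumes fin: "finite (W ` space M)"
    and meas: "\<And>l. {x\<in>space M. W x = l} \<in> sets M"
    and q: "\<And>l. l \<in> W ` space M \<Longrightarrow> 0 \<le> q l" "(\<Sum>l\<in>W ` space M. q l) \<le> 1"
    and B: "integrable M B"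
    and le: "AE x in M. 0 < q (W x) \<and> - ln (q (W x)) \<le> B x"
  shows "label_entropy M W \<le> (\<integral>x. B x \<partial>M)"
proof -
  define F where "F l = {x\<in>space M. W x = l}" for l
  define p where "p l = measure M (F l)" for l
  have F [measurable]: "F l \<in> sets M" for l
    unfolding F_def by (rule meas)
  have iB: "integrable M (\<lambda>x. indicator (F l) x * B x)" for l
    using integrable_real_mult_indicator[OF F B] by (simp add: mult.commute)
  \<comment> \<open>The slack \<open>q l - p l\<close> comes from \<open>ln t \<le> t - 1\<close> at
    \<open>t = q l / p l\<close>; summed over all labels it is at most \<open>1 - 1\<close>.\<close>
  have one: "- (p l * ln (p l)) \<le> (\<integral>x. indicator (F l) x * B x \<partial>M) + q l - p l"
    if l: "l \<in> W ` space M" for l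
  proof (cases "p l = 0")
    case True
    then have "AE x in M. x \<notin> F l"
      using F by (intro AE_not_in) (auto simp: p_def null_sets_def emeasure_eq_measure)
    then have "(\<integral>x. indicator (F l) x * B x \<partial>M) = 0"
      by (intro integral_eq_zero_AE) (auto simp: indicator_def)
    then show ?thesis using True q(1)[OF l] by simp
  next
    case False
    then have p: "p l > 0"
      by (simp add: p_def zero_less_measure_iff)
    have "- (p l * ln (p l)) = (\<integral>x. indicator (F l) x * (- ln (p l)) \<partial>M)"
      by (simp add: p_def)
    also have "\<dots> \<le> (\<integral>x. indicator (F l) x * B x + indicator (F l) x * (q l / p l - 1) \<partial>M)"
    proof (rule integral_mono_AE)
      show "AE x in M. indicator (F l) x * (- ln (p l)) \<le>
        indicator (F l) x * B x + indicator (F l) x * (q l / p l - 1)"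
        using le
      proof eventually_elim
        case (elim x)
        show ?case
        proof (cases "x \<in> F l")
          case True
          then have "W x = l" by (auto simp: F_def)
          then have ql: "q l > 0" and B: "- ln (q l) \<le> B x" using elim by auto
          have "ln (q l / p l) \<le> q l / p l - 1"
            using ql p by (intro ln_le_minus_one) auto
          then show ?thesis
            using True B ql p by (simp add: ln_div)
        qed auto
      qed
    qed (use iB in \<open>auto intro!: integrable_real_indicator integrable_mult_left simp: emeasure_eq_measure\<close>)
    also have "\<dots> = (\<integral>x. indicator (F l) x * B x \<partial>M) + (q l / p l - 1) * p l"
      using iB by (subst Bochner_Integration.integral_add)
        (auto intro!: integrable_real_indicator integrable_mult_left simp: emeasure_eq_measure p_def)
    finally show ?thesis
      using p by (simp add: algebra_simps)
  qed
  have ind: "(\<Sum>l\<in>W ` space M. indicator (F l) x) = (1::real)" if "x \<in> space M" for x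
  proof -
    have "(\<Sum>l\<in>W ` space M. indicator (F l) x) = (\<Sum>l\<in>W ` space M. if l = W x then 1 else (0::real))"
      using that by (intro sum.cong) (auto simp: F_def)
    then show ?thesis using that fin by auto
  qed
  have "(\<Sum>l\<in>W ` space M. \<integral>x. indicator (F l) x * B x \<partial>M) =
        (\<integral>x. (\<Sum>l\<in>W ` space M. indicator (F l) x) * B x \<partial>M)"
    using iB by (subst Bochner_Integration.integral_sum[symmetric]) (auto simp: sum_distrib_right)
  also have "\<dots> = (\<integral>x. B x \<partial>M)"
    by (intro Bochner_Integration.integral_cong) (auto simp: ind)
  finally have sB: "(\<Sum>l\<in>W ` space M. \<integral>x. indicator (F l) x * B x \<partial>M) = (\<integral>x. B x \<partial>M)" .
  have "(\<Sum>l\<in>W ` space M. p l) = (\<integral>x. (\<Sum>l\<in>W ` space M. indicator (F l) x) \<partial>M)"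
    by (subst Bochner_Integration.integral_sum)
       (auto intro!: integrable_real_indicator simp: p_def emeasure_eq_measure)
  also have "\<dots> = (\<integral>x. 1 \<partial>M)"
    by (intro Bochner_Integration.integral_cong) (auto simp: ind)
  finally have sp: "(\<Sum>l\<in>W ` space M. p l) = 1"
    by (simp add: prob_space)
  have "label_entropy M W = (\<Sum>l\<in>W ` space M. - (p l * ln (p l)))"
    by (simp add: label_entropy_def p_def F_def sum_negf)
  also have "\<dots> \<le> (\<Sum>l\<in>W ` space M. (\<integral>x. indicator (F l) x * B x \<partial>M) + q l - p l)"
    using one by (rule sum_mono)
  also have "\<dots> = (\<integral>x. B x \<partial>M) + (\<Sum>l\<in>W ` space M. q l) - 1"
    by (simp add: sum.distrib sum_subtractf sB sp)
  finally show ?thesis using q(2) by simp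
qed

text \<open>Jensen's inequality on each fibre: over a fibre of measure \<open>p\<close> the mean of
  \<open>t\<close> is at most \<open>1 / p\<close>, so the mean of \<open>ln t\<close> is at most
  \<open>- ln p\<close>.\<close>

lemma (in prob_space) integral_ln_le_label_entropy:
  assumes fin: "finite (W ` space M)"
    and meas: "\<And>l. {x\<in>space M. W x = l} \<in> sets M"
    and t [measurable]: "t \<in> borel_measurable M" and pos: "AE x in M. 0 < t x"
    and le: "\<And>l. l \<in> W ` space M \<Longrightarrow> (\<integral>\<^sup>+x. t x * indicator {x\<in>space M. W x = l} x \<partial>M) \<le> 1"
    and B: "integrable M (\<lambda>x. ln (t x))"
  shows "(\<integral>x. ln (t x) \<partial>M) \<le> label_entropy M W"
proof -
  define F where "F l = {x\<in>space M. W x = l}" for l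
  define p where "p l = measure M (F l)" for l
  have F [measurable]: "F l \<in> sets M" for l
    unfolding F_def by (rule meas)
  have iB: "integrable M (\<lambda>x. indicator (F l) x * ln (t x))" for l
    using integrable_real_mult_indicator[OF F B] by (simp add: mult.commute)
  have one: "(\<integral>x. indicator (F l) x * ln (t x) \<partial>M) \<le> - (p l * ln (p l))"
    if l: "l \<in> W ` space M" for l
  proof (cases "p l = 0")
    case True
    then have "AE x in M. x \<notin> F l"
      using F by (intro AE_not_in) (auto simp: p_def null_sets_def emeasure_eq_measure)
    then have "(\<integral>x. indicator (F l) x * ln (t x) \<partial>M) = 0"
      by (intro integral_eq_zero_AE) (auto simp: indicator_def)
    then show ?thesis using True by simp
  next
    case False
    then have p: "p l > 0"
      by (simp add: p_def zero_less_measure_iff)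
    have nn: "(\<integral>\<^sup>+x. ennreal (indicator (F l) x * t x) \<partial>M) \<le> 1"
    proof -
      have "(\<integral>\<^sup>+x. ennreal (indicator (F l) x * t x) \<partial>M) = (\<integral>\<^sup>+x. ennreal (t x) * indicator {x\<in>space M. W x = l} x \<partial>M)"
        by (intro nn_integral_cong) (auto simp: F_def indicator_def)
      then show ?thesis using le[OF l] by simp
    qed
    have ae: "AE x in M. 0 \<le> indicator (F l) x * t x"
      using pos by eventually_elim (auto simp: indicator_def)
    have it: "integrable M (\<lambda>x. indicator (F l) x * t x)"
      using nn ae by (intro integrableI_nonneg) (auto simp: order_le_less_trans)
    have I1: "(\<integral>x. indicator (F l) x * t x \<partial>M) \<le> 1"
      using nn ae by (subst integral_eq_nn_integral) (auto intro: enn2real_leI)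
    \<comment> \<open>On the fibre the right-hand integrand is the tangent line of \<open>ln\<close>
      at \<open>1 / p l\<close>, taken at \<open>t x\<close>.\<close>
    have "(\<integral>x. indicator (F l) x * ln (t x) \<partial>M) \<le>
        (\<integral>x. p l * (indicator (F l) x * t x) + indicator (F l) x * (- 1 - ln (p l)) \<partial>M)"
    proof (rule integral_mono_AE)
      show "AE x in M. indicator (F l) x * ln (t x) \<le>
        p l * (indicator (F l) x * t x) + indicator (F l) x * (- 1 - ln (p l))"
        using pos
      proof eventually_elim
        case (elim x)
        have "ln (p l * t x) \<le> p l * t x - 1"
          using elim p by (intro ln_le_minus_one) auto
        then show ?case
          using elim p by (auto simp: ln_mult indicator_def)
      qed
    qed (use iB it in \<open>auto intro!: integrable_real_indicator integrable_mult_left simp: emeasure_eq_measure\<close>)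
    also have "\<dots> = p l * (\<integral>x. indicator (F l) x * t x \<partial>M) + (- 1 - ln (p l)) * p l"
      using it by (subst Bochner_Integration.integral_add)
        (auto intro!: integrable_real_indicator integrable_mult_left simp: emeasure_eq_measure p_def)
    also have "\<dots> \<le> p l * 1 + (- 1 - ln (p l)) * p l"
      using I1 p by (intro add_right_mono mult_left_mono) auto
    finally show ?thesis
      by (simp add: algebra_simps)
  qed
  have ind: "(\<Sum>l\<in>W ` space M. indicator (F l) x) = (1::real)" if "x \<in> space M" for x
  proof -
    have "(\<Sum>l\<in>W ` space M. indicator (F l) x) = (\<Sum>l\<in>W ` space M. if l = W x then 1 else (0::real))"
      using that by (intro sum.cong) (auto simp: F_def)
    then show ?thesis using that fin by auto
  qed
  have "(\<integral>x. ln (t x) \<partial>M) = (\<integral>x. (\<Sum>l\<in>W ` space M. indicator (F l) x) * ln (t x) \<partial>M)"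
    by (intro Bochner_Integration.integral_cong) (auto simp: ind)
  also have "\<dots> = (\<Sum>l\<in>W ` space M. \<integral>x. indicator (F l) x * ln (t x) \<partial>M)"
    using iB by (subst Bochner_Integration.integral_sum[symmetric]) (auto simp: sum_distrib_right)
  also have "\<dots> \<le> (\<Sum>l\<in>W ` space M. - (p l * ln (p l)))"
    using one by (rule sum_mono)
  also have "\<dots> = label_entropy M W"
    by (simp add: label_entropy_def p_def F_def sum_negf)
  finally show ?thesis .
qed

text \<open>Fekete's lemma: the limit is the infimum of the quotients, by division of
  \<open>n\<close> by a fixed \<open>m\<close> with nearly minimal quotient. The value
  \<open>a 0\<close> is not assumed to be 0 and enters as a bounded error.\<close>

lemma subadditive_convergent:
  fixes a :: "nat \<Rightarrow> real"
  assumes sub: "\<And>n m. a (n + m) \<le> a n + a m" and nonneg: "\<And>n. 0 \<le> a n"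
  shows "convergent (\<lambda>n. a n / real n)"
proof -
  define L where "L = (INF n\<in>{1..}. a n / real n)"
  have bdd: "bdd_below ((\<lambda>n. a n / real n) ` {1..})"
    using nonneg by (intro bdd_belowI[of _ 0]) auto
  have lower: "L \<le> a n / real n" if "n \<ge> 1" for n
    unfolding L_def using that by (intro cINF_lower bdd) auto
  have mult: "a (q * m) \<le> real q * a m + a 0" for q m
  proof (induction q)
    case (Suc q)
    have "a (Suc q * m) \<le> a m + a (q * m)"
      using sub[of m "q * m"] by simp
    then show ?case using Suc by (simp add: algebra_simps)
  qed simp
  have "(\<lambda>n. a n / real n) \<longlonglongrightarrow> L"
  proof (rule LIMSEQ_I)
    fix e :: real assume e: "e > 0"
    have "\<exists>m\<in>{1..}. a m / real m < L + e / 2"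
      using cINF_less_iff[OF _ bdd, of "L + e / 2"] e unfolding L_def[symmetric] by auto
    then obtain m where m: "m \<ge> 1" "a m / real m < L + e / 2" by auto
    \<comment> \<open>\<open>C\<close> absorbs the remainder of \<open>n\<close> modulo
      \<open>m\<close>, whatever it is, and the term \<open>a 0\<close> of
      \<open>mult\<close>.\<close>
    define C where "C = (\<Sum>r<m. a r) + a 0"
    have C: "C \<ge> 0" unfolding C_def using nonneg by (intro add_nonneg_nonneg sum_nonneg) auto
    have up: "a n / real n \<le> a m / real m + C / real n" if n: "n \<ge> 1" for n
    proof -
      have "a n \<le> a (n div m * m) + a (n mod m)"
        using sub[of "n div m * m" "n mod m"] by simp
      also have "\<dots> \<le> real (n div m) * a m + a 0 + (\<Sum>r<m. a r)"
      proof -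
        have "a (n mod m) \<le> (\<Sum>r<m. a r)"
          using m nonneg by (intro member_le_sum) auto
        then show ?thesis using mult[of "n div m" m] by linarith
      qed
      also have "\<dots> \<le> real n / real m * a m + C"
      proof -
        have "real (n div m) * real m \<le> real n"
          by (metis of_nat_mult of_nat_le_iff div_times_less_eq_dividend)
        then have "real (n div m) \<le> real n / real m"
          using m by (simp add: pos_le_divide_eq)
        then have "real (n div m) * a m \<le> real n / real m * a m"
          using nonneg by (intro mult_right_mono) auto
        then show ?thesis by (simp add: C_def)
      qed
      finally show ?thesis
        using n m by (simp add: divide_simps algebra_simps)
    qed
    obtain N :: nat where N: "real N > 2 * C / e"
      using reals_Archimedean2 by blast
    show "\<exists>N. \<forall>n\<ge>N. norm (a n / real n - L) < e"
    proof (intro exI allI impI)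
      fix n assume n: "n \<ge> max N 1"
      then have "2 * C / e < real n" using N by linarith
      then have "C / real n < e / 2"
        using n e by (simp add: divide_simps algebra_simps)
      moreover have "n \<ge> 1" using n by simp
      ultimately have "\<bar>a n / real n - L\<bar> < e"
        using up[of n] lower[of n] m(2) by linarith
      then show "norm (a n / real n - L) < e" by simp
    qed
  qed
  then show ?thesis by (rule convergentI)
qed

section \<open>Measure-preserving maps and the convergence of entropy\<close>

locale pmp = prob_space M for M :: "'a measure" +
  fixes T :: "'a \<Rightarrow> 'a"
  assumes T [measurable]: "T \<in> M \<rightarrow>\<^sub>M M"
    and distr_T: "distr M M T = M"
begin

lemma Tn [measurable]: "T ^^ n \<in> M \<rightarrow>\<^sub>M M"
  by (induction n) auto

lemma Tn_space: "x \<in> space M \<Longrightarrow> (T ^^ n) x \<in> space M"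
  using measurable_space[OF Tn] .

lemma distr_Tn: "distr M M (T ^^ n) = M"
proof (induction n)
  case 0
  then show ?case by (simp add: distr_id id_def)
next
  case (Suc n)
  have "distr M M (T ^^ Suc n) = distr (distr M M (T ^^ n)) M T"
    by (subst distr_distr) (auto simp: comp_def)
  then show ?case unfolding Suc distr_T .
qed

lemma AE_Tn:
  assumes "AE x in M. P x"
  shows "AE x in M. P ((T ^^ n) x)"
  using AE_distrD[OF Tn[of n], of P] assms unfolding distr_Tn by blast

lemma nn_integral_Tn:
  assumes "f \<in> borel_measurable M"
  shows "(\<integral>\<^sup>+x. f ((T ^^ n) x) \<partial>M) = (\<integral>\<^sup>+x. f x \<partial>M)"
  using nn_integral_distr[OF Tn[of n], of f] assms by (simp add: distr_Tn)

lemma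
  fixes f :: "'a \<Rightarrow> real"
  assumes "integrable M f"
  shows integrable_Tn: "integrable M (\<lambda>x. f ((T ^^ n) x))"
    and integral_Tn: "(\<integral>x. f ((T ^^ n) x) \<partial>M) = (\<integral>x. f x \<partial>M)"
  using integrable_distr[OF Tn[of n], of f] integral_distr[OF Tn[of n], of f] assms
  by (simp_all add: distr_Tn)

lemma finite_itinerary_image:
  assumes "finite (c ` space M)"
  shows "finite (itinerary T c n ` space M)"
proof (rule finite_subset)
  show "itinerary T c n ` space M \<subseteq> {l. set l \<subseteq> c ` space M \<and> length l = n}"
    using set_itinerary[of "space M" T c "c ` space M"] measurable_space[OF T] by auto
qed (use finite_lists_length_eq[OF assms] in auto)

lemma sets_itinerary_fibre:
  assumes "\<And>a. {x\<in>space M. c x = a} \<in> sets M"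
  shows "{x\<in>space M. itinerary T c n x = l} \<in> sets M"
proof (induction n arbitrary: l)
  case 0
  then show ?case by (cases l) auto
next
  case (Suc n)
  show ?case
  proof (cases l)
    case (Cons a as)
    have "{x\<in>space M. itinerary T c (Suc n) x = l} =
      ((T ^^ n) -` {x\<in>space M. c x = a} \<inter> space M) \<inter> {x\<in>space M. itinerary T c n x = as}"
      using Cons Tn_space by auto
    then show ?thesis
      using Suc measurable_sets[OF Tn assms] by auto
  qed auto
qed

end

lemma (in prob_space)
  fixes f :: "'l \<Rightarrow> real"
  assumes fin: "finite (W ` space M)"
    and meas: "\<And>l. {x\<in>space M. W x = l} \<in> sets M"
  shows integrable_finite_range: "integrable M (\<lambda>x. f (W x))"
    and integral_finite_range:
      "(\<integral>x. f (W x) \<partial>M) = (\<Sum>l\<in>W ` space M. f l * measure M {x\<in>space M. W x = l})"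
proof -
  have eq: "f (W x) = (\<Sum>l\<in>W ` space M. f l * indicator {x\<in>space M. W x = l} x)" if "x \<in> space M" for x
  proof -
    have "(\<Sum>l\<in>W ` space M. f l * indicator {x\<in>space M. W x = l} x) =
      (\<Sum>l\<in>W ` space M. if l = W x then f l else 0)"
      using that by (intro sum.cong) auto
    then show ?thesis using that fin by auto
  qed
  have int: "integrable M (\<lambda>x. \<Sum>l\<in>W ` space M. f l * indicator {x\<in>space M. W x = l} x)"
    using meas by (intro Bochner_Integration.integrable_sum integrable_mult_right integrable_real_indicator)
      (auto simp: emeasure_eq_measure)
  show "integrable M (\<lambda>x. f (W x))"
    using int by (subst Bochner_Integration.integrable_cong[OF refl eq]) auto
  have "(\<integral>x. f (W x) \<partial>M) = (\<integral>x. (\<Sum>l\<in>W ` space M. f l * indicator {x\<in>space M. W x = l} x) \<partial>M)"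
    using eq by (intro Bochner_Integration.integral_cong) auto
  also have "\<dots> = (\<Sum>l\<in>W ` space M. f l * measure M {x\<in>space M. W x = l})"
    using meas by (subst Bochner_Integration.integral_sum)
      (auto simp: emeasure_eq_measure intro!: integrable_mult_right integrable_real_indicator sum.cong)
  finally show "(\<integral>x. f (W x) \<partial>M) = (\<Sum>l\<in>W ` space M. f l * measure M {x\<in>space M. W x = l})" .
qed

lemma (in prob_space) AE_fibre_pos:
  assumes fin: "finite (W ` space M)"
    and meas: "\<And>l. {x\<in>space M. W x = l} \<in> sets M"
  shows "AE x in M. 0 < measure M {y\<in>space M. W y = W x}"
proof -
  have "AE x in M. \<forall>l\<in>W ` space M. measure M {y\<in>space M. W y = l} = 0 \<longrightarrow> W x \<noteq> l"
  proof (rule AE_finite_allI[OF fin])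
    fix l
    show "AE x in M. measure M {y\<in>space M. W y = l} = 0 \<longrightarrow> W x \<noteq> l"
    proof (cases "measure M {y\<in>space M. W y = l} = 0")
      case True
      then have "{y\<in>space M. W y = l} \<in> null_sets M"
        using meas by (auto simp: null_sets_def emeasure_eq_measure)
      then have "AE x in M. x \<notin> {y\<in>space M. W y = l}" by (rule AE_not_in)
      then show ?thesis by (rule AE_mp) auto
    qed auto
  qed
  then show ?thesis
    using AE_space by eventually_elim (auto simp: zero_less_measure_iff)
qed

lemma (in prob_space) label_entropy_eq_integral:
  assumes "finite (W ` space M)" "\<And>l. {x\<in>space M. W x = l} \<in> sets M"
  shows "label_entropy M W = (\<integral>x. - ln (measure M {y\<in>space M. W y = W x}) \<partial>M)"
  using integral_finite_range[OF assms, of "\<lambda>l. - ln (measure M {y\<in>space M. W y = l})"]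
  by (simp add: label_entropy_def sum_negf mult.commute)

lemma (in prob_space) sum_fibre_measures:
  assumes "finite (W ` space M)" "\<And>l. {x\<in>space M. W x = l} \<in> sets M"
  shows "(\<Sum>l\<in>W ` space M. measure M {x\<in>space M. W x = l}) = 1"
  using integral_finite_range[OF assms, of "\<lambda>_. 1"] by (simp add: prob_space)

context pmp
begin

text \<open>Gibbs' inequality with the product of the two marginal distributions as weights;
  invariance turns the integral over the shifted part into an entropy. The first \<open>n\<close>
  list entries are the later symbols, hence the itinerary of \<open>(T ^^ m) x\<close>.\<close>

lemma label_entropy_itinerary_subadditive:
  assumes fin: "finite (c ` space M)" and meas: "\<And>a. {x\<in>space M. c x = a} \<in> sets M"
  shows "label_entropy M (itinerary T c (n + m)) \<le>
    label_entropy M (itinerary T c n) + label_entropy M (itinerary T c m)"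
proof -
  define p where "p k l = measure M {y\<in>space M. itinerary T c k y = l}" for k l
  define q where "q l = p n (take n l) * p m (drop n l)" for l
  define B where "B x = - ln (p n (itinerary T c n ((T ^^ m) x))) + - ln (p m (itinerary T c m x))" for x
  note F = finite_itinerary_image[OF fin] sets_itinerary_fibre[OF meas]
  have int: "integrable M (\<lambda>x. - ln (p k (itinerary T c k x)))" for k
    using integrable_finite_range[OF F] .
  have H: "(\<integral>x. - ln (p k (itinerary T c k x)) \<partial>M) = label_entropy M (itinerary T c k)" for k
    using label_entropy_eq_integral[OF F] by (simp add: p_def)
  have split: "take n (itinerary T c (n + m) x) = itinerary T c n ((T ^^ m) x)"
    "drop n (itinerary T c (n + m) x) = itinerary T c m x" for x
    by (simp_all add: itinerary_add)
  have pos: "AE x in M. 0 < p k (itinerary T c k x)" for k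
    using AE_fibre_pos[OF F] by (simp add: p_def)
  have "label_entropy M (itinerary T c (n + m)) \<le> (\<integral>x. B x \<partial>M)"
  proof (rule label_entropy_le_integral[OF F, where q = q])
    show "0 \<le> q l" for l by (simp add: q_def p_def)
    have inj: "inj_on (\<lambda>l. (take n l, drop n l)) (itinerary T c (n + m) ` space M)"
      by (rule inj_onI) (metis append_take_drop_id prod.inject)
    have "(\<Sum>l\<in>itinerary T c (n + m) ` space M. q l) =
        (\<Sum>(a, b)\<in>(\<lambda>l. (take n l, drop n l)) ` itinerary T c (n + m) ` space M. p n a * p m b)"
      by (simp add: sum.reindex[OF inj] q_def)
    also have "\<dots> \<le> (\<Sum>(a, b)\<in>itinerary T c n ` space M \<times> itinerary T c m ` space M. p n a * p m b)"
      by (rule sum_mono2) (auto simp: F split p_def intro!: Tn_space imageI)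
    also have "\<dots> = (\<Sum>a\<in>itinerary T c n ` space M. p n a) * (\<Sum>b\<in>itinerary T c m ` space M. p m b)"
      by (simp add: sum_product sum.cartesian_product)
    also have "\<dots> = 1"
      using sum_fibre_measures[OF F] by (simp add: p_def)
    finally show "(\<Sum>l\<in>itinerary T c (n + m) ` space M. q l) \<le> 1" .
    show "integrable M B"
      unfolding B_def using integrable_Tn[OF int] int by (rule Bochner_Integration.integrable_add)
    show "AE x in M. 0 < q (itinerary T c (n + m) x) \<and> - ln (q (itinerary T c (n + m) x)) \<le> B x"
      using AE_Tn[OF pos[of n], of m] pos[of m]
      by eventually_elim (simp add: q_def split B_def ln_mult)
  qed
  also have "\<dots> = label_entropy M (itinerary T c n) + label_entropy M (itinerary T c m)"
    unfolding B_def using integrable_Tn[OF int] int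
    by (subst Bochner_Integration.integral_add) (auto simp: integral_Tn[OF int, of n m, simplified] H[simplified])
  finally show ?thesis .
qed

lemma finite_measurable_partition_cell:
  assumes "finite_measurable_partition M P"
  shows "finite (cell P ` space M)" "{x\<in>space M. cell P x = A} \<in> sets M"
proof -
  have P: "partition_on (space M) P" "finite P" "P \<subseteq> sets M"
    using assms by (auto simp: finite_measurable_partition_def)
  show "finite (cell P ` space M)"
    using P(2) by (rule finite_subset[rotated]) (use cell_mem[OF P(1)] in auto)
  show "{x\<in>space M. cell P x = A} \<in> sets M"
  proof (cases "A \<in> P")
    case True
    then have "{x\<in>space M. cell P x = A} = A"
      using cell_mem[OF P(1)] cell_eqI[OF P(1) True] sets.sets_into_space[of A M] P(3) by blast
    then show ?thesis using P(3) True by auto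
  next
    case False
    then have "{x\<in>space M. cell P x = A} = {}"
      using cell_mem[OF P(1)] by auto
    then show ?thesis by (simp only: sets.empty_sets)
  qed
qed

text \<open>The definition of \<open>entropy_wrt_partition\<close> uses \<open>lim\<close>, which is
  informative only for a convergent sequence; subadditivity supplies the convergence.\<close>

lemma entropy_wrt_partition_tendsto:
  assumes "finite_measurable_partition M P"
  shows "(\<lambda>n. label_entropy M (itinerary T (cell P) n) / real n) \<longlonglongrightarrow> entropy_wrt_partition M T P"
proof -
  let ?H = "\<lambda>n. label_entropy M (itinerary T (cell P) n)"
  note F = finite_measurable_partition_cell[OF assms]
  have P: "partition_on (space M) P"
    using assms by (auto simp: finite_measurable_partition_def)
  have neg: "p * ln p \<le> 0" if "0 \<le> p" "p \<le> 1" for p :: real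
    using that by (cases "p = 0") (auto simp: mult_nonneg_nonpos)
  have "0 \<le> ?H n" for n
    unfolding label_entropy_def sum_negf[symmetric]
    by (intro sum_nonneg) (simp add: neg)
  then have "convergent (\<lambda>n. ?H n / real n)"
    using label_entropy_itinerary_subadditive[OF F] by (intro subadditive_convergent) auto
  then obtain L where L: "(\<lambda>n. ?H n / real n) \<longlonglongrightarrow> L"
    by (auto simp: convergent_def)
  have "(\<lambda>n. partition_entropy M (iterated_join M T P n) / real n) \<longlonglongrightarrow> L"
  proof (rule Lim_transform_eventually[OF L])
    show "\<forall>\<^sub>F n in sequentially. ?H n / real n = partition_entropy M (iterated_join M T P n) / real n"
      using eventually_ge_at_top[of "1::nat"]
      by eventually_elim (simp add: partition_entropy_iterated_join[OF P] measurable_space[OF T])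
  qed
  then show ?thesis
    unfolding entropy_wrt_partition_def using L by (simp add: limI)
qed

end

section \<open>Coboundaries, excursion times and branch probabilities\<close>

context pmp
begin

text \<open>The function \<open>u\<close> may fail to be integrable, so the two terms cannot be
  integrated separately. Bounded truncations of \<open>u\<close> have coboundaries of integral 0;
  the lower bound \<open>f\<close> permits Fatou's lemma, which yields integrability, and dominated
  convergence then gives the value.\<close>

lemma
  assumes u [measurable]: "u \<in> borel_measurable M" and f: "integrable M f"
    and le: "AE x in M. f x \<le> u (T x) - u x"
  shows integrable_coboundary: "integrable M (\<lambda>x. u (T x) - u x)"
    and integral_coboundary: "(\<integral>x. u (T x) - u x \<partial>M) = (0::real)"
proof -
  \<comment> \<open>The clamp is nondecreasing and does not increase distances, so a truncated
    difference keeps the sign of \<open>u (T x) - u x\<close> and is no larger in absolute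
    value.\<close>
  define cl where "cl k t = max (- real k) (min (real k) t)" for k :: nat and t :: real
  define d where "d k x = cl k (u (T x)) - cl k (u x)" for k x
  have cl [measurable]: "cl k \<in> borel_measurable borel" for k
    unfolding cl_def by measurable
  have d_meas [measurable]: "d k \<in> borel_measurable M" for k
    unfolding d_def by measurable
  have f_meas [measurable]: "f \<in> borel_measurable M"
    using f by auto
  have int_cl: "integrable M (\<lambda>x. cl k (u x))" for k
    by (rule integrable_const_bound[of _ "real k"]) (auto simp: cl_def)
  have d0: "integrable M (\<lambda>x. d k x)" "(\<integral>x. d k x \<partial>M) = 0" for k
    unfolding d_def using integrable_Tn[OF int_cl, where n = 1] integral_Tn[OF int_cl, where n = 1] int_cl
    by auto
  have d_bound: "\<bar>d k x\<bar> \<le> \<bar>u (T x) - u x\<bar>" "min 0 (u (T x) - u x) \<le> d k x" for k x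
    by (auto simp: d_def cl_def)
  have d_lim: "(\<lambda>k. d k x) \<longlonglongrightarrow> u (T x) - u x" for x
  proof (rule tendsto_eventually)
    obtain N :: nat where N: "real N > max \<bar>u (T x)\<bar> \<bar>u x\<bar>"
      using reals_Archimedean2 by blast
    show "\<forall>\<^sub>F k in sequentially. d k x = u (T x) - u x"
      using eventually_ge_at_top[of N]
    proof eventually_elim
      case (elim k)
      then have "real k > max \<bar>u (T x)\<bar> \<bar>u x\<bar>" using N by linarith
      then show ?case by (auto simp: d_def cl_def)
    qed
  qed
  \<comment> \<open>Fatou's lemma: with \<open>\<bar>f x\<bar>\<close> added, the truncated
    coboundaries are nonnegative almost everywhere and their integrals do not depend on
    \<open>k\<close>.\<close>
  have "(\<integral>\<^sup>+x. ennreal (u (T x) - u x + \<bar>f x\<bar>) \<partial>M) =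
    (\<integral>\<^sup>+x. liminf (\<lambda>k. ennreal (d k x + \<bar>f x\<bar>)) \<partial>M)"
    by (intro nn_integral_cong lim_imp_Liminf[symmetric] tendsto_ennrealI tendsto_intros d_lim) auto
  also have "\<dots> \<le> liminf (\<lambda>k. \<integral>\<^sup>+x. ennreal (d k x + \<bar>f x\<bar>) \<partial>M)"
    by (rule nn_integral_liminf) measurable
  also have "(\<lambda>k. \<integral>\<^sup>+x. ennreal (d k x + \<bar>f x\<bar>) \<partial>M) = (\<lambda>k. ennreal (\<integral>x. \<bar>f x\<bar> \<partial>M))"
  proof
    fix k
    have "AE x in M. 0 \<le> d k x + \<bar>f x\<bar>"
      using le by eventually_elim (use d_bound(2)[of _ k] in \<open>smt (verit)\<close>)
    then have "(\<integral>\<^sup>+x. ennreal (d k x + \<bar>f x\<bar>) \<partial>M) = ennreal (\<integral>x. d k x + \<bar>f x\<bar> \<partial>M)"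
      using d0(1) f by (intro nn_integral_eq_integral) auto
    also have "(\<integral>x. d k x + \<bar>f x\<bar> \<partial>M) = (\<integral>x. \<bar>f x\<bar> \<partial>M)"
      using d0[of k] f by (subst Bochner_Integration.integral_add) auto
    finally show "(\<integral>\<^sup>+x. ennreal (d k x + \<bar>f x\<bar>) \<partial>M) = ennreal (\<integral>x. \<bar>f x\<bar> \<partial>M)" .
  qed
  also have "liminf (\<lambda>k::nat. ennreal (\<integral>x. \<bar>f x\<bar> \<partial>M)) = ennreal (\<integral>x. \<bar>f x\<bar> \<partial>M)"
    by (simp add: Liminf_const)
  finally have "(\<integral>\<^sup>+x. ennreal (u (T x) - u x + \<bar>f x\<bar>) \<partial>M) < \<infinity>"
    by (simp add: order_le_less_trans)
  moreover have "AE x in M. 0 \<le> u (T x) - u x + \<bar>f x\<bar>"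
    using le by eventually_elim linarith
  ultimately have "integrable M (\<lambda>x. u (T x) - u x + \<bar>f x\<bar>)"
    by (intro integrableI_nonneg) auto
  from Bochner_Integration.integrable_diff[OF this integrable_abs[OF f]]
  show int: "integrable M (\<lambda>x. u (T x) - u x)" by simp
  have "(\<lambda>k. \<integral>x. d k x \<partial>M) \<longlonglongrightarrow> (\<integral>x. u (T x) - u x \<partial>M)"
    by (rule integral_dominated_convergence[where w="\<lambda>x. \<bar>u (T x) - u x\<bar>"])
      (use int d_lim d_bound in auto)
  then show "(\<integral>x. u (T x) - u x \<partial>M) = 0"
    unfolding d0 by (simp add: LIMSEQ_const_iff)
qed

text \<open>A form of Kac's lemma.\<close>

lemma integrable_excursion_time:
  fixes f :: "'a \<Rightarrow> real"
  assumes A [measurable]: "A \<in> sets M" and f [measurable]: "f \<in> borel_measurable M"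
    and nonneg: "\<And>x. x \<in> space M \<Longrightarrow> x \<notin> A \<Longrightarrow> 0 \<le> f x"
    and exc: "AE x in M. x \<notin> A \<longrightarrow> (\<forall>n j. real n < f x \<and> 1 \<le> j \<and> j \<le> n \<longrightarrow> (T ^^ j) x \<in> A)"
  shows "integrable M (\<lambda>x. indicator (space M - A) x * f x)"
proof -
  \<comment> \<open>\<open>E n\<close> consists of the points that are in \<open>A\<close> at the
    times \<open>0, ..., n - 1\<close>, and \<open>D n\<close> of the points outside
    \<open>A\<close> that are in \<open>A\<close> at the times \<open>1, ..., n\<close>.\<close>
  define E where "E n = {x\<in>space M. \<forall>j<n. (T ^^ j) x \<in> A}" for n
  define D where "D n = {x\<in>space M. x \<notin> A \<and> (\<forall>j<n. (T ^^ j) (T x) \<in> A)}" for n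
  have E [measurable]: "E n \<in> sets M" for n
    unfolding E_def by measurable
  have D [measurable]: "D n \<in> sets M" for n
    unfolding D_def by measurable
  have mD: "measure M (D n) = measure M (E n) - measure M (E (Suc n))" for n
  proof -
    have "measure M (E n) = measure (distr M M T) (E n)"
      by (simp add: distr_T)
    also have "\<dots> = measure M (T -` E n \<inter> space M)"
      by (rule measure_distr) auto
    \<comment> \<open>If the image of a point lies in \<open>E n\<close>, the point is either in
      \<open>A\<close>, hence in \<open>E (Suc n)\<close>, or outside \<open>A\<close>, hence in
      \<open>D n\<close>. With invariance the measures of the sets \<open>D n\<close>
      telescope.\<close>
    also have "T -` E n \<inter> space M = D n \<union> E (Suc n)"
      using measurable_space[OF T]
      by (auto simp: E_def D_def All_less_Suc2 funpow_swap1 simp del: funpow.simps)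
        (auto simp: funpow_swap1)
    also have "measure M \<dots> = measure M (D n) + measure M (E (Suc n))"
      by (rule finite_measure_Union) (auto simp: E_def D_def All_less_Suc2)
    finally show ?thesis by simp
  qed
  have sD: "(\<Sum>n<N. measure M (D n)) \<le> 1" for N
  proof -
    have "(\<Sum>n<N. measure M (D n)) = measure M (E 0) - measure M (E N)"
      by (induction N) (simp_all add: mD)
    also have "\<dots> \<le> 1"
      using prob_le_1[of "E 0"] measure_nonneg[of M "E N"] by linarith
    finally show ?thesis .
  qed
  have "(\<integral>\<^sup>+x. ennreal (indicator (space M - A) x * f x) \<partial>M) \<le> (\<integral>\<^sup>+x. (\<Sum>n. indicator (D n) x) \<partial>M)"
  proof (rule nn_integral_mono_AE)
    show "AE x in M. ennreal (indicator (space M - A) x * f x) \<le> (\<Sum>n. indicator (D n) x)"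
      using exc AE_space
    proof eventually_elim
      case (elim x)
      show ?case
      proof (cases "x \<in> A")
        case False
        \<comment> \<open>By \<open>exc\<close> the point lies in \<open>D n\<close> for all
          \<open>n < f x\<close>, which are exactly the \<open>n < K\<close> because of the ceiling.
          So at least \<open>f x\<close> of the sets \<open>D n\<close> contain it.\<close>
        define K where "K = nat \<lceil>f x\<rceil>"
        have "indicator (D n) x = (1::ennreal)" if "n < K" for n
        proof -
          have "real n < f x" using that unfolding K_def by linarith
          then have "(T ^^ j) (T x) \<in> A" if "j < n" for j
            using elim False that by (metis Suc_leI comp_apply funpow_Suc_right le_add1 plus_1_eq_Suc)
          then show ?thesis using elim False by (simp add: D_def)
        qed
        then have "(\<Sum>n<K. indicator (D n) x) = (of_nat K :: ennreal)"
          by simp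
        then have "of_nat K \<le> (\<Sum>n. indicator (D n) x :: ennreal)"
          using sum_le_suminf[of "\<lambda>n. indicator (D n) x :: ennreal" "{..<K}"] by simp
        moreover have "ennreal (indicator (space M - A) x * f x) \<le> of_nat K"
        proof -
          have "f x \<le> real K" unfolding K_def by linarith
          then show ?thesis using elim False by (simp add: ennreal_of_nat_eq_real_of_nat ennreal_leI)
        qed
        ultimately show ?thesis by (rule order_trans[rotated])
      qed auto
    qed
  qed
  also have "\<dots> = (\<Sum>n. emeasure M (D n))"
    by (subst nn_integral_suminf) auto
  also have "\<dots> \<le> 1"
  proof (rule suminf_le_const)
    fix N
    have "(\<Sum>n<N. emeasure M (D n)) = ennreal (\<Sum>n<N. measure M (D n))"
      by (simp add: emeasure_eq_measure sum_ennreal)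
    also have "\<dots> \<le> ennreal 1"
      by (rule ennreal_leI[OF sD])
    finally show "(\<Sum>n<N. emeasure M (D n)) \<le> 1" by simp
  qed auto
  finally have "(\<integral>\<^sup>+x. ennreal (indicator (space M - A) x * f x) \<partial>M) < \<infinity>"
    by (simp add: order_le_less_trans)
  then show ?thesis
    using nonneg by (intro integrableI_nonneg) (auto intro!: AE_I2 simp: indicator_def)
qed

end

section \<open>Branch probabilities and the lower bound for the entropy\<close>

text \<open>Here \<open>w b y\<close> is the conditional probability, given \<open>T x = y\<close>, that \<open>x\<close> lies in the branch \<open>b\<close>.\<close>

locale branch_weights = pmp +
  fixes c :: "'a \<Rightarrow> bool" and w :: "bool \<Rightarrow> 'a \<Rightarrow> real"
  assumes c [measurable]: "Measurable.pred M c"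
    and w [measurable]: "\<And>b. w b \<in> borel_measurable M"
    and w_nonneg: "\<And>b x. 0 \<le> w b x"
    and transfer: "\<And>b h. h \<in> borel_measurable M \<Longrightarrow>
      (\<integral>\<^sup>+x. h (T x) * indicator {x. c x = b} x \<partial>M) = (\<integral>\<^sup>+y. h y * ennreal (w b y) \<partial>M)"
begin

text \<open>With the indicator of the zero set of \<open>w b\<close> as test function,
  \<open>transfer\<close> shows that almost no point of the branch \<open>b\<close> is mapped into
  that set.\<close>

lemma AE_weight_pos: "AE x in M. 0 < w (c x) (T x)"
proof -
  have "AE x in M. c x = b \<longrightarrow> 0 < w b (T x)" for b
  proof -
    have "(\<integral>\<^sup>+x. indicator {y. w b y = 0} (T x) * indicator {x. c x = b} x \<partial>M) =
      (\<integral>\<^sup>+y. indicator {y. w b y = 0} y * ennreal (w b y) \<partial>M)"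
      by (rule transfer) measurable
    also have "\<dots> = (\<integral>\<^sup>+y. 0 \<partial>M)"
      by (rule nn_integral_cong) (auto simp: indicator_def)
    also have "\<dots> = 0" by simp
    finally have "AE x in M. indicator {y. w b y = 0} (T x) * indicator {x. c x = b} x = (0::ennreal)"
      by (subst (asm) nn_integral_0_iff_AE) auto
    then show ?thesis
      by eventually_elim (auto simp: indicator_def less_le w_nonneg split: if_splits)
  qed
  from this[of True] this[of False] show ?thesis
    by eventually_elim (metis (full_types))
qed

text \<open>Adding \<open>transfer\<close> over both branches gives back invariance, so the sum of
  the weights is a density of \<open>M\<close> with respect to itself; densities are unique up to
  null sets.\<close>

lemma AE_weight_sum: "AE x in M. w True x + w False x = 1"
proof -
  have "density M (\<lambda>x. ennreal (w True x + w False x)) = density M (\<lambda>_. 1)"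
  proof (rule measure_eqI)
    fix A assume "A \<in> sets (density M (\<lambda>x. ennreal (w True x + w False x)))"
    then have A [measurable]: "A \<in> sets M" by simp
    have "emeasure (density M (\<lambda>x. ennreal (w True x + w False x))) A =
      (\<integral>\<^sup>+x. indicator A x * ennreal (w True x) + indicator A x * ennreal (w False x) \<partial>M)"
      by (subst emeasure_density)
        (auto intro!: nn_integral_cong simp: ennreal_plus w_nonneg distrib_left distrib_right mult.commute)
    also have "\<dots> = (\<integral>\<^sup>+x. indicator A x * ennreal (w True x) \<partial>M) + (\<integral>\<^sup>+x. indicator A x * ennreal (w False x) \<partial>M)"
      by (rule nn_integral_add) measurable
    also have "\<dots> = (\<integral>\<^sup>+x. indicator A (T x) * indicator {x. c x = True} x \<partial>M) +
        (\<integral>\<^sup>+x. indicator A (T x) * indicator {x. c x = False} x \<partial>M)"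
      by (subst (1 2) transfer) auto
    also have "\<dots> = (\<integral>\<^sup>+x. indicator A (T x) * indicator {x. c x = True} x +
        indicator A (T x) * indicator {x. c x = False} x \<partial>M)"
      by (rule nn_integral_add[symmetric]) measurable
    also have "\<dots> = (\<integral>\<^sup>+x. indicator A (T x) \<partial>M)"
      by (rule nn_integral_cong) (auto simp: indicator_def)
    also have "\<dots> = (\<integral>\<^sup>+x. indicator A x \<partial>M)"
      using nn_integral_Tn[of "indicator A" 1] by simp
    finally show "emeasure (density M (\<lambda>x. ennreal (w True x + w False x))) A =
      emeasure (density M (\<lambda>_. 1)) A"
      by (simp add: emeasure_density)
  qed simp
  then have "AE x in M. ennreal (w True x + w False x) = 1"
    by (subst (asm) density_unique_iff) (auto intro!: sigma_finite_measure.sigma_finite_iff_density_finite)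
  then show ?thesis
    by eventually_elim (simp add: ennreal_eq_1)
qed

text \<open>Its integral is the conditional entropy of the branch of \<open>x\<close> given
  \<open>T x\<close>.\<close>

definition info :: "'a \<Rightarrow> real" where
  "info x = - ln (w (c x) (T x))"

text \<open>The factor \<open>1 / w\<close> plays the part of the Jacobian of \<open>T\<close> with
  respect to \<open>M\<close>, and the product along the orbit that of the Jacobian of
  \<open>T ^^ n\<close>.\<close>

definition jac :: "nat \<Rightarrow> 'a \<Rightarrow> real" where
  "jac n x = (\<Prod>j<n. 1 / w (c ((T ^^ j) x)) (T ((T ^^ j) x)))"

lemma w_c [measurable]: "(\<lambda>x. w (c x) (T x)) \<in> borel_measurable M"
proof -
  have "(\<lambda>x. if c x then w True (T x) else w False (T x)) \<in> borel_measurable M"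
    by measurable
  also have "(\<lambda>x. if c x then w True (T x) else w False (T x)) = (\<lambda>x. w (c x) (T x))"
    by (auto simp: fun_eq_iff)
  finally show ?thesis .
qed

lemma jac_measurable [measurable]: "jac n \<in> borel_measurable M"
proof -
  have "(\<lambda>x. 1 / w (c ((T ^^ j) x)) (T ((T ^^ j) x))) \<in> borel_measurable M" for j
    using measurable_compose[OF Tn w_c] by measurable
  then show ?thesis
    unfolding jac_def by (intro borel_measurable_prod) auto
qed

lemma jac_Suc: "jac (Suc n) x = 1 / w (c x) (T x) * jac n (T x)"
  unfolding jac_def by (subst prod.lessThan_Suc_shift) (simp add: funpow_swap1)

text \<open>The integral of a Jacobian over a cylinder should be the measure of its image, whence
  the bound 1. The labelling \<open>d\<close> may be finer than the branches as long as it
  determines them through \<open>D\<close>.\<close>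

lemma nn_integral_jac_le_1:
  assumes d: "\<And>a. {x\<in>space M. d x = a} \<in> sets M" and D: "\<And>x. x \<in> space M \<Longrightarrow> c x = D (d x)"
  shows "(\<integral>\<^sup>+x. ennreal (jac n x) * indicator {x\<in>space M. itinerary T d n x = l} x \<partial>M) \<le> 1"
proof (induction n arbitrary: l)
  case 0
  have "(\<integral>\<^sup>+x. ennreal (jac 0 x) * indicator {x\<in>space M. itinerary T d 0 x = l} x \<partial>M) \<le> (\<integral>\<^sup>+x. 1 \<partial>M)"
    by (rule nn_integral_mono) (auto simp: jac_def indicator_def)
  then show ?case by (simp add: emeasure_space_1)
next
  case (Suc n)
  \<comment> \<open>The oldest symbol stands last, so splitting off the first time step removes the
    end of the list.\<close>
  have it: "itinerary T d (Suc n) x = itinerary T d n (T x) @ [d x]" for x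
    using itinerary_add[of T d n 1 x] by simp
  have F [measurable]: "{x\<in>space M. itinerary T d n x = l} \<in> sets M" for l
    by (rule sets_itinerary_fibre[OF d])
  show ?case
  proof (cases "l = []")
    case True
    then show ?thesis by (simp add: it)
  next
    case False
    define as a where "as = butlast l" and "a = last l"
    have l: "l = as @ [a]" using False by (simp add: as_def a_def)
    define h where "h y = ennreal (1 / w (D a) y * jac n y) * indicator {x\<in>space M. itinerary T d n x = as} y" for y
    have jac_nonneg: "0 \<le> jac n y" for y
      unfolding jac_def by (intro prod_nonneg) (simp add: w_nonneg)
    have "(\<integral>\<^sup>+x. ennreal (jac (Suc n) x) * indicator {x\<in>space M. itinerary T d (Suc n) x = l} x \<partial>M)
      \<le> (\<integral>\<^sup>+x. h (T x) * indicator {x. c x = D a} x \<partial>M)"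
    proof (rule nn_integral_mono)
      fix x assume x: "x \<in> space M"
      show "ennreal (jac (Suc n) x) * indicator {x\<in>space M. itinerary T d (Suc n) x = l} x \<le>
        h (T x) * indicator {x. c x = D a} x"
      proof (cases "itinerary T d (Suc n) x = l")
        case True
        then have "itinerary T d n (T x) = as" "d x = a"
          unfolding it l by auto
        then show ?thesis
          using x D[OF x] measurable_space[OF T x] by (auto simp: h_def jac_Suc indicator_def)
      qed auto
    qed
    also have "\<dots> = (\<integral>\<^sup>+y. h y * ennreal (w (D a) y) \<partial>M)"
      by (rule transfer) (unfold h_def, measurable)
    \<comment> \<open>The factors \<open>1 / w\<close> and \<open>w\<close> cancel where
      \<open>w\<close> is positive. Where it is 0 their product is 0, hence only an
      inequality.\<close>
    also have "\<dots> \<le> (\<integral>\<^sup>+y. ennreal (jac n y) * indicator {x\<in>space M. itinerary T d n x = as} y \<partial>M)"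
      by (rule nn_integral_mono)
        (auto simp: h_def indicator_def w_nonneg jac_nonneg ennreal_mult'[symmetric]
          ennreal_mult''[symmetric] intro!: ennreal_leI)
    also have "\<dots> \<le> 1" by (rule Suc)
    finally show ?thesis .
  qed
qed

text \<open>Almost everywhere \<open>ln (jac n x)\<close> is the Birkhoff sum of
  \<open>info\<close>, so by invariance its integral is \<open>n\<close> times that of
  \<open>info\<close>.\<close>

lemma integral_info_le_label_entropy:
  assumes info: "integrable M info" and fin: "finite (d ` space M)"
    and d: "\<And>a. {x\<in>space M. d x = a} \<in> sets M" and D: "\<And>x. x \<in> space M \<Longrightarrow> c x = D (d x)"
  shows "real n * (\<integral>x. info x \<partial>M) \<le> label_entropy M (itinerary T d n)"
proof -
  have posj: "AE x in M. \<forall>j. 0 < w (c ((T ^^ j) x)) (T ((T ^^ j) x))"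
    using AE_Tn[OF AE_weight_pos] by (simp add: AE_all_countable)
  have ln_jac: "AE x in M. 0 < jac n x \<and> ln (jac n x) = (\<Sum>j<n. info ((T ^^ j) x))"
    using posj
  proof eventually_elim
    case (elim x)
    then have pos: "0 < 1 / w (c ((T ^^ j) x)) (T ((T ^^ j) x))" for j
      by simp
    then have "0 < jac n x"
      unfolding jac_def by (intro prod_pos) blast
    moreover have "ln (jac n x) = (\<Sum>j<n. ln (1 / w (c ((T ^^ j) x)) (T ((T ^^ j) x))))"
      unfolding jac_def using pos by (intro ln_prod) (auto simp: less_imp_neq[THEN not_sym])
    moreover have "ln (1 / w (c ((T ^^ j) x)) (T ((T ^^ j) x))) = info ((T ^^ j) x)" for j
      using elim[rule_format, of j] by (simp add: info_def ln_div)
    ultimately show ?case by simp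
  qed
  have int: "integrable M (\<lambda>x. \<Sum>j<n. info ((T ^^ j) x))"
    using integrable_Tn[OF info] by (intro Bochner_Integration.integrable_sum) auto
  have "real n * (\<integral>x. info x \<partial>M) = (\<integral>x. (\<Sum>j<n. info ((T ^^ j) x)) \<partial>M)"
    using integrable_Tn[OF info] by (subst Bochner_Integration.integral_sum) (auto simp: integral_Tn[OF info])
  also have "\<dots> = (\<integral>x. ln (jac n x) \<partial>M)"
    using ln_jac int by (intro integral_cong_AE) (auto elim: eventually_mono)
  also have "\<dots> \<le> label_entropy M (itinerary T d n)"
  proof (rule integral_ln_le_label_entropy)
    show "integrable M (\<lambda>x. ln (jac n x))"
      by (rule integrable_cong_AE_imp[OF int]) (use ln_jac in \<open>auto elim: eventually_mono\<close>)
    show "AE x in M. 0 < jac n x" using ln_jac by eventually_elim auto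
    show "(\<integral>\<^sup>+x\<in>{x\<in>space M. itinerary T d n x = l}. ennreal (jac n x)\<partial>M) \<le> 1" for l
      by (rule nn_integral_jac_le_1[OF d D])
  qed (use finite_itinerary_image[OF fin] sets_itinerary_fibre[OF d] in auto)
  finally show ?thesis .
qed

text \<open>The partition into branches is the witness. The labels of its itineraries are sets, and
  \<open>D\<close> recovers the branch from such a set.\<close>

lemma integral_info_le_metric_entropy:
  assumes info: "integrable M info"
  shows "ereal (\<integral>x. info x \<partial>M) \<le> metric_entropy M T"
proof -
  define P where "P = (\<lambda>b. {x\<in>space M. c x = b}) ` c ` space M"
  have P: "finite_measurable_partition M P"
    unfolding finite_measurable_partition_def
  proof (intro conjI)
    show "finite P" unfolding P_def by simp
    have "{x\<in>space M. c x = b} \<in> sets M" for b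
      by measurable
    then show "P \<subseteq> sets M" unfolding P_def by auto
    show "partition_on (space M) P"
      unfolding P_def by (rule partition_onI) (auto simp: disjnt_def)
  qed
  have part: "partition_on (space M) P" using P by (simp add: finite_measurable_partition_def)
  define D where "D A = (\<exists>x\<in>A. c x)" for A
  have D: "c x = D (cell P x)" if "x \<in> space M" for x
  proof -
    have "cell P x = {y\<in>space M. c y = c x}"
      by (rule cell_eqI[OF part]) (use that in \<open>auto simp: P_def\<close>)
    then show ?thesis using that by (auto simp: D_def)
  qed
  have "(\<integral>x. info x \<partial>M) \<le> entropy_wrt_partition M T P"
  proof (rule tendsto_lowerbound[OF entropy_wrt_partition_tendsto[OF P]])
    show "\<forall>\<^sub>F n in sequentially. (\<integral>x. info x \<partial>M) \<le> label_entropy M (itinerary T (cell P) n) / real n"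
      using eventually_ge_at_top[of "1::nat"]
    proof eventually_elim
      case (elim n)
      then show ?case
        using integral_info_le_label_entropy[OF info finite_measurable_partition_cell[OF P] D, of n]
        by (simp add: pos_le_divide_eq mult.commute)
    qed
  qed simp
  also have "ereal (entropy_wrt_partition M T P) \<le> metric_entropy M T"
    unfolding metric_entropy_def using P by (intro SUP_upper) auto
  finally show ?thesis by simp
qed

end

section \<open>Upper bound for the entropy\<close>

text \<open>For finite \<open>E\<close> these are the piecewise constant functions with breakpoints
  in \<open>E\<close> and arbitrary values on \<open>E\<close>. The form with segments fits the
  monotone branches, which map a point between two others to a point between their images.\<close>

definition step_on :: "real set \<Rightarrow> (real \<Rightarrow> 'b) \<Rightarrow> bool" where
  "step_on E f \<longleftrightarrow> (\<forall>x y. closed_segment x y \<inter> E = {} \<longrightarrow> f x = f y)"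

lemma step_onD: "step_on E f \<Longrightarrow> closed_segment x y \<inter> E = {} \<Longrightarrow> f x = f y"
  by (simp add: step_on_def)

lemma step_on_mono: "step_on E f \<Longrightarrow> E \<subseteq> E' \<Longrightarrow> step_on E' f"
  unfolding step_on_def by blast

text \<open>The number of points of \<open>F\<close> below \<open>z\<close> identifies the gap that
  contains \<open>z\<close>. One representative for each value of this counter suffices, and at most
  \<open>card F + 1\<close> values occur.\<close>

lemma grid_between:
  fixes F :: "real set"
  assumes F: "finite F" and ab: "a < b"
  obtains Y where "Y \<subseteq> {a<..<b}" "finite Y" "Y \<noteq> {}" "card Y \<le> card F + 1"
    "\<And>z. z \<in> {a<..<b} \<Longrightarrow> z \<notin> F \<Longrightarrow> \<exists>y\<in>Y. closed_segment z y \<inter> F = {}"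
proof -
  define S where "S = {a<..<b} - F"
  define key where "key z = card {e\<in>F. e < z}" for z
  define rep where "rep k = (SOME z. z \<in> S \<and> key z = k)" for k
  have rep: "rep (key z) \<in> S" "key (rep (key z)) = key z" if "z \<in> S" for z
    using someI[of "\<lambda>z'. z' \<in> S \<and> key z' = key z" z] that unfolding rep_def by auto
  have sub: "key ` S \<subseteq> {..card F}"
    unfolding key_def using F by (auto intro!: card_mono)
  then have fin: "finite (key ` S)" by (rule finite_subset) auto
  have seg: "closed_segment z y \<inter> F = {}" if zy: "z \<in> S" "y \<in> S" "key z = key y" for z y
  proof -
    have *: "closed_segment z y \<inter> F = {}" if zy: "z \<in> S" "y \<in> S" "key z = key y" "z \<le> y" for z y
    proof -
      have "{e\<in>F. e < z} = {e\<in>F. e < y}"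
        by (rule card_subset_eq) (use F zy in \<open>auto simp: key_def\<close>)
      then have eq: "e < z \<longleftrightarrow> e < y" if "e \<in> F" for e using that by blast
      have "False" if e: "e \<in> F" "z \<le> e" "e \<le> y" for e
      proof -
        have "e \<noteq> z" "e \<noteq> y" using e zy by (auto simp: S_def)
        then show False using eq[OF e(1)] e by linarith
      qed
      then show ?thesis
        using zy(4) by (auto simp: closed_segment_eq_real_ivl)
    qed
    show ?thesis
      using * zy by (metis closed_segment_commute linorder_le_cases)
  qed
  have "infinite S"
    unfolding S_def using ab F by (simp add: infinite_Ioo)
  then have "S \<noteq> {}" by auto
  show ?thesis
  proof
    show "rep ` key ` S \<subseteq> {a<..<b}" using rep by (auto simp: S_def)
    show "finite (rep ` key ` S)" using fin by auto
    show "rep ` key ` S \<noteq> {}" using \<open>S \<noteq> {}\<close> by auto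
    have "card (rep ` key ` S) \<le> card (key ` S)" by (rule card_image_le[OF fin])
    also have "\<dots> \<le> card {..card F}" by (rule card_mono[OF _ sub]) auto
    finally show "card (rep ` key ` S) \<le> card F + 1" by simp
    fix z assume "z \<in> {a<..<b}" "z \<notin> F"
    then have z: "z \<in> S" by (simp add: S_def)
    show "\<exists>y\<in>rep ` key ` S. closed_segment z y \<inter> F = {}"
      using seg[OF z rep(1)[OF z]] rep(2)[OF z] z by auto
  qed
qed

section \<open>Word weights and the comparison of entropy with a kernel\<close>

locale full_branch = branch_weights M T "\<lambda>x. 0 < x" w
  for M :: "real measure" and T w +
  fixes psi :: "bool \<Rightarrow> real \<Rightarrow> real"
  assumes sets_M: "sets M = sets (restrict_space borel {-1..1})"
    and atomless: "\<And>a. AE x in M. x \<noteq> a"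
    and T_interior: "\<And>x. -1 < x \<Longrightarrow> x < 1 \<Longrightarrow> x \<noteq> 0 \<Longrightarrow> -1 < T x \<and> T x < 1"
    and psi: "\<And>b y. -1 < y \<Longrightarrow> y < 1 \<Longrightarrow>
      -1 < psi b y \<and> psi b y < 1 \<and> psi b y \<noteq> 0 \<and> (0 < psi b y \<longleftrightarrow> b) \<and> T (psi b y) = y"
    and T_mono: "\<And>x y. -1 < x \<Longrightarrow> x \<le> y \<Longrightarrow> y < 1 \<Longrightarrow> 0 < x \<or> y < 0 \<Longrightarrow> T x \<le> T y"
begin

text \<open>\<open>word_weight s r as y\<close> sums, over all \<open>x\<close> with \<open>(T ^^ length as) x = y\<close>, the weight that the branch
  probabilities \<open>s\<close> and the emission probabilities \<open>r\<close> give to emitting the reversed word along the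
  orbit of \<open>x\<close>.\<close>

primrec word_weight :: "(bool \<Rightarrow> real \<Rightarrow> real) \<Rightarrow> ('l \<Rightarrow> real \<Rightarrow> real) \<Rightarrow> 'l list \<Rightarrow> real \<Rightarrow> real" where
  "word_weight s r [] y = 1"
| "word_weight s r (a # as) y = (\<Sum>b\<in>UNIV. s b y * r a (psi b y) * word_weight s r as (psi b y))"

text \<open>Two points of one branch cylinder of length \<open>n\<close> whose images under \<open>T ^^ n\<close> are not separated by
  \<open>cuts E n\<close> have orbits that are never separated by \<open>E\<close>. The number of cuts grows only linearly in
  \<open>n\<close>, which makes it unnecessary that the branch partition generates.\<close>

primrec cuts :: "real set \<Rightarrow> nat \<Rightarrow> real set" where
  "cuts E 0 = E"
| "cuts E (Suc n) = E \<union> T ` cuts E n"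

lemma finite_cuts: "finite E \<Longrightarrow> finite (cuts E n)"
  by (induction n) auto

text \<open>A forward image never has more points than the set itself, so each step adds at most
  \<open>card E\<close> points.\<close>

lemma card_cuts: "finite E \<Longrightarrow> card (cuts E n) \<le> (n + 1) * card E"
proof (induction n)
  case (Suc n)
  have "card (cuts E (Suc n)) \<le> card E + card (T ` cuts E n)"
    by (simp add: card_Un_le)
  also have "\<dots> \<le> card E + card (cuts E n)"
    using finite_cuts[OF Suc.prems] by (simp add: card_image_le)
  finally show ?case using Suc by simp
qed simp

lemma subset_cuts: "E \<subseteq> cuts E n"
  by (cases n) auto

lemma word_weight_nonneg:
  assumes "\<And>b y. 0 \<le> s b y" "\<And>a x. 0 \<le> r a x"
  shows "0 \<le> word_weight s r as y"
  using assms by (induction as arbitrary: y) (auto intro!: sum_nonneg mult_nonneg_nonneg)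

text \<open>One step distributes mass at most 1 over branches and letters, and the sum over words
  factors letter by letter. The bound holds for every end point \<open>y\<close>, which permits
  averaging over \<open>y\<close> later.\<close>

lemma sum_word_weight_le_1:
  assumes L: "finite L" and s: "\<And>b y. 0 \<le> s b y" "\<And>y. (\<Sum>b\<in>UNIV. s b y) \<le> 1"
    and r: "\<And>a x. 0 \<le> r a x" "\<And>x. (\<Sum>a\<in>L. r a x) \<le> 1"
  shows "(\<Sum>as\<in>{as. set as \<subseteq> L \<and> length as = n}. word_weight s r as y) \<le> 1"
proof (induction n arbitrary: y)
  case 0
  have "{as. set as \<subseteq> L \<and> length as = 0} = {[]}" by auto
  then show ?case by simp
next
  case (Suc n)
  let ?S = "{as. set as \<subseteq> L \<and> length as = n}"
  have "(\<Sum>as\<in>{as. set as \<subseteq> L \<and> length as = Suc n}. word_weight s r as y) =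
    (\<Sum>(as, a)\<in>?S \<times> L. word_weight s r (a # as) y)"
    unfolding lists_length_Suc_eq by (subst sum.reindex) (auto simp: inj_on_def intro!: sum.cong)
  also have "\<dots> = (\<Sum>b\<in>UNIV. s b y * (\<Sum>a\<in>L. r a (psi b y)) * (\<Sum>as\<in>?S. word_weight s r as (psi b y)))"
  proof -
    have "(\<Sum>(as, a)\<in>?S \<times> L. word_weight s r (a # as) y) =
      (\<Sum>(as, a)\<in>?S \<times> L. \<Sum>b\<in>UNIV. s b y * (r a (psi b y) * word_weight s r as (psi b y)))"
      by (simp add: mult.assoc)
    also have "\<dots> = (\<Sum>b\<in>UNIV. \<Sum>(as, a)\<in>?S \<times> L. s b y * (r a (psi b y) * word_weight s r as (psi b y)))"
      unfolding case_prod_beta by (rule sum.swap)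
    also have "\<dots> = (\<Sum>b\<in>UNIV. s b y * ((\<Sum>a\<in>L. r a (psi b y)) * (\<Sum>as\<in>?S. word_weight s r as (psi b y))))"
    proof (intro sum.cong refl)
      fix b
      have "(\<Sum>(as, a)\<in>?S \<times> L. s b y * (r a (psi b y) * word_weight s r as (psi b y))) =
        (\<Sum>a\<in>L. \<Sum>as\<in>?S. s b y * (r a (psi b y) * word_weight s r as (psi b y)))"
        unfolding sum.cartesian_product[symmetric] by (rule sum.swap)
      then show "(\<Sum>(as, a)\<in>?S \<times> L. s b y * (r a (psi b y) * word_weight s r as (psi b y))) =
        s b y * ((\<Sum>a\<in>L. r a (psi b y)) * (\<Sum>as\<in>?S. word_weight s r as (psi b y)))"
        by (subst sum_product) (simp only: sum_distrib_left)
    qed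
    finally show ?thesis by (simp add: mult.assoc)
  qed
  also have "\<dots> \<le> (\<Sum>b\<in>UNIV. s b y * 1 * 1)"
    by (intro sum_mono mult_mono r s Suc mult_nonneg_nonneg sum_nonneg word_weight_nonneg) auto
  also have "\<dots> \<le> 1" using s(2) by simp
  finally show ?case .
qed

text \<open>Of all inverse orbits of \<open>y\<close> only the one that follows the branches of the
  orbit of \<open>x\<close> is kept. No breakpoint separates the two orbits, so the step functions
  take the same values along both.\<close>

lemma word_weight_ge:
  assumes s: "\<And>b y. 0 \<le> s b y" "\<And>b. step_on E (s b)"
    and r: "\<And>a x. 0 \<le> r a x" "\<And>a. step_on E (r a)"
    and x: "\<And>j. (T ^^ j) x \<in> {-1<..<1} - {0}"
    and y: "y \<in> {-1<..<1}" "closed_segment ((T ^^ n) x) y \<inter> cuts E n = {}"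
  shows "(\<Prod>j<n. s (0 < (T ^^ j) x) (T ((T ^^ j) x)) * r (d ((T ^^ j) x)) ((T ^^ j) x))
    \<le> word_weight s r (itinerary T d n x) y"
  using y
proof (induction n arbitrary: y)
  case 0
  then show ?case by simp
next
  case (Suc n)
  define z where "z = (T ^^ n) x"
  define b where "b = (0 < z)"
  define y' where "y' = psi b y"
  have z: "-1 < z" "z < 1" "z \<noteq> 0" using x[of n] by (auto simp: z_def)
  have y': "-1 < y'" "y' < 1" "y' \<noteq> 0" "0 < y' \<longleftrightarrow> b" "T y' = y"
    using psi[of y b] Suc.prems(1) by (auto simp: y'_def)
  \<comment> \<open>A cut between \<open>z\<close> and \<open>y'\<close> would be carried by the
    monotone branch to a point of \<open>cuts E (Suc n)\<close> between \<open>T z\<close> and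
    \<open>y\<close>.\<close>
  have seg: "closed_segment z y' \<inter> cuts E n = {}"
  proof (rule ccontr)
    assume "closed_segment z y' \<inter> cuts E n \<noteq> {}"
    then obtain e where e: "e \<in> closed_segment z y'" "e \<in> cuts E n" by auto
    have "T e \<in> closed_segment (T z) (T y')"
    proof (cases "z \<le> y'")
      case True
      then have "z \<le> e" "e \<le> y'" using e by (auto simp: closed_segment_eq_real_ivl)
      moreover have "T z \<le> T e" "T e \<le> T y'"
        using T_mono[of z e] T_mono[of e y'] calculation z y' unfolding b_def by auto
      ultimately show ?thesis by (auto simp: closed_segment_eq_real_ivl)
    next
      case False
      then have "y' \<le> e" "e \<le> z" using e by (auto simp: closed_segment_eq_real_ivl split: if_splits)
      moreover have "T y' \<le> T e" "T e \<le> T z"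
        using T_mono[of y' e] T_mono[of e z] calculation z y' unfolding b_def by auto
      ultimately show ?thesis by (auto simp: closed_segment_eq_real_ivl)
    qed
    then show False
      using Suc.prems(2) e(2) y'(5) by (auto simp: z_def)
  qed
  have "s b (T z) = s b y"
    using Suc.prems(2) subset_cuts[of E "Suc n"]
    by (intro step_onD[OF s(2)]) (auto simp: z_def)
  moreover have "r (d z) z = r (d z) y'"
    using seg subset_cuts[of E n] by (intro step_onD[OF r(2)]) auto
  moreover have "(\<Prod>j<n. s (0 < (T ^^ j) x) (T ((T ^^ j) x)) * r (d ((T ^^ j) x)) ((T ^^ j) x))
    \<le> word_weight s r (itinerary T d n x) y'"
    by (rule Suc.IH) (use y' seg in \<open>auto simp: z_def\<close>)
  ultimately have "(\<Prod>j<Suc n. s (0 < (T ^^ j) x) (T ((T ^^ j) x)) * r (d ((T ^^ j) x)) ((T ^^ j) x))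
    \<le> s b y * r (d z) y' * word_weight s r (itinerary T d n x) y'"
    using s(1) r(1)
    by (simp add: z_def[symmetric] b_def[symmetric] mult.commute mult_left_mono mult_right_mono)
  also have "\<dots> \<le> word_weight s r (itinerary T d (Suc n) x) y"
    unfolding itinerary.simps word_weight.simps z_def[symmetric] y'_def
    by (rule member_le_sum[of b UNIV "\<lambda>b. s b y * r (d z) (psi b y) * word_weight s r (itinerary T d n x) (psi b y)"])
      (auto intro!: mult_nonneg_nonneg s r word_weight_nonneg)
  finally show ?case .
qed

lemma AE_orbit_avoids:
  assumes "countable S"
  shows "AE x in M. \<forall>j. (T ^^ j) x \<notin> S"
proof -
  have "AE x in M. \<forall>a\<in>S. x \<noteq> a"
    using atomless assms by (subst AE_ball_countable) auto
  then have "AE x in M. x \<notin> S" by eventually_elim auto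
  then show ?thesis using AE_Tn[of "\<lambda>x. x \<notin> S"] by (simp add: AE_all_countable)
qed

lemma space_M: "space M = {-1..1}"
  using sets_eq_imp_space_eq[OF sets_M] by (simp add: space_restrict_space)

text \<open>Gibbs' inequality with word weights averaged over one end point per gap of
  \<open>cuts E n\<close>. Every orbit end is matched by some grid point, at the price of the factor
  \<open>card Y\<close>; \<open>\<kappa>\<close> bounds the cost of one time step, and invariance
  adds these costs up.\<close>

lemma label_entropy_le_kernel:
  assumes fin: "finite (d ` space M)" and d: "\<And>a. {x\<in>space M. d x = a} \<in> sets M"
    and E: "finite E"
    and s: "\<And>b y. 0 < s b y" "\<And>b. step_on E (s b)" "\<And>y. (\<Sum>b\<in>UNIV. s b y) \<le> 1"
    and r: "\<And>a x. 0 < r a x" "\<And>a. step_on E (r a)" "\<And>x. (\<Sum>a\<in>d ` space M. r a x) \<le> 1"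
    and \<kappa>: "integrable M \<kappa>" "AE x in M. - ln (s (0 < x) (T x)) - ln (r (d x) x) \<le> \<kappa> x"
  shows "label_entropy M (itinerary T d n) \<le> ln (real ((n + 1) * card E + 1)) + real n * (\<integral>x. \<kappa> x \<partial>M)"
proof -
  note s0 = less_imp_le[OF s(1)] and r0 = less_imp_le[OF r(1)]
  obtain Y where Y: "Y \<subseteq> {-1<..<1}" "finite Y" "Y \<noteq> {}" "card Y \<le> card (cuts E n) + 1"
    "\<And>z. z \<in> {-1<..<1} \<Longrightarrow> z \<notin> cuts E n \<Longrightarrow> \<exists>y\<in>Y. closed_segment z y \<inter> cuts E n = {}"
    using grid_between[OF finite_cuts[OF E], of "-1" 1 n] by auto
  have cY: "0 < card Y" using Y(2,3) by (simp add: card_gt_0_iff)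
  define q where "q l = (\<Sum>y\<in>Y. word_weight s r l y) / real (card Y)" for l
  define B where "B x = ln (real (card Y)) + (\<Sum>j<n. \<kappa> ((T ^^ j) x))" for x
  have int: "integrable M (\<lambda>x. \<Sum>j<n. \<kappa> ((T ^^ j) x))"
    using integrable_Tn[OF \<kappa>(1)] by (intro Bochner_Integration.integrable_sum) auto
  have "label_entropy M (itinerary T d n) \<le> (\<integral>x. B x \<partial>M)"
  proof (rule label_entropy_le_integral[OF finite_itinerary_image[OF fin] sets_itinerary_fibre[OF d], where q = q])
    show "0 \<le> q l" for l
      unfolding q_def by (intro divide_nonneg_nonneg sum_nonneg word_weight_nonneg s0 r0) auto
    show "integrable M B" unfolding B_def using int by simp
    let ?S = "{as. set as \<subseteq> d ` space M \<and> length as = n}"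
    have "itinerary T d n ` space M \<subseteq> ?S"
      using set_itinerary[of "space M" T d "d ` space M"] measurable_space[OF T] by auto
    then have "(\<Sum>l\<in>itinerary T d n ` space M. q l) \<le> (\<Sum>l\<in>?S. q l)"
      using finite_lists_length_eq[OF fin, of n]
      by (intro sum_mono2)
        (auto simp: q_def intro!: divide_nonneg_nonneg sum_nonneg word_weight_nonneg s0 r0)
    also have "\<dots> = (\<Sum>y\<in>Y. \<Sum>l\<in>?S. word_weight s r l y) / real (card Y)"
      unfolding q_def by (subst sum.swap) (simp add: sum_divide_distrib)
    also have "\<dots> \<le> (\<Sum>y\<in>Y. 1) / real (card Y)"
      by (intro divide_right_mono sum_mono sum_word_weight_le_1 fin s0 r0 s r) auto
    also have "\<dots> = 1" using cY by simp
    finally show "(\<Sum>l\<in>itinerary T d n ` space M. q l) \<le> 1" .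
    have "AE x in M. \<forall>j. - ln (s (0 < (T ^^ j) x) (T ((T ^^ j) x))) - ln (r (d ((T ^^ j) x)) ((T ^^ j) x)) \<le> \<kappa> ((T ^^ j) x)"
      using AE_Tn[OF \<kappa>(2)] by (simp add: AE_all_countable)
    moreover have "AE x in M. \<forall>j. (T ^^ j) x \<notin> {-1, 0, 1} \<union> cuts E n"
      using finite_cuts[OF E] by (intro AE_orbit_avoids countable_finite) auto
    ultimately show "AE x in M. 0 < q (itinerary T d n x) \<and> - ln (q (itinerary T d n x)) \<le> B x"
      using AE_space
    proof eventually_elim
      case (elim x)
      define P where "P = (\<Prod>j<n. s (0 < (T ^^ j) x) (T ((T ^^ j) x)) * r (d ((T ^^ j) x)) ((T ^^ j) x))"
      have good: "(T ^^ j) x \<in> {-1<..<1} - {0}" for j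
      proof -
        have "(T ^^ j) x \<in> {-1..1}" using Tn_space[OF elim(3)] by (simp add: space_M)
        moreover have "(T ^^ j) x \<notin> {-1, 0, 1}" using elim(2) by blast
        ultimately show ?thesis by auto
      qed
      obtain y where y: "y \<in> Y" "closed_segment ((T ^^ n) x) y \<inter> cuts E n = {}"
        using Y(5)[of "(T ^^ n) x"] good[of n] elim(2) by auto
      have Ppos: "0 < P" unfolding P_def by (intro prod_pos) (simp add: s r)
      have "P \<le> word_weight s r (itinerary T d n x) y"
        unfolding P_def by (rule word_weight_ge) (use s s0 r r0 good y Y(1) in auto)
      also have "\<dots> \<le> (\<Sum>y\<in>Y. word_weight s r (itinerary T d n x) y)"
        by (rule member_le_sum) (use y Y in \<open>auto intro!: word_weight_nonneg s0 r0\<close>)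
      finally have q: "P / real (card Y) \<le> q (itinerary T d n x)"
        unfolding q_def by (rule divide_right_mono) auto
      have pos: "0 < P / real (card Y)" using Ppos cY by simp
      have "- ln (q (itinerary T d n x)) \<le> - ln (P / real (card Y))"
        using q pos by simp
      also have "\<dots> = ln (real (card Y)) - ln P"
        using Ppos cY by (simp add: ln_div)
      also have "ln P = (\<Sum>j<n. ln (s (0 < (T ^^ j) x) (T ((T ^^ j) x)) * r (d ((T ^^ j) x)) ((T ^^ j) x)))"
        unfolding P_def by (rule ln_prod) (auto simp: s r less_imp_neq[THEN not_sym])
      also have "\<dots> = (\<Sum>j<n. ln (s (0 < (T ^^ j) x) (T ((T ^^ j) x))) + ln (r (d ((T ^^ j) x)) ((T ^^ j) x)))"
        by (intro sum.cong refl ln_mult_pos s r)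
      also have "ln (real (card Y)) - \<dots> \<le> B x"
      proof -
        have "- (\<Sum>j<n. ln (s (0 < (T ^^ j) x) (T ((T ^^ j) x))) + ln (r (d ((T ^^ j) x)) ((T ^^ j) x)))
          \<le> (\<Sum>j<n. \<kappa> ((T ^^ j) x))"
          unfolding sum_negf[symmetric]
        proof (rule sum_mono)
          fix j
          show "- (ln (s (0 < (T ^^ j) x) (T ((T ^^ j) x))) + ln (r (d ((T ^^ j) x)) ((T ^^ j) x))) \<le> \<kappa> ((T ^^ j) x)"
            using elim(1)[rule_format, of j] by linarith
        qed
        then show ?thesis by (simp add: B_def)
      qed
      finally show ?case using pos q by simp
    qed
  qed
  also have "\<dots> = ln (real (card Y)) + real n * (\<integral>x. \<kappa> x \<partial>M)"
    unfolding B_def using int integrable_Tn[OF \<kappa>(1)]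
    by (simp add: prob_space Bochner_Integration.integral_sum integral_Tn[OF \<kappa>(1)])
  also have "\<dots> \<le> ln (real ((n + 1) * card E + 1)) + real n * (\<integral>x. \<kappa> x \<partial>M)"
  proof -
    have "card Y \<le> (n + 1) * card E + 1" using Y(4) card_cuts[OF E, of n] by linarith
    then have "ln (real (card Y)) \<le> ln (real ((n + 1) * card E + 1))"
      using cY by (subst ln_le_cancel_iff) (auto simp del: of_nat_add of_nat_mult)
    then show ?thesis by simp
  qed
  finally show ?thesis .
qed

lemma entropy_wrt_partition_le_kernel:
  assumes Q: "finite_measurable_partition M Q"
    and E: "finite E"
    and s: "\<And>b y. 0 < s b y" "\<And>b. step_on E (s b)" "\<And>y. (\<Sum>b\<in>UNIV. s b y) \<le> 1"
    and r: "\<And>a x. 0 < r a x" "\<And>a. step_on E (r a)" "\<And>x. (\<Sum>a\<in>cell Q ` space M. r a x) \<le> 1"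
    and \<kappa>: "integrable M \<kappa>" "AE x in M. - ln (s (0 < x) (T x)) - ln (r (cell Q x) x) \<le> \<kappa> x"
  shows "entropy_wrt_partition M T Q \<le> (\<integral>x. \<kappa> x \<partial>M)"
proof -
  let ?I = "\<integral>x. \<kappa> x \<partial>M"
  define K where "K = real (2 * card E + 1)"
  have "(\<lambda>n. ln (real n) / real n + ln K / real n + ?I) \<longlonglongrightarrow> 0 + 0 + ?I"
    by (intro tendsto_intros lim_ln_over_n lim_const_over_n)
  then have lim: "(\<lambda>n. ln (real n) / real n + ln K / real n + ?I) \<longlonglongrightarrow> ?I" by simp
  show ?thesis
  proof (rule tendsto_le[OF _ lim entropy_wrt_partition_tendsto[OF Q]])
    show "\<forall>\<^sub>F n in sequentially. label_entropy M (itinerary T (cell Q) n) / real n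
      \<le> ln (real n) / real n + ln K / real n + ?I"
      using eventually_ge_at_top[of "1::nat"]
    proof eventually_elim
      case (elim n)
      \<comment> \<open>A crude product form of the linear bound, so that its logarithm splits into
        \<open>ln n\<close> and a constant.\<close>
      have "(n + 1) * card E + 1 \<le> n * (2 * card E + 1)"
        using elim by (cases n) auto
      then have "real ((n + 1) * card E + 1) \<le> real n * K"
        unfolding K_def of_nat_mult[symmetric] of_nat_le_iff .
      moreover have "0 < real ((n + 1) * card E + 1)" by (simp del: of_nat_add of_nat_mult)
      ultimately have "ln (real ((n + 1) * card E + 1)) \<le> ln (real n * K)"
        by (metis ln_le_cancel_iff order_less_le_trans)
      also have "\<dots> = ln (real n) + ln K"
        using elim by (intro ln_mult_pos) (auto simp: K_def)
      finally have "label_entropy M (itinerary T (cell Q) n) \<le> ln (real n) + ln K + real n * ?I"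
        using label_entropy_le_kernel[OF finite_measurable_partition_cell[OF Q] E s r \<kappa>, of n]
        by linarith
      then show ?case
        using elim by (simp add: divide_simps algebra_simps)
    qed
  qed simp
qed

end

section \<open>Approximation by step functions\<close>

lemma step_on_indicator_ball:
  fixes x r :: real
  shows "step_on {x - r, x + r} (indicator (ball x r) :: real \<Rightarrow> real)"
  unfolding step_on_def
proof (intro allI impI)
  fix y z assume "closed_segment y z \<inter> {x - r, x + r} = {}"
  then have "x - r \<notin> closed_segment y z" "x + r \<notin> closed_segment y z" by blast+
  then have "y \<in> ball x r \<longleftrightarrow> z \<in> ball x r"
    unfolding ball_eq_greaterThanLessThan closed_segment_eq_real_ivl
    by (cases "y \<le> z") (simp_all, linarith+)
  then show "indicator (ball x r) y = (indicator (ball x r) z :: real)"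
    by (simp add: indicator_def)
qed

lemma step_on_indicator_Union:
  assumes "\<And>i. i \<in> I \<Longrightarrow> step_on E (indicator (A i) :: real \<Rightarrow> real)"
  shows "step_on E (indicator (\<Union>i\<in>I. A i) :: real \<Rightarrow> real)"
  unfolding step_on_def
proof (intro allI impI)
  fix x y :: real assume xy: "closed_segment x y \<inter> E = {}"
  have "x \<in> A i \<longleftrightarrow> y \<in> A i" if "i \<in> I" for i
    using step_onD[OF assms[OF that] xy] by (auto simp: indicator_def split: if_splits)
  then show "indicator (\<Union>i\<in>I. A i) x = (indicator (\<Union>i\<in>I. A i) y :: real)"
    by (auto simp: indicator_def)
qed

text \<open>The shift by \<open>\<epsilon>\<close> makes the loss linear in the error
  \<open>\<bar>t - u\<bar>\<close>, even where the approximation \<open>u\<close> vanishes or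
  \<open>t\<close> is tiny, so that smallness in L1 suffices. The proof compares
  \<open>u + \<epsilon>\<close> with \<open>t + \<epsilon>\<close>.\<close>

lemma neg_ln_shift_le:
  fixes u t \<epsilon> :: real
  assumes "0 < \<epsilon>" "0 \<le> u" "0 < t"
  shows "- ln (u + \<epsilon>) \<le> - ln t + \<bar>t - u\<bar> / \<epsilon>"
proof -
  have "ln t - ln (u + \<epsilon>) \<le> ln (t + \<epsilon>) - ln (u + \<epsilon>)"
    using assms by simp
  also have "\<dots> = ln ((t + \<epsilon>) / (u + \<epsilon>))"
    using assms by (simp add: ln_div)
  also have "\<dots> \<le> (t + \<epsilon>) / (u + \<epsilon>) - 1"
    using assms by (intro ln_le_minus_one) auto
  also have "\<dots> = (t - u) / (u + \<epsilon>)"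
    using assms by (simp add: field_simps)
  also have "\<dots> \<le> \<bar>t - u\<bar> / (u + \<epsilon>)"
    using assms by (intro divide_right_mono) auto
  also have "\<dots> \<le> \<bar>t - u\<bar> / \<epsilon>"
    using assms by (intro divide_left_mono) auto
  finally show ?thesis by linarith
qed

context full_branch
begin

lemma measurable_M_borel: "f \<in> borel_measurable borel \<Longrightarrow> f \<in> borel_measurable M"
  unfolding measurable_cong_sets[OF sets_M refl] by (rule measurable_restrict_space1)

lemma sets_M_borel: "A \<in> sets M \<Longrightarrow> A \<in> sets borel"
  using sets_M by (auto simp: sets_restrict_space)

text \<open>Regularity encloses \<open>A\<close> between a compact \<open>K\<close> and an open
  \<open>U\<close> of nearly the same measure. Finitely many intervals in \<open>U\<close> cover
  \<open>K\<close>, and the indicator of their union is the step function.\<close>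

lemma step_approx_indicator:
  assumes A: "A \<in> sets M" and \<delta>: "0 < \<delta>"
  shows "\<exists>E v. finite E \<and> step_on E v \<and> v \<in> borel_measurable borel \<and> (\<forall>x. 0 \<le> v x \<and> v x \<le> 1) \<and>
    (\<integral>x. \<bar>indicator A x - v x\<bar> \<partial>M) < (\<delta>::real)"
proof -
  have id [measurable]: "(\<lambda>x. x) \<in> M \<rightarrow>\<^sub>M borel" by (rule measurable_M_borel) auto
  \<comment> \<open>Regularity is stated for measures on the Borel sets of a whole space, so
    \<open>M\<close> is pushed forward to the line.\<close>
  define N where "N = distr M borel (\<lambda>x. x)"
  interpret N: prob_space N unfolding N_def by (rule prob_space_distr) auto
  have sN: "sets N = sets borel" by (simp add: N_def)
  note Ab = sets_M_borel[OF A]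
  have eN: "emeasure N A \<noteq> \<infinity>" "emeasure N (space N) \<noteq> \<infinity>" by (auto simp: N.emeasure_eq_measure)
  have "\<exists>K. K \<subseteq> A \<and> compact K \<and> measure N A < measure N K + \<delta> / 2"
  \<comment> \<open>The case split keeps \<open>measure N A - \<delta> / 2\<close> nonnegative,
    because \<open>ennreal\<close> sends negative numbers to 0.\<close>
  proof (cases "measure N A < \<delta> / 2")
    case True
    then show ?thesis by (intro exI[of _ "{}"]) auto
  next
    case False
    have "ennreal (measure N A - \<delta> / 2) < emeasure N A"
      using \<delta> False by (simp add: N.emeasure_eq_measure ennreal_less_iff)
    also have "emeasure N A = (SUP K\<in>{K. K \<subseteq> A \<and> compact K}. emeasure N K)"
      by (rule inner_regular[OF sN eN(2) Ab])
    finally obtain K where K: "K \<subseteq> A" "compact K" "ennreal (measure N A - \<delta> / 2) < emeasure N K"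
      by (auto simp: less_SUP_iff)
    then have "measure N A - \<delta> / 2 < measure N K"
      using False by (simp add: N.emeasure_eq_measure ennreal_less_iff)
    then show ?thesis using K by (intro exI[of _ K]) auto
  qed
  then obtain K where K: "K \<subseteq> A" "compact K" "measure N A < measure N K + \<delta> / 2" by auto
  have "emeasure N A < ennreal (measure N A + \<delta> / 2)"
    using \<delta> by (simp add: N.emeasure_eq_measure ennreal_less_iff)
  then obtain U where U: "A \<subseteq> U" "open U" "emeasure N U < ennreal (measure N A + \<delta> / 2)"
    unfolding outer_regular[OF sN eN(2) Ab] by (auto simp: INF_less_iff)
  then have mU: "measure N U < measure N A + \<delta> / 2"
    using \<delta> by (simp add: N.emeasure_eq_measure ennreal_less_iff del: ennreal_plus)
  have "\<forall>x\<in>K. \<exists>r>0. ball x r \<subseteq> U"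
    using U K(1) open_contains_ball by blast
  then obtain r where r: "\<And>x. x \<in> K \<Longrightarrow> r x > 0 \<and> ball x (r x) \<subseteq> U" by metis
  obtain D where D: "D \<subseteq> K" "finite D" "K \<subseteq> (\<Union>x\<in>D. ball x (r x))"
    by (rule compactE_image[OF K(2), of K "\<lambda>x. ball x (r x)"]) (use r in auto)
  define V where "V = (\<Union>x\<in>D. ball x (r x))"
  define E where "E = (\<Union>x\<in>D. {x - r x, x + r x})"
  have V: "K \<subseteq> V" "V \<subseteq> U" using D r by (auto simp: V_def subset_eq)
  have Vb [measurable]: "V \<in> sets borel" unfolding V_def by (intro borel_open open_UN ballI open_ball)
  have Ub [measurable]: "U \<in> sets borel" using U by auto
  have Kb [measurable]: "K \<in> sets borel" using K(2) by (intro borel_closed compact_imp_closed)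
  have "step_on E (indicator V :: real \<Rightarrow> real)"
    unfolding V_def
    by (rule step_on_indicator_Union) (rule step_on_mono[OF step_on_indicator_ball], auto simp: E_def)
  moreover have "(\<integral>x. \<bar>indicator A x - indicator V x\<bar> \<partial>M) < \<delta>"
  proof -
    have "(\<integral>x. \<bar>indicator A x - indicator V x\<bar> \<partial>M) = (\<integral>x. \<bar>indicator A x - indicator V x :: real\<bar> \<partial>N)"
      proof -
      have "(\<lambda>x. \<bar>indicator A x - indicator V x\<bar> :: real) \<in> borel_measurable borel"
        using Ab by measurable
      then show ?thesis unfolding N_def by (subst integral_distr[OF id]) auto
    qed
    \<comment> \<open>Both \<open>A\<close> and \<open>V\<close> lie between \<open>K\<close> and
      \<open>U\<close>, so they can differ only on \<open>U - K\<close>.\<close>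
    also have "\<dots> \<le> (\<integral>x. indicator (U - K) x \<partial>N)"
    proof (rule integral_mono_AE)
      show "integrable N (\<lambda>x. \<bar>indicator A x - indicator V x :: real\<bar>)"
        by (rule N.integrable_const_bound[of _ 1]) (use Ab in \<open>auto simp: indicator_def N_def\<close>)
      show "integrable N (\<lambda>x. indicator (U - K) x :: real)"
        by (rule N.integrable_const_bound[of _ 1]) (auto simp: indicator_def N_def)
      show "AE x in N. \<bar>indicator A x - indicator V x\<bar> \<le> (indicator (U - K) x :: real)"
        using K(1) U(1) V by (intro AE_I2) (auto simp: indicator_def)
    qed
    also have "\<dots> = measure N (U - K)" by (simp add: sN)
    also have "\<dots> = measure N U - measure N K"
      using K(1) U(1) by (intro N.finite_measure_Diff) (auto simp: sN)
    also have "\<dots> < \<delta>" using mU K(3) by linarith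
    finally show ?thesis .
  qed
  moreover have "finite E" using D(2) by (auto simp: E_def)
  ultimately show ?thesis
    by (intro exI[of _ E] exI[of _ "indicator V"]) (auto simp: indicator_def)
qed

text \<open>Layers: the mean of the indicators of the sets \<open>real k \<le> real n * f x\<close>
  for \<open>k = 1, ..., n\<close> is \<open>f\<close> rounded down to a multiple of
  \<open>1 / n\<close>. This reduces the claim to indicators.\<close>

lemma step_approx:
  assumes f [measurable]: "f \<in> borel_measurable M" and f01: "\<And>x. x \<in> space M \<Longrightarrow> 0 \<le> f x \<and> f x \<le> 1"
    and \<delta>: "0 < \<delta>"
  shows "\<exists>E v. finite E \<and> step_on E v \<and> v \<in> borel_measurable borel \<and> (\<forall>x. 0 \<le> v x \<and> v x \<le> 1) \<and>
    (\<integral>x. \<bar>f x - v x\<bar> \<partial>M) < (\<delta>::real)"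
proof -
  obtain n :: nat where n: "0 < n" "1 / real n < \<delta> / 2"
    using \<delta> by (metis half_gt_zero nat_approx_posE of_nat_Suc zero_less_Suc)
  define A where "A k = {x\<in>space M. real k \<le> real n * f x}" for k
  have A: "A k \<in> sets M" for k unfolding A_def by measurable
  have "\<forall>k. \<exists>E u. finite E \<and> step_on E u \<and> u \<in> borel_measurable borel \<and> (\<forall>x. 0 \<le> u x \<and> u x \<le> 1) \<and>
    (\<integral>x. \<bar>indicator (A k) x - u x\<bar> \<partial>M) < \<delta> / 2"
    using step_approx_indicator[OF A half_gt_zero[OF \<delta>]] by blast
  then obtain E1 u where E1: "\<And>k. finite (E1 k)" and u: "\<And>k. step_on (E1 k) (u k)"
    "\<And>k. u k \<in> borel_measurable borel" and u01: "\<And>k x. 0 \<le> u k x \<and> u k x \<le> 1"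
    and ui: "\<And>k. (\<integral>x. \<bar>indicator (A k) x - u k x\<bar> \<partial>M) < \<delta> / 2"
    by metis
  define E where "E = (\<Union>k\<in>{1..n}. E1 k)"
  define v where "v x = (\<Sum>k=1..n. u k x) / real n" for x
  have uM [measurable]: "u k \<in> borel_measurable M" for k
    by (rule measurable_M_borel[OF u(2)])
  have A' [measurable]: "A k \<in> sets M" for k by (rule A)
  have v01: "0 \<le> v x \<and> v x \<le> 1" for x
  proof -
    have "(\<Sum>k=1..n. u k x) \<le> (\<Sum>k=1..n. 1)" by (rule sum_mono) (use u01 in auto)
    moreover have "0 \<le> (\<Sum>k=1..n. u k x)" by (rule sum_nonneg) (use u01 in auto)
    ultimately show ?thesis
      unfolding v_def using n by (simp add: divide_le_eq)
  qed
  have step: "step_on E v"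
    unfolding step_on_def
  proof (intro allI impI)
    fix x y assume xy: "closed_segment x y \<inter> E = {}"
    have "u k x = u k y" if "k \<in> {1..n}" for k
    proof (rule step_onD[OF step_on_mono[OF u(1)] xy])
      show "E1 k \<subseteq> E" using that by (auto simp: E_def)
    qed
    then show "v x = v y" by (simp add: v_def)
  qed
  have vb: "v \<in> borel_measurable borel"
    unfolding v_def using u(2) by measurable
  have vM [measurable]: "v \<in> borel_measurable M" by (rule measurable_M_borel[OF vb])
  have floor: "\<bar>f x - (\<Sum>k=1..n. indicator (A k) x) / real n\<bar> \<le> 1 / real n" if x: "x \<in> space M" for x
  proof -
    define m where "m = nat \<lfloor>real n * f x\<rfloor>"
    have nf: "0 \<le> real n * f x" "real n * f x \<le> real n"
      using f01[OF x] n by (auto simp: mult_left_le)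
    then have m: "real m \<le> real n * f x" "real n * f x < real m + 1" "m \<le> n"
      unfolding m_def by linarith+
    have "(\<Sum>k=1..n. indicator (A k) x) = (\<Sum>k=1..n. if k \<le> m then 1 else (0::real))"
    proof (intro sum.cong refl)
      fix k
      have "real k \<le> real n * f x \<longleftrightarrow> k \<le> m"
        using m by linarith
      then show "indicator (A k) x = (if k \<le> m then 1 else (0::real))"
        using x by (simp add: A_def)
    qed
    also have "\<dots> = real (card ({1..n} \<inter> {k. k \<le> m}))"
      by (simp add: sum.If_cases)
    also have "{1..n} \<inter> {k. k \<le> m} = {1..m}" using m(3) by auto
    finally have "(\<Sum>k=1..n. indicator (A k) x) = real m" by simp
    moreover have "\<bar>f x - real m / real n\<bar> \<le> 1 / real n"
    proof -
      have "f x = real n * f x / real n" using n by simp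
      then have "\<bar>f x - real m / real n\<bar> = \<bar>real n * f x - real m\<bar> / real n"
        by (metis abs_divide abs_of_nat diff_divide_distrib)
      also have "\<dots> \<le> 1 / real n"
        using m by (intro divide_right_mono) auto
      finally show ?thesis .
    qed
    ultimately show ?thesis by simp
  qed
  have intu: "integrable M (\<lambda>x. \<bar>indicator (A k) x - u k x\<bar>)" for k
    by (rule integrable_const_bound[of _ 1]) (use u01 in \<open>auto simp: indicator_def\<close>)
  have "(\<integral>x. \<bar>f x - v x\<bar> \<partial>M) \<le> (\<integral>x. 1 / real n + (\<Sum>k=1..n. \<bar>indicator (A k) x - u k x\<bar>) / real n \<partial>M)"
  proof (rule integral_mono)
    have "\<bar>f x - v x\<bar> \<le> 1" if "x \<in> space M" for x
      using f01[OF that] v01[of x] by auto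
    then show "integrable M (\<lambda>x. \<bar>f x - v x\<bar>)"
      by (intro integrable_const_bound[of _ 1]) auto
    show "integrable M (\<lambda>x. 1 / real n + (\<Sum>k=1..n. \<bar>indicator (A k) x - u k x\<bar>) / real n)"
      using intu by auto
    fix x assume x: "x \<in> space M"
    have "\<bar>(\<Sum>k=1..n. indicator (A k) x) / real n - v x\<bar> = \<bar>\<Sum>k=1..n. indicator (A k) x - u k x\<bar> / real n"
      by (simp add: v_def sum_subtractf diff_divide_distrib[symmetric])
    also have "\<dots> \<le> (\<Sum>k=1..n. \<bar>indicator (A k) x - u k x\<bar>) / real n"
      by (intro divide_right_mono sum_abs) auto
    finally show "\<bar>f x - v x\<bar> \<le> 1 / real n + (\<Sum>k=1..n. \<bar>indicator (A k) x - u k x\<bar>) / real n"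
      using floor[OF x] by linarith
  qed
  also have "\<dots> = 1 / real n + (\<Sum>k=1..n. \<integral>x. \<bar>indicator (A k) x - u k x\<bar> \<partial>M) / real n"
    using intu by (subst Bochner_Integration.integral_add) (auto simp: prob_space Bochner_Integration.integral_sum)
  also have "\<dots> \<le> 1 / real n + (\<Sum>k=1..n. \<delta> / 2) / real n"
    using less_imp_le[OF ui] by (intro add_left_mono divide_right_mono sum_mono) auto
  also have "\<dots> = 1 / real n + \<delta> / 2" using n(1) by (simp add: field_simps)
  also have "\<dots> < \<delta>" using n(2) by linarith
  finally have "(\<integral>x. \<bar>f x - v x\<bar> \<partial>M) < \<delta>" .
  moreover have "finite E" using E1 by (auto simp: E_def)
  ultimately show ?thesis using step vb v01 by blast
qed

lemma entropy_wrt_partition_le_integral_info: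
  assumes info: "integrable M info" and Q: "finite_measurable_partition M Q"
  shows "entropy_wrt_partition M T Q \<le> (\<integral>x. info x \<partial>M)"
proof -
  define L where "L = cell Q ` space M"
  define K where "K = real (card L)"
  note cQ = finite_measurable_partition_cell[OF Q]
  have L: "finite L" using cQ(1) by (simp add: L_def)
  have "L \<noteq> {}" using not_empty by (simp add: L_def)
  then have K: "1 \<le> K" using L by (simp add: K_def Suc_leI card_gt_0_iff)
  have main: "entropy_wrt_partition M T Q \<le> (\<integral>x. info x \<partial>M) + (3 + 3 * K) * \<epsilon>"
    if \<epsilon>: "0 < \<epsilon>" "\<epsilon> \<le> 1" for \<epsilon>
  proof -
    \<comment> \<open>The errors enter divided by \<open>\<epsilon>\<close>; the square leaves a
      total of order \<open>\<epsilon>\<close>.\<close>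
    define \<delta> where "\<delta> = \<epsilon> ^ 2"
    have \<delta>: "0 < \<delta>" using \<epsilon> by (simp add: \<delta>_def)
    \<comment> \<open>That \<open>w True\<close> is at most 1 is known only almost everywhere. The
      truncation makes it true on the whole space, as \<open>step_approx\<close> requires.\<close>
    define wt where "wt x = min 1 (w True x)" for x
    have wt [measurable]: "wt \<in> borel_measurable M" unfolding wt_def by measurable
    obtain E0 v where v: "finite E0" "step_on E0 v" "v \<in> borel_measurable borel" "\<And>x. 0 \<le> v x \<and> v x \<le> 1"
      "(\<integral>x. \<bar>wt x - v x\<bar> \<partial>M) < \<delta>"
      using step_approx[OF wt _ \<delta>] by (auto simp: wt_def w_nonneg)
    define F where "F a = {x\<in>space M. cell Q x = a}" for a
    have F [measurable]: "F a \<in> sets M" for a unfolding F_def by (rule cQ(2))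
    have "\<forall>a. \<exists>E u. finite E \<and> step_on E u \<and> u \<in> borel_measurable borel \<and> (\<forall>x. 0 \<le> u x \<and> u x \<le> 1) \<and>
      (\<integral>x. \<bar>indicator (F a) x - u x\<bar> \<partial>M) < \<delta>"
      using step_approx_indicator[OF F \<delta>] by blast
    then obtain E1 u where u: "\<And>a. finite (E1 a)" "\<And>a. step_on (E1 a) (u a)" "\<And>a. u a \<in> borel_measurable borel"
      "\<And>a x. 0 \<le> u a x \<and> u a x \<le> 1" "\<And>a. (\<integral>x. \<bar>indicator (F a) x - u a x\<bar> \<partial>M) < \<delta>"
      by metis
    have vM [measurable]: "v \<in> borel_measurable M" by (rule measurable_M_borel[OF v(3)])
    have uM [measurable]: "u a \<in> borel_measurable M" for a by (rule measurable_M_borel[OF u(3)])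
    define E where "E = E0 \<union> (\<Union>a\<in>L. E1 a)"
    have E: "finite E" using v(1) u(1) L by (auto simp: E_def)
    \<comment> \<open>Both kernels are shifted by \<open>\<epsilon>\<close> and divided by their
      total mass. Labels outside \<open>L\<close> are not attained on the space; the value 1 there
      keeps \<open>r\<close> positive.\<close>
    define s where "s b y = ((if b then v y else 1 - v y) + \<epsilon>) / (1 + 2 * \<epsilon>)" for b y
    define r where "r a x = (if a \<in> L then (u a x + \<epsilon>) / ((\<Sum>a\<in>L. u a x) + K * \<epsilon>) else 1)" for a x
    define \<Sigma> where "\<Sigma> x = (\<Sum>a\<in>L. \<bar>indicator (F a) x - u a x\<bar>)" for x
    \<comment> \<open>The terms \<open>2 * \<epsilon>\<close> and
      \<open>K * \<epsilon> + \<Sigma> x\<close> bound the logarithms of the two normalising sums;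
      the terms divided by \<open>\<epsilon>\<close> come from
      \<open>neg_ln_shift_le\<close>.\<close>
    define \<kappa> where "\<kappa> x = info x + 2 * \<epsilon> + \<bar>wt (T x) - v (T x)\<bar> / \<epsilon> + K * \<epsilon> + (1 + 1 / \<epsilon>) * \<Sigma> x" for x
    have den: "0 < (\<Sum>a\<in>L. u a x) + K * \<epsilon>" for x
      using K \<epsilon> u(4) by (intro add_nonneg_pos sum_nonneg mult_pos_pos) auto
    have s_pos: "0 < s b y" for b y
      using v(4)[of y] \<epsilon> by (auto simp: s_def intro!: divide_pos_pos add_nonneg_pos)
    have r_pos: "0 < r a x" for a x
      using u(4)[of a x] \<epsilon> den[of x] by (auto simp: r_def intro!: divide_pos_pos add_nonneg_pos)
    have s_step: "step_on E (s b)" for b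
    proof -
      have "step_on E v" by (rule step_on_mono[OF v(2)]) (auto simp: E_def)
      then show ?thesis unfolding step_on_def s_def by metis
    qed
    have r_step: "step_on E (r a)" for a
      unfolding step_on_def
    proof (intro allI impI)
      fix x y assume xy: "closed_segment x y \<inter> E = {}"
      have "u b x = u b y" if "b \<in> L" for b
      proof (rule step_onD[OF step_on_mono[OF u(2)] xy])
        show "E1 b \<subseteq> E" using that by (auto simp: E_def)
      qed
      then show "r a x = r a y" by (simp add: r_def)
    qed
    have s_sum: "(\<Sum>b\<in>UNIV. s b y) \<le> 1" for y
      using \<epsilon> by (simp add: UNIV_bool s_def add_divide_distrib[symmetric])
    have r_sum: "(\<Sum>a\<in>cell Q ` space M. r a x) \<le> 1" for x
    proof -
      have "(\<Sum>a\<in>L. r a x) = (\<Sum>a\<in>L. u a x + \<epsilon>) / ((\<Sum>a\<in>L. u a x) + K * \<epsilon>)"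
        by (simp add: r_def sum_divide_distrib)
      also have "(\<Sum>a\<in>L. u a x + \<epsilon>) = (\<Sum>a\<in>L. u a x) + K * \<epsilon>"
        by (simp add: sum.distrib K_def)
      finally show ?thesis using den[of x] by (simp add: L_def)
    qed
    have int_wt: "integrable M (\<lambda>x. \<bar>wt x - v x\<bar>)"
    proof (rule integrable_const_bound[of _ 1])
      have "\<bar>wt x - v x\<bar> \<le> 1" for x
        using v(4)[of x] w_nonneg[of True x] by (auto simp: wt_def)
      then show "AE x in M. norm \<bar>wt x - v x\<bar> \<le> 1" by simp
    qed measurable
    have int_u: "integrable M (\<lambda>x. \<bar>indicator (F a) x - u a x\<bar>)" for a
    proof (rule integrable_const_bound[of _ 1])
      have "\<bar>indicator (F a) x - u a x\<bar> \<le> 1" for x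
        using u(4)[of a x] by (auto simp: indicator_def)
      then show "AE x in M. norm \<bar>indicator (F a) x - u a x\<bar> \<le> 1" by simp
    qed measurable
    have int_\<Sigma>: "integrable M \<Sigma>"
      unfolding \<Sigma>_def using int_u by auto
    have I\<Sigma>: "(\<integral>x. \<Sigma> x \<partial>M) \<le> K * \<delta>"
    proof -
      have "(\<integral>x. \<Sigma> x \<partial>M) = (\<Sum>a\<in>L. \<integral>x. \<bar>indicator (F a) x - u a x\<bar> \<partial>M)"
        unfolding \<Sigma>_def using int_u by (rule Bochner_Integration.integral_sum)
      also have "\<dots> \<le> (\<Sum>a\<in>L. \<delta>)" by (intro sum_mono less_imp_le u)
      finally show ?thesis by (simp add: K_def)
    qed
    have int_wtT: "integrable M (\<lambda>x. \<bar>wt (T x) - v (T x)\<bar>)"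
      using integrable_Tn[OF int_wt, where n = 1] by simp
    have IwT: "(\<integral>x. \<bar>wt (T x) - v (T x)\<bar> \<partial>M) < \<delta>"
      using integral_Tn[OF int_wt, where n = 1] v(5) by simp
    have int_\<kappa>: "integrable M \<kappa>"
      unfolding \<kappa>_def using info int_\<Sigma> int_wtT by auto
    have ws: "AE x in M. w True (T x) + w False (T x) = 1"
      using AE_Tn[OF AE_weight_sum, of 1] by simp
    have \<kappa>_ge: "AE x in M. - ln (s (0 < x) (T x)) - ln (r (cell Q x) x) \<le> \<kappa> x"
      using ws AE_weight_pos AE_space
    proof eventually_elim
      case (elim x)
      define y where "y = T x"
      define a where "a = cell Q x"
      have a: "a \<in> L" "x \<in> F a" using elim(3) by (auto simp: a_def L_def F_def)
      have wt_y: "wt y = w True y" "w False y = 1 - wt y"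
        using elim(1) w_nonneg[of False y] by (auto simp: wt_def y_def)
      define t where "t = w (0 < x) y"
      define z where "z = (if 0 < x then v y else 1 - v y)"
      have t: "0 < t" using elim(2) by (simp add: t_def y_def)
      have z: "0 \<le> z" using v(4)[of y] by (simp add: z_def)
      have tz: "\<bar>t - z\<bar> = \<bar>wt y - v y\<bar>"
        unfolding t_def z_def using wt_y by (cases "0 < x") auto
      have "- ln (s (0 < x) y) = ln (1 + 2 * \<epsilon>) - ln (z + \<epsilon>)"
        using z \<epsilon> by (simp add: s_def z_def[symmetric] ln_div)
      also have "\<dots> \<le> 2 * \<epsilon> + (- ln t + \<bar>t - z\<bar> / \<epsilon>)"
        using neg_ln_shift_le[OF \<epsilon>(1) z t] ln_add_one_self_le_self[of "2 * \<epsilon>"] \<epsilon> by linarith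
      finally have 1: "- ln (s (0 < x) y) \<le> 2 * \<epsilon> + info x + \<bar>wt y - v y\<bar> / \<epsilon>"
        by (simp add: info_def t_def y_def tz[unfolded t_def y_def])
      have ind: "(\<Sum>b\<in>L. indicator (F b) x) = (1::real)"
      proof -
        have "(\<Sum>b\<in>L. indicator (F b) x) = (\<Sum>b\<in>L. if b = a then 1 else (0::real))"
          using elim(3) by (intro sum.cong) (auto simp: F_def a_def)
        then show ?thesis using L a by simp
      qed
      have "(\<Sum>b\<in>L. u b x) - 1 = (\<Sum>b\<in>L. u b x - indicator (F b) x)"
        by (simp add: sum_subtractf ind)
      also have "\<dots> \<le> \<Sigma> x"
        unfolding \<Sigma>_def by (rule sum_mono) auto
      finally have \<Sigma>1: "(\<Sum>b\<in>L. u b x) - 1 \<le> \<Sigma> x" .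
      have "\<bar>indicator (F a) x - u a x\<bar> \<le> \<Sigma> x"
        unfolding \<Sigma>_def by (rule member_le_sum) (use a L in auto)
      then have \<Sigma>2: "\<bar>1 - u a x\<bar> \<le> \<Sigma> x" using a by simp
      have "- ln (r a x) = ln ((\<Sum>b\<in>L. u b x) + K * \<epsilon>) - ln (u a x + \<epsilon>)"
        using a den[of x] u(4)[of a x] \<epsilon> by (simp add: r_def ln_div)
      also have "\<dots> \<le> ((\<Sum>b\<in>L. u b x) + K * \<epsilon> - 1) + (- ln 1 + \<bar>1 - u a x\<bar> / \<epsilon>)"
        using ln_le_minus_one[OF den[of x]] neg_ln_shift_le[OF \<epsilon>(1), of "u a x" 1] u(4)[of a x]
        by (intro order_trans[OF _ add_mono[OF ln_le_minus_one[OF den[of x]] neg_ln_shift_le[OF \<epsilon>(1), of "u a x" 1]]]) auto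
      also have "\<dots> \<le> \<Sigma> x + K * \<epsilon> + \<Sigma> x / \<epsilon>"
      proof -
        have "\<bar>1 - u a x\<bar> / \<epsilon> \<le> \<Sigma> x / \<epsilon>" using \<Sigma>2 \<epsilon> by (intro divide_right_mono) auto
        then show ?thesis using \<Sigma>1 by simp
      qed
      finally have 2: "- ln (r a x) \<le> \<Sigma> x + K * \<epsilon> + \<Sigma> x / \<epsilon>" .
      have "\<kappa> x = (2 * \<epsilon> + info x + \<bar>wt y - v y\<bar> / \<epsilon>) + (\<Sigma> x + K * \<epsilon> + \<Sigma> x / \<epsilon>)"
        by (simp add: \<kappa>_def y_def algebra_simps)
      then show ?case using 1 2 by (simp add: y_def a_def)
    qed
    have "entropy_wrt_partition M T Q \<le> (\<integral>x. \<kappa> x \<partial>M)"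
      by (rule entropy_wrt_partition_le_kernel[OF Q E s_pos s_step s_sum r_pos r_step r_sum int_\<kappa> \<kappa>_ge])
    also have "\<dots> = (\<integral>x. info x \<partial>M) + 2 * \<epsilon> + (\<integral>x. \<bar>wt (T x) - v (T x)\<bar> \<partial>M) / \<epsilon> + K * \<epsilon> + (1 + 1 / \<epsilon>) * (\<integral>x. \<Sigma> x \<partial>M)"
      unfolding \<kappa>_def using info int_\<Sigma> int_wtT by (simp add: prob_space)
    also have "\<dots> \<le> (\<integral>x. info x \<partial>M) + 2 * \<epsilon> + \<delta> / \<epsilon> + K * \<epsilon> + (1 + 1 / \<epsilon>) * (K * \<delta>)"
      using IwT I\<Sigma> \<epsilon> K by (intro add_mono mult_left_mono divide_right_mono) auto
    also have "\<dots> = (\<integral>x. info x \<partial>M) + 3 * \<epsilon> + 2 * K * \<epsilon> + K * (\<epsilon> * \<epsilon>)"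
      using \<epsilon> by (simp add: \<delta>_def power2_eq_square field_simps)
    also have "\<dots> \<le> (\<integral>x. info x \<partial>M) + 3 * \<epsilon> + 2 * K * \<epsilon> + K * \<epsilon>"
      using \<epsilon> K by (intro add_left_mono mult_left_mono) (auto simp: mult_left_le)
    finally show ?thesis by (simp add: algebra_simps)
  qed
  show ?thesis
  proof (rule field_le_epsilon)
    fix e :: real assume e: "0 < e"
    define \<epsilon> where "\<epsilon> = min 1 (e / (3 + 3 * K))"
    have "0 < \<epsilon>" "\<epsilon> \<le> 1" using e K by (auto simp: \<epsilon>_def)
    moreover have "(3 + 3 * K) * \<epsilon> \<le> e"
      using K by (simp add: \<epsilon>_def min_def divide_simps mult.commute)
    ultimately show "entropy_wrt_partition M T Q \<le> (\<integral>x. info x \<partial>M) + e"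
      using main[of \<epsilon>] by linarith
  qed
qed

lemma metric_entropy_eq_integral_info:
  assumes "integrable M info"
  shows "metric_entropy M T = ereal (\<integral>x. info x \<partial>M)"
proof (rule antisym)
  show "metric_entropy M T \<le> ereal (\<integral>x. info x \<partial>M)"
    unfolding metric_entropy_def
    using entropy_wrt_partition_le_integral_info[OF assms] by (intro SUP_least) auto
qed (rule integral_info_le_metric_entropy[OF assms])

end

section \<open>The two branches\<close>

text \<open>The sign \<open>\<sigma>\<close> is 1 or -1, and \<open>\<sigma> * x\<close> is the
  distance from 0. Every estimate is thus made once for both branches, with 0 and the fixed point
  \<open>\<sigma>\<close> as the ends of the half.\<close>

definition half :: "real \<Rightarrow> real set" where
  "half \<sigma> = {x. 0 < \<sigma> * x \<and> \<sigma> * x < 1}"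

lemma half_1: "half 1 = {0<..<1}" and half_m1: "half (-1) = {-1<..<0}"
  by (auto simp: half_def)

lemma sgn_cases: "\<bar>\<sigma>\<bar> = 1 \<Longrightarrow> \<sigma> = 1 \<or> \<sigma> = -1" for \<sigma> :: real
  by (auto simp: abs_if split: if_splits)

lemma half_convex:
  assumes "\<bar>\<sigma>\<bar> = 1" "x \<in> half \<sigma>" "y \<in> half \<sigma>" "x \<le> z" "z \<le> y"
  shows "z \<in> half \<sigma>"
proof -
  have "\<sigma> = 1 \<or> \<sigma> = -1" using assms(1) by (auto simp: abs_if split: if_splits)
  then show ?thesis using assms by (auto simp: half_def)
qed

locale two_branch =
  fixes g :: "real \<Rightarrow> real"
  assumes bij: "\<And>\<sigma>. \<bar>\<sigma>\<bar> = 1 \<Longrightarrow> bij_betw g (half \<sigma>) {-1<..<1}"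
    and deriv: "\<And>\<sigma> x. \<bar>\<sigma>\<bar> = 1 \<Longrightarrow> x \<in> half \<sigma> \<Longrightarrow> (g has_real_derivative deriv g x) (at x)"
    and deriv_pos: "\<And>\<sigma> x. \<bar>\<sigma>\<bar> = 1 \<Longrightarrow> x \<in> half \<sigma> \<Longrightarrow> 0 < deriv g x"
    and cont_deriv: "\<And>\<sigma>. \<bar>\<sigma>\<bar> = 1 \<Longrightarrow> continuous_on (half \<sigma>) (deriv g)"
    and cont_inv: "\<And>\<sigma>. \<bar>\<sigma>\<bar> = 1 \<Longrightarrow> continuous_on {-1<..<1} (inv_into (half \<sigma>) g)"

lemma two_branch_if_A0:
  assumes "cond_A0 g"
  shows "two_branch g"
proof -
  have open_half: "open (half \<sigma>)" for \<sigma>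
    unfolding half_def by (intro open_Collect_conj open_Collect_less continuous_intros)
  have diffeo: "orientation_preserving_C2_diffeo (half \<sigma>) {-1<..<1} g" if "\<bar>\<sigma>\<bar> = 1" for \<sigma>
  proof -
    have "\<sigma> = 1 \<or> \<sigma> = -1" using that by (auto simp: abs_if split: if_splits)
    then show ?thesis
      using assms unfolding cond_A0_def interior_atLeastAtMost_real
      by (elim disjE) (simp_all only: half_1 half_m1)
  qed
  have *: "(g has_real_derivative deriv g x) (at x)" "continuous_on (half \<sigma>) (deriv g)"
    if \<sigma>: "\<bar>\<sigma>\<bar> = 1" and x: "x \<in> half \<sigma>" for \<sigma> x
  proof -
    obtain f' f'' where f: "C2_derivs (half \<sigma>) g f' f''"
      using diffeo[OF \<sigma>] by (auto simp: orientation_preserving_C2_diffeo_def C2_on_def)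
    have d: "(g has_real_derivative f' y) (at y)" "deriv g y = f' y" if "y \<in> half \<sigma>" for y
    proof -
      show "(g has_real_derivative f' y) (at y)"
        using f that at_within_open[OF that open_half] unfolding C2_derivs_def by metis
      then show "deriv g y = f' y" by (rule DERIV_imp_deriv)
    qed
    show "(g has_real_derivative deriv g x) (at x)" using d[OF x] by simp
    have "continuous_on (half \<sigma>) f'"
      using f unfolding C2_derivs_def continuous_on_eq_continuous_within
      by (metis DERIV_continuous)
    then show "continuous_on (half \<sigma>) (deriv g)"
      using d(2) by (subst continuous_on_cong[OF refl]) auto
  qed
  have cont_C2: "continuous_on S f" if "C2_on S f" for S f
    using that unfolding C2_on_def C2_derivs_def continuous_on_eq_continuous_within
    by (metis DERIV_continuous)
  have ne: "half \<sigma> \<noteq> {}" if "\<bar>\<sigma>\<bar> = 1" for \<sigma>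
  proof -
    have "\<sigma> / 2 \<in> half \<sigma>"
      using that by (auto simp: half_def abs_if split: if_splits)
    then show ?thesis by blast
  qed
  show ?thesis
  proof
    fix \<sigma> :: real assume \<sigma>: "\<bar>\<sigma>\<bar> = 1"
    show "bij_betw g (half \<sigma>) {-1<..<1}" "continuous_on {-1<..<1} (inv_into (half \<sigma>) g)"
      using diffeo[OF \<sigma>] cont_C2 by (auto simp: orientation_preserving_C2_diffeo_def)
    show "continuous_on (half \<sigma>) (deriv g)" using *(2)[OF \<sigma>] ne[OF \<sigma>] by blast
    fix x assume x: "x \<in> half \<sigma>"
    show "(g has_real_derivative deriv g x) (at x)" by (rule *[OF \<sigma> x])
    show "0 < deriv g x" using diffeo[OF \<sigma>] x by (auto simp: orientation_preserving_C2_diffeo_def)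
  qed
qed

context two_branch
begin

lemma g_less:
  assumes \<sigma>: "\<bar>\<sigma>\<bar> = 1" and xy: "x \<in> half \<sigma>" "y \<in> half \<sigma>" "x < y"
  shows "g x < g y"
proof (rule DERIV_pos_imp_increasing[OF xy(3)])
  fix z assume "x \<le> z" "z \<le> y"
  then have "z \<in> half \<sigma>" using half_convex[OF \<sigma> xy(1,2)] by simp
  then show "\<exists>d. (g has_real_derivative d) (at z) \<and> 0 < d"
    using deriv[OF \<sigma>] deriv_pos[OF \<sigma>] by blast
qed

lemma g_le:
  assumes "\<bar>\<sigma>\<bar> = 1" "x \<in> half \<sigma>" "y \<in> half \<sigma>" "x \<le> y"
  shows "g x \<le> g y"
  using g_less[OF assms(1-3)] assms(4) by (cases "x = y") auto

lemma g_range: "\<bar>\<sigma>\<bar> = 1 \<Longrightarrow> x \<in> half \<sigma> \<Longrightarrow> -1 < g x \<and> g x < 1"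
  using bij_betw_apply[OF bij] by fastforce

lemma inv_half:
  assumes "\<bar>\<sigma>\<bar> = 1" "-1 < y" "y < 1"
  shows "inv_into (half \<sigma>) g y \<in> half \<sigma>" "g (inv_into (half \<sigma>) g y) = y"
proof -
  have "y \<in> g ` half \<sigma>" using bij[OF assms(1)] assms by (auto simp: bij_betw_def)
  then show "inv_into (half \<sigma>) g y \<in> half \<sigma>" "g (inv_into (half \<sigma>) g y) = y"
    by (auto simp: inv_into_into f_inv_into_f)
qed

lemma inv_half_g: "\<bar>\<sigma>\<bar> = 1 \<Longrightarrow> x \<in> half \<sigma> \<Longrightarrow> inv_into (half \<sigma>) g (g x) = x"
  using bij[of \<sigma>] by (auto simp: bij_betw_def)

section \<open>Behaviour of the branches near 0 and near the fixed points\<close>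

lemma scaled_less_iff:
  assumes "\<bar>\<sigma>\<bar> = 1" "x \<in> half \<sigma>" "y \<in> half \<sigma>"
  shows "\<sigma> * g x < \<sigma> * g y \<longleftrightarrow> \<sigma> * x < \<sigma> * y"
  using sgn_cases[OF assms(1)] g_less[OF assms] g_less[OF assms(1,3,2)]
  by (cases x y rule: linorder_cases) auto

text \<open>A monotone bijection onto the open interval must approach its end, whatever the local
  form at 0.\<close>

lemma tendsto_at_0:
  assumes \<sigma>: "\<bar>\<sigma>\<bar> = 1"
  shows "(g \<longlongrightarrow> - \<sigma>) (at 0 within half \<sigma>)"
  unfolding Lim_within
proof (intro allI impI)
  fix e :: real assume e: "0 < e"
  \<comment> \<open>The value \<open>y\<close> lies at distance \<open>min 1 (e / 2)\<close> from
    \<open>- \<sigma>\<close>; points closer to 0 than its preimage have images closer to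
    \<open>- \<sigma>\<close>.\<close>
  define y where "y = - \<sigma> + \<sigma> * min 1 (e / 2)"
  have y: "-1 < y" "y < 1" "\<sigma> * y \<le> -1 + e / 2"
    using sgn_cases[OF \<sigma>] e by (auto simp: y_def min_def)
  define z where "z = inv_into (half \<sigma>) g y"
  have z: "z \<in> half \<sigma>" "g z = y" using inv_half[OF \<sigma> y(1,2)] by (auto simp: z_def)
  show "\<exists>d>0. \<forall>x\<in>half \<sigma>. 0 < dist x 0 \<and> dist x 0 < d \<longrightarrow> dist (g x) (- \<sigma>) < e"
  proof (intro exI[of _ "\<sigma> * z"] conjI ballI impI)
    show "0 < \<sigma> * z" using z by (simp add: half_def)
    fix x assume x: "x \<in> half \<sigma>" "0 < dist x 0 \<and> dist x 0 < \<sigma> * z"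
    have "\<sigma> * x < \<sigma> * z" using x sgn_cases[OF \<sigma>] by (auto simp: half_def)
    then have "\<sigma> * g x < \<sigma> * y" using scaled_less_iff[OF \<sigma> x(1) z(1)] z by simp
    then show "dist (g x) (- \<sigma>) < e"
      using y(3) e sgn_cases[OF \<sigma>] g_range[OF \<sigma> x(1)] by (auto simp: dist_real_def)
  qed
qed

lemma Lim_at_0:
  assumes \<sigma>: "\<bar>\<sigma>\<bar> = 1"
  shows "Lim (at 0 within half \<sigma>) g = - \<sigma>"
proof (rule tendsto_Lim[OF _ tendsto_at_0[OF \<sigma>]])
  have "0 islimpt half \<sigma>"
    unfolding islimpt_approachable
  proof (intro allI impI)
    fix e :: real assume e: "0 < e"
    have "\<sigma> * min (1/2) (e / 2) \<in> half \<sigma> \<and> \<sigma> * min (1/2) (e / 2) \<noteq> 0 \<and> dist (\<sigma> * min (1/2) (e / 2)) 0 < e"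
      using sgn_cases[OF \<sigma>] e by (auto simp: half_def min_def dist_real_def)
    then show "\<exists>x'\<in>half \<sigma>. x' \<noteq> 0 \<and> dist x' 0 < e" by blast
  qed
  then show "\<not> trivial_limit (at 0 within half \<sigma>)"
    by (simp add: trivial_limit_within)
qed

lemma branch_plus: "branch I_plus g 0 = -1" "x \<in> half 1 \<Longrightarrow> branch I_plus g x = g x"
  using Lim_at_0[of 1] by (auto simp: branch_def half_1)

lemma branch_minus: "branch I_minus g 0 = 1" "x \<in> half (-1) \<Longrightarrow> branch I_minus g x = g x"
  using Lim_at_0[of "-1"] by (auto simp: branch_def half_m1)

text \<open>The sets \<open>U_minus1\<close> and \<open>U_plus1\<close> are images of one-sided
  neighbourhoods of 0. Since the branch over the opposite half is onto and monotone, such an image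
  contains a one-sided neighbourhood of the fixed point, on which the local form of \<open>g\<close>
  may be used.\<close>

lemma nbhd_of_end:
  assumes \<sigma>: "\<bar>\<sigma>\<bar> = 1" and \<iota>: "0 < \<iota>" "\<iota> \<le> 1"
    and h: "h 0 = \<sigma>" "\<And>x. x \<in> half (- \<sigma>) \<Longrightarrow> h x = g x"
    and U: "U = h ` {x. 0 \<le> - \<sigma> * x \<and> - \<sigma> * x < \<iota>}"
  shows "\<sigma> \<in> U" "\<exists>e>0. e \<le> 1 \<and> (\<forall>x. \<sigma> * x < 1 \<and> 1 - e < \<sigma> * x \<longrightarrow> x \<in> U)"
proof -
  show "\<sigma> \<in> U" unfolding U using h(1) \<iota> by (intro image_eqI[of _ _ 0]) auto
  have m\<sigma>: "\<bar>- \<sigma>\<bar> = 1" using \<sigma> by simp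
  define z where "z = - \<sigma> * (\<iota> / 2)"
  have z: "z \<in> half (- \<sigma>)" using sgn_cases[OF \<sigma>] \<iota> by (auto simp: half_def z_def)
  have sz: "- \<sigma> * z = \<iota> / 2" using sgn_cases[OF \<sigma>] by (auto simp: z_def)
  define e where "e = min 1 (1 - \<sigma> * g z)"
  have gz: "\<sigma> * g z < 1" using sgn_cases[OF \<sigma>] g_range[OF m\<sigma> z] by auto
  show "\<exists>e>0. e \<le> 1 \<and> (\<forall>x. \<sigma> * x < 1 \<and> 1 - e < \<sigma> * x \<longrightarrow> x \<in> U)"
  proof (intro exI[of _ e] conjI allI impI)
    show "0 < e" "e \<le> 1" using gz by (auto simp: e_def)
    fix x assume x: "\<sigma> * x < 1 \<and> 1 - e < \<sigma> * x"
    have x1: "-1 < x" "x < 1" using x sgn_cases[OF \<sigma>] by (auto simp: e_def)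
    define y where "y = inv_into (half (- \<sigma>)) g x"
    have y: "y \<in> half (- \<sigma>)" "g y = x" using inv_half[OF m\<sigma> x1] by (auto simp: y_def)
    have "- \<sigma> * g y < - \<sigma> * g z" using x y by (auto simp: e_def)
    then have "- \<sigma> * y < - \<sigma> * z" using scaled_less_iff[OF m\<sigma> y(1) z] by blast
    then have "- \<sigma> * y < \<iota>" using sz \<iota> by linarith
    then show "x \<in> U"
      unfolding U using h(2)[OF y(1)] y by (intro image_eqI[of _ _ y]) (auto simp: half_def)
  qed
qed

text \<open>Hyperbolic and neutral fixed points are treated alike: the lower bound 1 makes
  \<open>ln (deriv g x)\<close> nonnegative, and the upper bound limits the speed of
  repulsion.\<close>

lemma deriv_bounds_at_end:
  assumes \<sigma>: "\<bar>\<sigma>\<bar> = 1" and l: "0 \<le> l" and b: "0 < b"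
    and U: "\<sigma> \<in> U" "0 < e" "e \<le> 1" "\<And>x. \<sigma> * x < 1 \<Longrightarrow> 1 - e < \<sigma> * x \<Longrightarrow> x \<in> U"
    and form: "if l = 0
      then \<exists>\<xi> \<xi>' \<xi>''. C2_derivs U \<xi> \<xi>' \<xi>'' \<and> \<xi>' \<sigma> = 0 \<and> (\<forall>x\<in>U. g x = \<sigma> + (1 + b) * (x - \<sigma>) + \<xi> x)
      else (\<forall>x\<in>U. g x = x - \<sigma> * b * (1 - \<sigma> * x) powr (1 + l))"
  shows "\<exists>e'>0. e' \<le> 1 \<and> (\<exists>L. \<forall>x. \<sigma> * x < 1 \<and> 1 - e' < \<sigma> * x \<longrightarrow> 1 \<le> deriv g x \<and> deriv g x \<le> L)"
proof -
  define N where "N = {x. \<sigma> * x < 1 \<and> 1 - e < \<sigma> * x}"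
  have oN: "open N"
    unfolding N_def by (intro open_Collect_conj open_Collect_less continuous_intros)
  have NU: "N \<subseteq> U" using U(4) by (auto simp: N_def)
  have uniq: "deriv g x = d" if "x \<in> N" "(f has_real_derivative d) (at x)" "\<And>y. y \<in> N \<Longrightarrow> g y = f y" for x d f
  proof -
    have "(g has_real_derivative d) (at x)"
      using has_field_derivative_transform_within_open[OF that(2) oN that(1)] that(3) by simp
    then show ?thesis by (rule DERIV_imp_deriv)
  qed
  show ?thesis
  proof (cases "l = 0")
    case True
    then obtain \<xi> \<xi>' \<xi>'' where \<xi>: "C2_derivs U \<xi> \<xi>' \<xi>''" "\<xi>' \<sigma> = 0" "\<And>x. x \<in> U \<Longrightarrow> g x = \<sigma> + (1 + b) * (x - \<sigma>) + \<xi> x"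
      using form by auto
    have "continuous (at \<sigma> within U) \<xi>'"
      using \<xi>(1) U(1) DERIV_continuous unfolding C2_derivs_def by blast
    \<comment> \<open>Near \<open>\<sigma>\<close> the perturbation of the slope
      \<open>1 + b\<close> stays below \<open>b\<close>, whence the bounds 1 and
      \<open>1 + 2 * b\<close>.\<close>
    then obtain d where d: "0 < d" "\<And>x. x \<in> U \<Longrightarrow> dist x \<sigma> < d \<Longrightarrow> dist (\<xi>' x) (\<xi>' \<sigma>) < b"
      unfolding continuous_within_eps_delta using b by metis
    show ?thesis
    proof (rule exI[of _ "min e d"], intro exI[of _ "1 + 2 * b"] conjI allI impI)
      show "0 < min e d" "min e d \<le> 1" using U d by auto
      fix x assume x: "\<sigma> * x < 1 \<and> 1 - min e d < \<sigma> * x"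
      then have xN: "x \<in> N" by (auto simp: N_def)
      have "dist x \<sigma> < d" using x sgn_cases[OF \<sigma>] by (auto simp: dist_real_def)
      then have \<xi>'b: "\<bar>\<xi>' x\<bar> < b" using d(2)[of x] xN NU \<xi>(2) by (auto simp: dist_real_def)
      have "(\<xi> has_real_derivative \<xi>' x) (at x within U)"
        using \<xi>(1) xN NU unfolding C2_derivs_def by blast
      then have "(\<xi> has_real_derivative \<xi>' x) (at x within N)"
        by (rule DERIV_subset[OF _ NU])
      then have "(\<xi> has_real_derivative \<xi>' x) (at x)"
        using at_within_open[OF xN oN] by simp
      then have "((\<lambda>x. \<sigma> + (1 + b) * (x - \<sigma>) + \<xi> x) has_real_derivative (1 + b) + \<xi>' x) (at x)"
        by (auto intro!: derivative_eq_intros)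
      then have "deriv g x = (1 + b) + \<xi>' x"
        by (rule uniq[OF xN]) (use \<xi>(3) NU in auto)
      then show "1 \<le> deriv g x" "deriv g x \<le> 1 + 2 * b" using \<xi>'b by auto
    qed
  next
    case False
    then have gf: "\<And>x. x \<in> U \<Longrightarrow> g x = x - \<sigma> * b * (1 - \<sigma> * x) powr (1 + l)" using form by auto
    show ?thesis
    proof (rule exI[of _ e], intro exI[of _ "1 + b * (1 + l)"] conjI allI impI U)
      fix x assume x: "\<sigma> * x < 1 \<and> 1 - e < \<sigma> * x"
      then have xN: "x \<in> N" by (auto simp: N_def)
      have "((\<lambda>x. x - \<sigma> * b * (1 - \<sigma> * x) powr (1 + l)) has_real_derivative
        1 - \<sigma> * b * ((1 + l) * (1 - \<sigma> * x) powr (1 + l - 1) * (- \<sigma>))) (at x)"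
        using x by (auto intro!: derivative_eq_intros)
      then have "deriv g x = 1 - \<sigma> * b * ((1 + l) * (1 - \<sigma> * x) powr (1 + l - 1) * (- \<sigma>))"
        by (rule uniq[OF xN]) (rule gf[OF subsetD[OF NU]])
      also have "\<dots> = 1 + b * (1 + l) * (1 - \<sigma> * x) powr l"
        using sgn_cases[OF \<sigma>] by auto
      finally have "deriv g x = 1 + b * (1 + l) * (1 - \<sigma> * x) powr l" .
      moreover have "(1 - \<sigma> * x) powr l \<le> 1"
        using x U(3) l by (intro powr_le1) auto
      moreover have "0 \<le> (1 - \<sigma> * x) powr l" by simp
      ultimately show "1 \<le> deriv g x" "deriv g x \<le> 1 + b * (1 + l)"
        using b l by (auto simp: mult_left_le)
    qed
  qed
qed

text \<open>The number \<open>1 + \<sigma> * g x\<close> is the distance from \<open>g x\<close> to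
  the fixed point \<open>- \<sigma>\<close>. In the power case it and the derivative are powers of
  the same \<open>\<sigma> * x\<close>, so their logarithms are affinely related; for
  \<open>k = 1\<close> monotonicity keeps the derivative between its values at 0 and at an interior
  point.\<close>

lemma ln_deriv_bound_at_0:
  assumes \<sigma>: "\<bar>\<sigma>\<bar> = 1" and \<iota>: "0 < \<iota>" "\<iota> \<le> 1" and k: "0 < k" and a: "0 < a"
    and h: "\<And>x. x \<in> half \<sigma> \<Longrightarrow> h x = g x"
    and U: "U = {x. 0 \<le> \<sigma> * x \<and> \<sigma> * x < \<iota>}"
    and form: "if k = 1 then monotone_derivative_at_0 h U a else (\<forall>x\<in>U. h x = - \<sigma> + \<sigma> * (a * \<bar>x\<bar> powr k))"
  shows "\<exists>e>0. e \<le> 1 \<and> (\<exists>K. \<forall>x. 0 < \<sigma> * x \<and> \<sigma> * x < e \<longrightarrow> \<bar>ln (deriv g x)\<bar> \<le> K + K * \<bar>ln (1 + \<sigma> * g x)\<bar>)"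
proof -
  define N where "N = {x. 0 < \<sigma> * x \<and> \<sigma> * x < \<iota>}"
  have oN: "open N"
    unfolding N_def by (intro open_Collect_conj open_Collect_less continuous_intros)
  have NU: "N \<subseteq> U" by (auto simp: N_def U)
  have Nh: "N \<subseteq> half \<sigma>" using \<iota> by (auto simp: N_def half_def)
  have uniq: "deriv g x = d" if "x \<in> N" "(f has_real_derivative d) (at x)" "\<And>y. y \<in> N \<Longrightarrow> g y = f y" for x d f
  proof -
    have "(g has_real_derivative d) (at x)"
      using has_field_derivative_transform_within_open[OF that(2) oN that(1)] that(3) by simp
    then show ?thesis by (rule DERIV_imp_deriv)
  qed
  show ?thesis
  proof (cases "k = 1")
    case True
    then obtain h' where h': "\<And>x. x \<in> U \<Longrightarrow> (h has_real_derivative h' x) (at x within U)" "h' 0 = a"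
      "mono_on U h' \<or> antimono_on U h'"
      using form unfolding monotone_derivative_at_0_def by auto
    have dg: "deriv g x = h' x" if x: "x \<in> N" for x
    proof (rule uniq[OF x])
      have "(h has_real_derivative h' x) (at x within N)"
        using h'(1)[of x] NU x by (intro DERIV_subset[OF _ NU]) auto
      then show "(h has_real_derivative h' x) (at x)"
        using at_within_open[OF x oN] by simp
      show "g y = h y" if "y \<in> N" for y using h Nh that by auto
    qed
    define z where "z = \<sigma> * (\<iota> / 2)"
    have z: "z \<in> N" "\<sigma> * z = \<iota> / 2" using sgn_cases[OF \<sigma>] \<iota> by (auto simp: z_def N_def)
    have hz: "0 < h' z" using dg[OF z(1)] deriv_pos[OF \<sigma>, of z] Nh z(1) by auto
    define K where "K = max \<bar>ln a\<bar> \<bar>ln (h' z)\<bar>"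
    show ?thesis
    proof (rule exI[of _ "\<iota> / 2"], intro exI[of _ K] conjI allI impI)
      show "0 < \<iota> / 2" "\<iota> / 2 \<le> 1" using \<iota> by auto
      fix x assume x: "0 < \<sigma> * x \<and> \<sigma> * x < \<iota> / 2"
      then have xN: "x \<in> N" using \<iota> by (auto simp: N_def)
      have U3: "0 \<in> U" "z \<in> U" "x \<in> U" using \<iota> NU z xN by (auto simp: U)
      have ord: "0 \<le> x \<and> x \<le> z \<or> z \<le> x \<and> x \<le> 0"
        using x z(2) sgn_cases[OF \<sigma>] by auto
      have "min a (h' z) \<le> h' x \<and> h' x \<le> max a (h' z)"
        using h'(3)
      proof
        assume m: "mono_on U h'"
        show ?thesis
          using ord mono_onD[OF m U3(1,3)] mono_onD[OF m U3(3,2)] mono_onD[OF m U3(3,1)] mono_onD[OF m U3(2,3)] h'(2)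
          by auto
      next
        assume m: "antimono_on U h'"
        show ?thesis
          using ord monotone_onD[OF m U3(1,3)] monotone_onD[OF m U3(3,2)] monotone_onD[OF m U3(3,1)] monotone_onD[OF m U3(2,3)] h'(2)
          by auto
      qed
      moreover have "0 < h' x" using dg[OF xN] deriv_pos[OF \<sigma>, of x] Nh xN by auto
      ultimately have "ln (min a (h' z)) \<le> ln (h' x)" "ln (h' x) \<le> ln (max a (h' z))"
        using a hz by (auto simp: min_def max_def split: if_splits)
      then have "\<bar>ln (h' x)\<bar> \<le> K"
        unfolding K_def by (auto simp: min_def max_def abs_le_iff split: if_splits)
      moreover have "0 \<le> K * \<bar>ln (1 + \<sigma> * g x)\<bar>"
        by (intro mult_nonneg_nonneg) (auto simp: K_def)
      ultimately show "\<bar>ln (deriv g x)\<bar> \<le> K + K * \<bar>ln (1 + \<sigma> * g x)\<bar>"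
        unfolding dg[OF xN] by linarith
    qed
  next
    case False
    have gf: "g x = - \<sigma> + \<sigma> * (a * (\<sigma> * x) powr k)" if "x \<in> N" for x
    proof -
      have "\<bar>x\<bar> = \<sigma> * x" using sgn_cases[OF \<sigma>] that by (auto simp: N_def)
      moreover have "h x = - \<sigma> + \<sigma> * (a * \<bar>x\<bar> powr k)" using form False NU that by auto
      ultimately show ?thesis using h[of x] Nh that by auto
    qed
    \<comment> \<open>The slope of this relation is \<open>(k - 1) / k\<close>, since
      \<open>deriv g x\<close> has exponent \<open>k - 1\<close> and
      \<open>1 + \<sigma> * g x\<close> has exponent \<open>k\<close>.\<close>
    define c where "c = \<bar>k - 1\<bar> / k"
    define K where "K = max (\<bar>ln (a * k)\<bar> + c * \<bar>ln a\<bar>) c"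
    show ?thesis
    proof (rule exI[of _ \<iota>], intro exI[of _ K] conjI allI impI \<iota>)
      fix x assume "0 < \<sigma> * x \<and> \<sigma> * x < \<iota>"
      then have xN: "x \<in> N" by (simp add: N_def)
      define t where "t = \<sigma> * x"
      have t: "0 < t" using xN by (simp add: N_def t_def)
      have "((\<lambda>x. - \<sigma> + \<sigma> * (a * (\<sigma> * x) powr k)) has_real_derivative
        \<sigma> * (a * (k * (\<sigma> * x) powr (k - 1) * \<sigma>))) (at x)"
        using t by (auto intro!: derivative_eq_intros simp: t_def)
      then have "deriv g x = \<sigma> * (a * (k * (\<sigma> * x) powr (k - 1) * \<sigma>))"
        by (rule uniq[OF xN]) (rule gf)
      also have "\<dots> = a * k * t powr (k - 1)"
        using sgn_cases[OF \<sigma>] by (auto simp: t_def)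
      finally have lnd: "ln (deriv g x) = ln (a * k) + (k - 1) * ln t"
        using a k t by (simp add: ln_mult ln_powr)
      have "1 + \<sigma> * g x = a * t powr k"
        using gf[OF xN] sgn_cases[OF \<sigma>] by (auto simp: t_def)
      then have "ln (1 + \<sigma> * g x) = ln a + k * ln t"
        using a t by (simp add: ln_mult ln_powr)
      then have lnt: "ln t = (ln (1 + \<sigma> * g x) - ln a) / k" using k by simp
      have "\<bar>ln (deriv g x)\<bar> \<le> \<bar>ln (a * k)\<bar> + \<bar>(k - 1) * ln t\<bar>"
        unfolding lnd by (rule abs_triangle_ineq)
      also have "\<bar>(k - 1) * ln t\<bar> = c * \<bar>ln (1 + \<sigma> * g x) - ln a\<bar>"
        using k by (simp add: lnt c_def abs_mult)
      also have "\<dots> \<le> c * (\<bar>ln (1 + \<sigma> * g x)\<bar> + \<bar>ln a\<bar>)"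
        using k by (intro mult_left_mono abs_triangle_ineq4) (simp add: c_def)
      finally have "\<bar>ln (deriv g x)\<bar> \<le> (\<bar>ln (a * k)\<bar> + c * \<bar>ln a\<bar>) + c * \<bar>ln (1 + \<sigma> * g x)\<bar>"
        by (simp add: algebra_simps)
      also have "\<dots> \<le> K + K * \<bar>ln (1 + \<sigma> * g x)\<bar>"
        by (intro add_mono mult_right_mono) (auto simp: K_def)
      finally show "\<bar>ln (deriv g x)\<bar> \<le> K + K * \<bar>ln (1 + \<sigma> * g x)\<bar>" .
    qed
  qed
qed

text \<open>Away from both ends the derivative is bounded by compactness. The second estimate says
  that a step increases the distance to the fixed point \<open>\<sigma>\<close> by a bounded factor;
  near \<open>\<sigma>\<close> it follows from the mean value theorem.\<close>

lemma branch_bounds_if_end_bounds: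
  assumes \<sigma>: "\<bar>\<sigma>\<bar> = 1"
    and at0: "\<exists>e>0. e \<le> 1 \<and> (\<exists>K. \<forall>x. 0 < \<sigma> * x \<and> \<sigma> * x < e \<longrightarrow> \<bar>ln (deriv g x)\<bar> \<le> K + K * \<bar>ln (1 + \<sigma> * g x)\<bar>)"
    and at1: "\<exists>e>0. e \<le> 1 \<and> (\<exists>L. \<forall>x. \<sigma> * x < 1 \<and> 1 - e < \<sigma> * x \<longrightarrow> 1 \<le> deriv g x \<and> deriv g x \<le> L)"
  shows "\<exists>K\<ge>0. \<forall>x\<in>half \<sigma>. \<bar>ln (deriv g x)\<bar> \<le> K + K * \<bar>ln (1 + \<sigma> * g x)\<bar> \<and> 1 - \<sigma> * g x \<le> K * (1 - \<sigma> * x)"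
proof -
  obtain e0 K0 where e0: "0 < e0" "e0 \<le> 1"
    "\<And>x. 0 < \<sigma> * x \<Longrightarrow> \<sigma> * x < e0 \<Longrightarrow> \<bar>ln (deriv g x)\<bar> \<le> K0 + K0 * \<bar>ln (1 + \<sigma> * g x)\<bar>"
    using at0 by blast
  obtain e1 L where e1: "0 < e1" "e1 \<le> 1"
    "\<And>x. \<sigma> * x < 1 \<Longrightarrow> 1 - e1 < \<sigma> * x \<Longrightarrow> 1 \<le> deriv g x \<and> deriv g x \<le> L"
    using at1 by blast
  have ss: "\<sigma> * \<sigma> = 1" using sgn_cases[OF \<sigma>] by auto
  define C where "C = (\<lambda>t. \<sigma> * t) ` {e0 / 2..1 - e1 / 2}"
  have C: "C \<subseteq> half \<sigma>"
    unfolding C_def half_def using e0 e1 by (auto simp: mult.assoc[symmetric] ss)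
  have "compact C"
    unfolding C_def by (intro compact_continuous_image continuous_intros) auto
  moreover have "continuous_on C (\<lambda>x. \<bar>ln (deriv g x)\<bar>)"
    using C deriv_pos[OF \<sigma>]
    by (intro continuous_intros continuous_on_subset[OF cont_deriv[OF \<sigma>]]) force+
  ultimately have "compact ((\<lambda>x. \<bar>ln (deriv g x)\<bar>) ` C)"
    by (rule compact_continuous_image[rotated])
  then have "bounded ((\<lambda>x. \<bar>ln (deriv g x)\<bar>) ` C)" by (rule compact_imp_bounded)
  then obtain B where B: "\<And>x. x \<in> C \<Longrightarrow> \<bar>ln (deriv g x)\<bar> \<le> B"
    unfolding bounded_real by auto
  have near1: "1 - \<sigma> * g x \<le> L * (1 - \<sigma> * x)" if x: "\<sigma> * x < 1" "1 - e1 < \<sigma> * x" for x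
  proof (rule ccontr)
    assume neg: "\<not> ?thesis"
    have xh: "x \<in> half \<sigma>" using x e1 by (auto simp: half_def)
    have L: "1 \<le> L" using e1(3)[OF x] by linarith
    \<comment> \<open>If the bound failed, \<open>\<sigma> * g x + L * (1 - \<sigma> * x)\<close>
      would be below 1. The midpoint between it and 1 is attained at some \<open>y\<close> inside
      the half, so the mean value theorem applies between \<open>x\<close> and \<open>y\<close>
      without reference to the value of \<open>g\<close> at \<open>\<sigma>\<close>.\<close>
    define v where "v = \<sigma> * ((\<sigma> * g x + L * (1 - \<sigma> * x) + 1) / 2)"
    have sv: "\<sigma> * v = (\<sigma> * g x + L * (1 - \<sigma> * x) + 1) / 2"
      unfolding v_def mult.assoc[symmetric] ss by simp
    have pos: "0 \<le> L * (1 - \<sigma> * x)" using L x by auto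
    have sg: "-1 < \<sigma> * g x" "\<sigma> * g x < 1" using g_range[OF \<sigma> xh] sgn_cases[OF \<sigma>] by auto
    have "\<sigma> * v < 1" "-1 < \<sigma> * v" using neg pos sg unfolding sv by auto
    then have v: "-1 < v" "v < 1" using sgn_cases[OF \<sigma>] by auto
    define y where "y = inv_into (half \<sigma>) g v"
    have y: "y \<in> half \<sigma>" "g y = v" using inv_half[OF \<sigma> v] by (auto simp: y_def)
    have "\<sigma> * g x + L * (1 - \<sigma> * x) < \<sigma> * g y" using neg y sv by auto
    then have gxy: "\<sigma> * g x < \<sigma> * g y" using pos by linarith
    then have xy: "\<sigma> * x < \<sigma> * y" using scaled_less_iff[OF \<sigma> xh y(1)] by blast
    have y1: "\<sigma> * y < 1" using y(1) by (simp add: half_def)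
    have "\<exists>z. \<sigma> * x \<le> \<sigma> * z \<and> \<sigma> * z \<le> \<sigma> * y \<and> g y - g x = (y - x) * deriv g z"
    proof -
      have dz: "(g has_real_derivative deriv g z) (at z)" if "\<sigma> * x \<le> \<sigma> * z" "\<sigma> * z \<le> \<sigma> * y" for z
        using that xh y(1) by (intro deriv[OF \<sigma>]) (auto simp: half_def)
      show ?thesis
        using sgn_cases[OF \<sigma>]
      proof
        assume s: "\<sigma> = 1"
        then have "x < y" using xy by simp
        from MVT2[OF this, of g "deriv g"] dz s show ?thesis by (auto intro: less_imp_le)
      next
        assume s: "\<sigma> = -1"
        then have "y < x" using xy by simp
        from MVT2[OF this, of g "deriv g"] dz s obtain z where "y < z" "z < x" "g x - g y = (x - y) * deriv g z"
          by auto
        then show ?thesis using s by (intro exI[of _ z]) (auto simp: algebra_simps)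
      qed
    qed
    then obtain z where z: "\<sigma> * x \<le> \<sigma> * z" "\<sigma> * z \<le> \<sigma> * y" "g y - g x = (y - x) * deriv g z" by blast
    have "deriv g z \<le> L" using e1(3)[of z] z x y1 by linarith
    have "\<sigma> * g y - \<sigma> * g x = (\<sigma> * y - \<sigma> * x) * deriv g z"
      using z(3) by (metis right_diff_distrib mult.assoc)
    also have "\<dots> \<le> (\<sigma> * y - \<sigma> * x) * L"
      using xy \<open>deriv g z \<le> L\<close> by (intro mult_left_mono) auto
    also have "\<dots> \<le> (1 - \<sigma> * x) * L"
      using y1 L by (intro mult_right_mono) auto
    finally show False using \<open>\<sigma> * g x + L * (1 - \<sigma> * x) < \<sigma> * g y\<close> by (simp add: mult.commute)
  qed
  \<comment> \<open>The term \<open>2 / e1\<close> serves the points at distance at least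
    \<open>e1\<close> from \<open>\<sigma>\<close>, where \<open>1 - \<sigma> * g x\<close> is at
    most 2.\<close>
  define K where "K = \<bar>K0\<bar> + \<bar>B\<bar> + \<bar>L\<bar> + \<bar>ln L\<bar> + 2 / e1"
  have Kb: "K0 \<le> K" "B \<le> K" "L \<le> K" "\<bar>ln L\<bar> \<le> K" "2 / e1 \<le> K" "0 \<le> K"
    using divide_pos_pos[OF zero_less_numeral e1(1), of "num.Bit0 num.One"] unfolding K_def by linarith+
  show ?thesis
  proof (intro exI[of _ K] conjI ballI Kb)
    fix x assume x: "x \<in> half \<sigma>"
    have x01: "0 < \<sigma> * x" "\<sigma> * x < 1" using x by (auto simp: half_def)
    have nn: "0 \<le> K * \<bar>ln (1 + \<sigma> * g x)\<bar>" using Kb by simp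
    consider "\<sigma> * x < e0" | "1 - e1 < \<sigma> * x" | "e0 \<le> \<sigma> * x" "\<sigma> * x \<le> 1 - e1" by linarith
    then show "\<bar>ln (deriv g x)\<bar> \<le> K + K * \<bar>ln (1 + \<sigma> * g x)\<bar>"
    proof cases
      case 1
      have "\<bar>ln (deriv g x)\<bar> \<le> K0 + K0 * \<bar>ln (1 + \<sigma> * g x)\<bar>" by (rule e0(3)[OF x01(1) 1])
      also have "\<dots> \<le> K + K * \<bar>ln (1 + \<sigma> * g x)\<bar>"
        using Kb by (intro add_mono mult_right_mono) auto
      finally show ?thesis .
    next
      case 2
      then have "1 \<le> deriv g x" "deriv g x \<le> L" using e1(3)[OF x01(2)] by auto
      then have "\<bar>ln (deriv g x)\<bar> \<le> \<bar>ln L\<bar>" by auto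
      then show ?thesis using Kb nn by linarith
    next
      case 3
      have "x \<in> C"
        unfolding C_def using 3 e0 e1 by (intro image_eqI[of _ _ "\<sigma> * x"]) (auto simp: mult.assoc[symmetric] ss)
      then show ?thesis using B[of x] Kb nn by linarith
    qed
    show "1 - \<sigma> * g x \<le> K * (1 - \<sigma> * x)"
    proof (cases "1 - e1 < \<sigma> * x")
      case True
      have "L * (1 - \<sigma> * x) \<le> K * (1 - \<sigma> * x)" using Kb x01 by (intro mult_right_mono) auto
      then show ?thesis using near1[OF x01(2) True] by linarith
    next
      case False
      have "1 - \<sigma> * g x \<le> 2" using g_range[OF \<sigma> x] sgn_cases[OF \<sigma>] by auto
      also have "2 = 2 / e1 * e1" using e1 by simp
      also have "\<dots> \<le> K * (1 - \<sigma> * x)"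
        using Kb False e1 x01 by (intro mult_mono) auto
      finally show ?thesis .
    qed
  qed
qed

text \<open>The form of \<open>g\<close> near the fixed point \<open>\<sigma>\<close> is prescribed
  on the image of a neighbourhood of 0 in the opposite half, so each sign involves both
  branches.\<close>

lemma branch_bounds_if_A1:
  assumes A1: "cond_A1 g \<iota> l1 l2 k1 k2 a1 a2 b1 b2" and \<sigma>: "\<bar>\<sigma>\<bar> = 1"
  shows "\<exists>K\<ge>0. \<forall>x\<in>half \<sigma>. \<bar>ln (deriv g x)\<bar> \<le> K + K * \<bar>ln (1 + \<sigma> * g x)\<bar> \<and> 1 - \<sigma> * g x \<le> K * (1 - \<sigma> * x)"
proof (rule branch_bounds_if_end_bounds[OF \<sigma>])
  note A = A1[unfolded cond_A1_def]
  have \<iota>: "0 < \<iota>" "\<iota> \<le> 1" using A by auto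
  have U0: "U0_minus \<iota> = {x. 0 \<le> (-1) * x \<and> (-1) * x < \<iota>}" "U0_plus \<iota> = {x. 0 \<le> 1 * x \<and> 1 * x < \<iota>}"
    by (auto simp: U0_minus_def U0_plus_def)
  show "\<exists>e>0. e \<le> 1 \<and> (\<exists>K. \<forall>x. 0 < \<sigma> * x \<and> \<sigma> * x < e \<longrightarrow> \<bar>ln (deriv g x)\<bar> \<le> K + K * \<bar>ln (1 + \<sigma> * g x)\<bar>)"
    using sgn_cases[OF \<sigma>]
  proof
    assume s: "\<sigma> = 1"
    show ?thesis unfolding s
    proof (rule ln_deriv_bound_at_0[OF _ \<iota> _ _ branch_plus(2) U0(2)])
      show "if k2 = 1 then monotone_derivative_at_0 (branch I_plus g) (U0_plus \<iota>) a2
        else \<forall>x\<in>U0_plus \<iota>. branch I_plus g x = - 1 + 1 * (a2 * \<bar>x\<bar> powr k2)"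
        using A by (auto simp: cond_A1_at_0_plus_def U0_plus_def split: if_splits)
    qed (use A in auto)
  next
    assume s: "\<sigma> = -1"
    show ?thesis unfolding s
    proof (rule ln_deriv_bound_at_0[OF _ \<iota> _ _ branch_minus(2) U0(1)])
      show "if k1 = 1 then monotone_derivative_at_0 (branch I_minus g) (U0_minus \<iota>) a1
        else \<forall>x\<in>U0_minus \<iota>. branch I_minus g x = - (-1) + (-1) * (a1 * \<bar>x\<bar> powr k1)"
        using A by (auto simp: cond_A1_at_0_minus_def U0_minus_def split: if_splits)
    qed (use A in auto)
  qed
  show "\<exists>e>0. e \<le> 1 \<and> (\<exists>L. \<forall>x. \<sigma> * x < 1 \<and> 1 - e < \<sigma> * x \<longrightarrow> 1 \<le> deriv g x \<and> deriv g x \<le> L)"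
    using sgn_cases[OF \<sigma>]
  proof
    assume s: "\<sigma> = 1"
    have "U_plus1 g \<iota> = branch I_minus g ` {x. 0 \<le> - 1 * x \<and> - 1 * x < \<iota>}"
      unfolding U_plus1_def U0 by simp
    note nb = nbhd_of_end[OF _ \<iota> branch_minus this]
    then obtain e where e: "0 < e" "e \<le> 1" "\<And>x. 1 * x < 1 \<Longrightarrow> 1 - e < 1 * x \<Longrightarrow> x \<in> U_plus1 g \<iota>"
      by auto
    show ?thesis unfolding s
    proof (rule deriv_bounds_at_end[OF _ _ _ _ e])
      show "if l2 = 0 then \<exists>\<xi> \<xi>' \<xi>''. C2_derivs (U_plus1 g \<iota>) \<xi> \<xi>' \<xi>'' \<and> \<xi>' 1 = 0 \<and>
          (\<forall>x\<in>U_plus1 g \<iota>. g x = 1 + (1 + b2) * (x - 1) + \<xi> x)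
        else \<forall>x\<in>U_plus1 g \<iota>. g x = x - 1 * b2 * (1 - 1 * x) powr (1 + l2)"
        using A unfolding cond_A1_at_plus1_def by (auto split: if_splits)
    qed (use A nb(1) in auto)
  next
    assume s: "\<sigma> = -1"
    have "U_minus1 g \<iota> = branch I_plus g ` {x. 0 \<le> - (-1) * x \<and> - (-1) * x < \<iota>}"
      unfolding U_minus1_def U0 by simp
    note nb = nbhd_of_end[OF _ \<iota> _ _ this]
    have h: "branch I_plus g 0 = -1" "\<And>x. x \<in> half (- (-1)) \<Longrightarrow> branch I_plus g x = g x"
      using branch_plus by auto
    obtain e where e: "0 < e" "e \<le> 1" "\<And>x. (-1) * x < 1 \<Longrightarrow> 1 - e < (-1) * x \<Longrightarrow> x \<in> U_minus1 g \<iota>"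
      using nb(2)[OF _ h] by auto
    show ?thesis unfolding s
    proof (rule deriv_bounds_at_end[OF _ _ _ _ e])
      show "if l1 = 0 then \<exists>\<xi> \<xi>' \<xi>''. C2_derivs (U_minus1 g \<iota>) \<xi> \<xi>' \<xi>'' \<and> \<xi>' (-1) = 0 \<and>
          (\<forall>x\<in>U_minus1 g \<iota>. g x = (-1) + (1 + b1) * (x - (-1)) + \<xi> x)
        else \<forall>x\<in>U_minus1 g \<iota>. g x = x - (-1) * b1 * (1 - (-1) * x) powr (1 + l1)"
        using A unfolding cond_A1_at_minus1_def by (auto split: if_splits)
    qed (use A nb(1)[OF _ h] in auto)
  qed
qed

end

section \<open>The entropy formula\<close>

context two_branch
begin

lemma half_open: "open (half \<sigma>)"
  unfolding half_def by (intro open_Collect_conj open_Collect_less continuous_intros)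

lemma half_sets [measurable]: "half \<sigma> \<in> sets borel"
  using half_open by simp

lemma g_continuous: "\<bar>\<sigma>\<bar> = 1 \<Longrightarrow> continuous_on (half \<sigma>) g"
  by (intro continuous_at_imp_continuous_on ballI) (rule DERIV_isCont[OF deriv])

text \<open>Substitution applies on closed intervals where the derivative is continuous. At 0 the
  derivative may be unbounded, so the open half is exhausted from inside by such intervals.\<close>

lemma nn_integral_branch:
  fixes H :: "real \<Rightarrow> ennreal"
  assumes \<sigma>: "\<bar>\<sigma>\<bar> = 1" and H [measurable]: "H \<in> borel_measurable borel"
  shows "(\<integral>\<^sup>+x. H (g x) * ennreal (deriv g x) * indicator (half \<sigma>) x \<partial>lborel) =
    (\<integral>\<^sup>+y. H y * indicator {-1<..<1} y \<partial>lborel)"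
proof -
  define l where "l = (if \<sigma> = 1 then 0 else -1 :: real)"
  have half: "half \<sigma> = {l<..<l + 1}"
    using sgn_cases[OF \<sigma>] by (auto simp: l_def half_1 half_m1)
  \<comment> \<open>The summand 3 gives \<open>a n < b n\<close> already for
    \<open>n = 0\<close>.\<close>
  define a b where "a n = l + 1 / (real n + 3)" and "b n = l + 1 - 1 / (real n + 3)" for n
  have ab: "l < a n" "a n < b n" "b n < l + 1" for n
  proof -
    have "0 < 1 / (real n + 3)" "1 / (real n + 3) \<le> 1 / 3" by (auto simp: divide_simps)
    then show "l < a n" "a n < b n" "b n < l + 1" unfolding a_def b_def by linarith+
  qed
  have ab_half: "a n \<in> half \<sigma>" "b n \<in> half \<sigma>" for n
    using ab[of n] by (auto simp: half)
  have mono: "a n \<le> a m" "b m \<le> b n" if "m \<le> n" for m n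
    using that unfolding a_def b_def by (auto simp: frac_le)
  \<comment> \<open>Extension by 0 gives Borel functions on the whole line, as the measure
    \<open>density lborel F\<close> requires.\<close>
  define gg where "gg x = (if x \<in> half \<sigma> then g x else 0)" for x
  define dg where "dg x = (if x \<in> half \<sigma> then deriv g x else 0)" for x
  have [measurable]: "gg \<in> borel_measurable borel" "dg \<in> borel_measurable borel"
    unfolding gg_def dg_def
    by (intro borel_measurable_continuous_on_if g_continuous cont_deriv \<sigma> continuous_intros half_sets)+
  define F where "F x = H (gg x) * ennreal (dg x)" for x
  have F [measurable]: "F \<in> borel_measurable borel" unfolding F_def by measurable
  have eq: "emeasure (density lborel H) {g (a n)..g (b n)} = emeasure (density lborel F) {a n..b n}" for n
  proof -
    have sub: "x \<in> half \<sigma>" if "x \<in> {a n..b n}" for x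
      using that ab[of n] by (auto simp: half)
    have "(\<integral>\<^sup>+x. H x * indicator {g (a n)..g (b n)} x \<partial>lborel) =
      (\<integral>\<^sup>+x. H (g x) * ennreal (deriv g x) * indicator {a n..b n} x \<partial>lborel)"
    proof (rule nn_integral_substitution_aux)
      show "continuous_on {a n..b n} (deriv g)"
        using cont_deriv[OF \<sigma>] by (rule continuous_on_subset) (use sub in auto)
      show "(g has_real_derivative deriv g x) (at x)" if "x \<in> {a n..b n}" for x
        by (rule deriv[OF \<sigma> sub[OF that]])
      show "0 \<le> deriv g x" if "x \<in> {a n..b n}" for x
        using deriv_pos[OF \<sigma> sub[OF that]] by simp
    qed (use ab in auto)
    also have "\<dots> = (\<integral>\<^sup>+x. F x * indicator {a n..b n} x \<partial>lborel)"
      by (rule nn_integral_cong) (use sub in \<open>auto simp: F_def gg_def dg_def indicator_def\<close>)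
    finally show ?thesis by (simp add: emeasure_density)
  qed
  have U1: "(\<Union>n. {a n..b n}) = half \<sigma>"
  proof (intro equalityI subsetI)
    fix x assume "x \<in> half \<sigma>"
    then have "0 < min (x - l) (l + 1 - x)" by (auto simp: half)
    then obtain n :: nat where n: "1 / real (Suc n) < min (x - l) (l + 1 - x)"
      using nat_approx_posE by blast
    have "1 / (real n + 3) \<le> 1 / real (Suc n)" by (simp add: frac_le)
    then have "x \<in> {a n..b n}" using n by (auto simp: a_def b_def)
    then show "x \<in> (\<Union>n. {a n..b n})" by blast
  next
    fix x assume "x \<in> (\<Union>n. {a n..b n})"
    then obtain n where "x \<in> {a n..b n}" by blast
    then show "x \<in> half \<sigma>" using ab[of n] by (auto simp: half)
  qed
  have U2: "(\<Union>n. {g (a n)..g (b n)}) = {-1<..<1}"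
  proof (intro equalityI subsetI)
    fix y :: real assume "y \<in> {-1<..<1}"
    then have y: "-1 < y" "y < 1" by auto
    define x where "x = inv_into (half \<sigma>) g y"
    have x: "x \<in> half \<sigma>" "g x = y" using inv_half[OF \<sigma> y] by (auto simp: x_def)
    then obtain n where "x \<in> {a n..b n}" using U1 by blast
    then have "y \<in> {g (a n)..g (b n)}"
      using g_le[OF \<sigma> ab_half(1) x(1)] g_le[OF \<sigma> x(1) ab_half(2)] x(2) by auto
    then show "y \<in> (\<Union>n. {g (a n)..g (b n)})" by blast
  next
    fix y assume "y \<in> (\<Union>n. {g (a n)..g (b n)})"
    then obtain n where "g (a n) \<le> y" "y \<le> g (b n)" by auto
    then show "y \<in> {-1<..<1}"
      using g_range[OF \<sigma> ab_half(1)[of n]] g_range[OF \<sigma> ab_half(2)[of n]] by auto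
  qed
  have "(\<lambda>n. emeasure (density lborel F) {a n..b n}) \<longlonglongrightarrow> emeasure (density lborel F) (\<Union>n. {a n..b n})"
  proof (rule Lim_emeasure_incseq)
    have "{a m..b m} \<subseteq> {a n..b n}" if "m \<le> n" for m n
      using mono[OF that] by auto
    then show "incseq (\<lambda>n. {a n..b n})"
      unfolding incseq_def by blast
  qed auto
  moreover have "(\<lambda>n. emeasure (density lborel H) {g (a n)..g (b n)}) \<longlonglongrightarrow>
    emeasure (density lborel H) (\<Union>n. {g (a n)..g (b n)})"
  proof (rule Lim_emeasure_incseq)
    have "g (a n) \<le> g (a m)" "g (b m) \<le> g (b n)" if "m \<le> n" for m n
      using g_le[OF \<sigma>] ab_half mono[OF that] by auto
    then show "incseq (\<lambda>n. {g (a n)..g (b n)})"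
      unfolding incseq_def by auto
  qed auto
  ultimately have "emeasure (density lborel F) (half \<sigma>) = emeasure (density lborel H) {-1<..<1}"
    unfolding eq U1 U2 by (rule LIMSEQ_unique)
  then have "(\<integral>\<^sup>+x. F x * indicator (half \<sigma>) x \<partial>lborel) = (\<integral>\<^sup>+y. H y * indicator {-1<..<1} y \<partial>lborel)"
    by (simp add: emeasure_density)
  moreover have "(\<integral>\<^sup>+x. F x * indicator (half \<sigma>) x \<partial>lborel) =
    (\<integral>\<^sup>+x. H (g x) * ennreal (deriv g x) * indicator (half \<sigma>) x \<partial>lborel)"
    by (rule nn_integral_cong) (auto simp: F_def gg_def dg_def indicator_def)
  ultimately show ?thesis by simp
qed

end

section \<open>Absolutely continuous invariant measures as instances of the abstract setting\<close>

locale acip_system = two_branch g + pmp M g for g and M :: "real measure" +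
  fixes \<rho> :: "real \<Rightarrow> real"
  assumes sets_M: "sets M = sets (restrict_space borel {-1..1})"
    and \<rho> [measurable]: "\<rho> \<in> borel_measurable borel" and \<rho>_nonneg: "\<And>x. 0 \<le> \<rho> x"
    and AE_\<rho>_pos: "AE x in M. 0 < \<rho> x"
    and nn_integral_M: "\<And>F. F \<in> borel_measurable M \<Longrightarrow>
      (\<integral>\<^sup>+x. F x \<partial>M) = (\<integral>\<^sup>+x. ennreal (\<rho> x) * F x * indicator {-1..1} x \<partial>lborel)"
begin

definition side :: "bool \<Rightarrow> real" where
  "side b = (if b then 1 else -1)"

definition psi :: "bool \<Rightarrow> real \<Rightarrow> real" where
  "psi b y = (if y \<in> {-1<..<1} then inv_into (half (side b)) g y else 0)"

text \<open>One summand of the Perron-Frobenius operator applied to \<open>\<rho>\<close>. The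
  repeated conditional makes the divisor the globally defined function whose measurability is shown
  in \<open>transfer_density_borel\<close>.\<close>

definition transfer_density :: "bool \<Rightarrow> real \<Rightarrow> real" where
  "transfer_density b y =
    (if y \<in> {-1<..<1} then \<rho> (psi b y) / (if y \<in> {-1<..<1} then deriv g (psi b y) else 1) else 0)"

text \<open>Division by 0 makes the weight vanish where the density does.\<close>

definition weight :: "bool \<Rightarrow> real \<Rightarrow> real" where
  "weight b y = transfer_density b y / \<rho> y"

lemma side [simp]: "\<bar>side b\<bar> = 1"
  by (simp add: side_def)

lemma mem_half_side: "-1 < x \<Longrightarrow> x < 1 \<Longrightarrow> x \<noteq> 0 \<Longrightarrow> x \<in> half (side b) \<longleftrightarrow> (0 < x \<longleftrightarrow> b)"
  by (auto simp: half_def side_def)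

lemma half_sideD: "x \<in> half (side b) \<Longrightarrow> -1 < x \<and> x < 1 \<and> x \<noteq> 0 \<and> (0 < x \<longleftrightarrow> b)"
  by (auto simp: half_def side_def split: if_splits)

lemma psi_mem: "y \<in> {-1<..<1} \<Longrightarrow> psi b y \<in> half (side b) \<and> g (psi b y) = y"
  using inv_half[of "side b" y] by (auto simp: psi_def)

lemma psi_g: "x \<in> half (side b) \<Longrightarrow> psi b (g x) = x"
  using inv_half_g[of "side b" x] g_range[of "side b" x] by (auto simp: psi_def)

lemma psi_borel [measurable]: "psi b \<in> borel_measurable borel"
  unfolding psi_def
  by (intro borel_measurable_continuous_on_if cont_inv continuous_intros) auto

lemma transfer_density_borel [measurable]: "transfer_density b \<in> borel_measurable borel"
proof -
  have "continuous_on {-1<..<1} (deriv g \<circ> inv_into (half (side b)) g)"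
    by (intro continuous_on_compose cont_inv continuous_on_subset[OF cont_deriv[of "side b"]])
      (auto intro: inv_half)
  then have "continuous_on {-1<..<1} (\<lambda>y. deriv g (psi b y))"
    by (rule continuous_on_eq) (auto simp: psi_def)
  then have [measurable]: "(\<lambda>y. if y \<in> {-1<..<1} then deriv g (psi b y) else 1) \<in> borel_measurable borel"
    by (intro borel_measurable_continuous_on_if continuous_intros) auto
  show ?thesis unfolding transfer_density_def by measurable
qed

lemma transfer_density_nonneg: "0 \<le> transfer_density b y"
proof (cases "y \<in> {-1<..<1}")
  case True
  then have "0 < deriv g (psi b y)" using deriv_pos[of "side b"] psi_mem by simp
  then show ?thesis using \<rho>_nonneg by (simp add: transfer_density_def)
qed (auto simp: transfer_density_def)

lemma borel_M: "f \<in> borel_measurable borel \<Longrightarrow> f \<in> borel_measurable M"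
  unfolding measurable_cong_sets[OF sets_M refl] by (rule measurable_restrict_space1)

lemma space_M_eq: "space M = {-1..1}"
  using sets_eq_imp_space_eq[OF sets_M] by (simp add: space_restrict_space)

lemma extend_borel:
  fixes h :: "real \<Rightarrow> ennreal"
  assumes "h \<in> borel_measurable M"
  shows "(\<lambda>x. h x * indicator {-1..1} x) \<in> borel_measurable borel"
  using assms unfolding measurable_cong_sets[OF sets_M refl]
  by (subst (asm) borel_measurable_restrict_space_iff_ennreal) auto

text \<open>Change of variables on one branch, where the Jacobian factor turns the pulled back
  transfer density into \<open>\<rho>\<close>. The ends of the half are Lebesgue null.\<close>

lemma nn_integral_branch_M:
  assumes h [measurable]: "h \<in> borel_measurable M"
  shows "(\<integral>\<^sup>+x. h (g x) * indicator {x. (0 < x) = b} x \<partial>M) =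
    (\<integral>\<^sup>+y. h y * ennreal (transfer_density b y) * indicator {-1<..<1} y \<partial>lborel)"
proof -
  define H where "H y = (h y * indicator {-1..1} y) * ennreal (transfer_density b y)" for y
  have H: "H \<in> borel_measurable borel"
    unfolding H_def using extend_borel[OF h] by measurable
  have [measurable]: "(\<lambda>x. x) \<in> borel_measurable M" by (rule borel_M) auto
  have "(\<integral>\<^sup>+x. h (g x) * indicator {x. (0 < x) = b} x \<partial>M) =
    (\<integral>\<^sup>+x. ennreal (\<rho> x) * (h (g x) * indicator {x. (0 < x) = b} x) * indicator {-1..1} x \<partial>lborel)"
    by (rule nn_integral_M) measurable
  also have "\<dots> = (\<integral>\<^sup>+x. H (g x) * ennreal (deriv g x) * indicator (half (side b)) x \<partial>lborel)"
  proof (rule nn_integral_cong_AE)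
    show "AE x in lborel. ennreal (\<rho> x) * (h (g x) * indicator {x. (0 < x) = b} x) * indicator {-1..1} x =
      H (g x) * ennreal (deriv g x) * indicator (half (side b)) x"
      using AE_lborel_singleton[of 0] AE_lborel_singleton[of 1] AE_lborel_singleton[of "-1"]
    proof eventually_elim
      case (elim x)
      show ?case
      proof (cases "x \<in> half (side b)")
        case True
        have x: "-1 < x" "x < 1" "(0 < x) = b" using half_sideD[OF True] by auto
        have gx: "-1 < g x" "g x < 1" using g_range[OF side True] by auto
        have d: "0 < deriv g x" by (rule deriv_pos[OF side True])
        have "ennreal (transfer_density b (g x)) * ennreal (deriv g x) = ennreal (\<rho> x)"
          using gx d \<rho>_nonneg[of x]
          by (simp add: transfer_density_def psi_g[OF True] ennreal_mult''[symmetric])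
        then show ?thesis
          using True x gx by (simp add: H_def mult.assoc) (simp add: mult.commute)
      next
        case False
        then have "\<not> ((0 < x) = b \<and> x \<in> {-1..1})"
          using mem_half_side[of x b] elim by auto
        then show ?thesis using False by (auto simp: indicator_def)
      qed
    qed
  qed
  also have "\<dots> = (\<integral>\<^sup>+y. H y * indicator {-1<..<1} y \<partial>lborel)"
    by (rule nn_integral_branch[OF side H])
  also have "\<dots> = (\<integral>\<^sup>+y. h y * ennreal (transfer_density b y) * indicator {-1<..<1} y \<partial>lborel)"
    by (rule nn_integral_cong) (auto simp: H_def indicator_def)
  finally show ?thesis .
qed

text \<open>Where \<open>\<rho>\<close> vanishes so does \<open>weight\<close>, hence
  \<open>\<rho> * weight = transfer_density\<close> needs this. By invariance almost every image
  point lies where \<open>\<rho>\<close> is positive, so no mass is transported to the zero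
  set.\<close>

lemma AE_transfer_density_0: "AE y in lborel. \<rho> y = 0 \<longrightarrow> transfer_density b y = 0"
proof -
  let ?h = "indicator {y. \<rho> y = 0} :: real \<Rightarrow> ennreal"
  have h: "?h \<in> borel_measurable borel" by measurable
  have "(\<integral>\<^sup>+y. ?h y * ennreal (transfer_density b y) * indicator {-1<..<1} y \<partial>lborel) =
    (\<integral>\<^sup>+x. ?h (g x) * indicator {x. (0 < x) = b} x \<partial>M)"
    by (rule nn_integral_branch_M[OF borel_M[OF h], symmetric])
  also have "\<dots> = (\<integral>\<^sup>+x. 0 \<partial>M)"
  proof (rule nn_integral_cong_AE)
    show "AE x in M. ?h (g x) * indicator {x. (0 < x) = b} x = 0"
      using AE_Tn[OF AE_\<rho>_pos, of 1] by eventually_elim auto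
  qed
  also have "\<dots> = 0" by simp
  finally have "AE y in lborel. ?h y * ennreal (transfer_density b y) * indicator {-1<..<1} y = 0"
    by (subst (asm) nn_integral_0_iff_AE) auto
  then show ?thesis
  proof eventually_elim
    case (elim y)
    show ?case
    proof (cases "y \<in> {-1<..<1}")
      case True
      then show ?thesis using elim transfer_density_nonneg[of b y]
        by (auto simp: indicator_def ennreal_eq_0_iff split: if_splits)
    qed (auto simp: transfer_density_def)
  qed
qed

lemma AE_not_singleton: "AE x in M. x \<noteq> a"
proof -
  have "(\<integral>\<^sup>+x. indicator {a} x \<partial>M) = (\<integral>\<^sup>+x. ennreal (\<rho> x) * indicator {a} x * indicator {-1..1} x \<partial>lborel)"
    by (rule nn_integral_M[OF borel_M]) auto
  also have "\<dots> = (\<integral>\<^sup>+x. 0 \<partial>(lborel :: real measure))"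
  proof (rule nn_integral_cong_AE)
    show "AE x in lborel. ennreal (\<rho> x) * indicator {a} x * indicator {-1..1} x = 0"
      using AE_lborel_singleton[of a] by eventually_elim auto
  qed
  also have "\<dots> = 0" by simp
  finally have "AE x in M. indicator {a} x = (0::ennreal)"
    using borel_M[of "indicator {a} :: real \<Rightarrow> ennreal"] by (subst (asm) nn_integral_0_iff_AE) auto
  then show ?thesis by eventually_elim (auto simp: indicator_def split: if_splits)
qed

lemma full_branch: "full_branch M g weight psi"
proof -
  have [measurable]: "(\<lambda>x. x) \<in> borel_measurable M" by (rule borel_M) auto
  have w [measurable]: "weight b \<in> borel_measurable borel" for b
    unfolding weight_def by measurable
  show ?thesis
  proof unfold_locales
    show "Measurable.pred M (\<lambda>x. 0 < x)" by measurable
    show "weight b \<in> borel_measurable M" for b by (rule borel_M[OF w])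
    show "0 \<le> weight b x" for b x
      unfolding weight_def using transfer_density_nonneg \<rho>_nonneg by (rule divide_nonneg_nonneg)
    show "(\<integral>\<^sup>+x. h (g x) * indicator {x. (0 < x) = b} x \<partial>M) = (\<integral>\<^sup>+y. h y * ennreal (weight b y) \<partial>M)"
      if h [measurable]: "h \<in> borel_measurable M" for b and h :: "real \<Rightarrow> ennreal"
    proof -
      have "(\<integral>\<^sup>+y. h y * ennreal (weight b y) \<partial>M) =
        (\<integral>\<^sup>+y. ennreal (\<rho> y) * (h y * ennreal (weight b y)) * indicator {-1..1} y \<partial>lborel)"
        using borel_M[OF w[of b]] by (intro nn_integral_M) measurable
      also have "\<dots> = (\<integral>\<^sup>+y. h y * ennreal (transfer_density b y) * indicator {-1<..<1} y \<partial>lborel)"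
      proof (rule nn_integral_cong_AE)
        show "AE y in lborel. ennreal (\<rho> y) * (h y * ennreal (weight b y)) * indicator {-1..1} y =
          h y * ennreal (transfer_density b y) * indicator {-1<..<1} y"
          using AE_transfer_density_0[of b]
        proof eventually_elim
          case (elim y)
          have "ennreal (\<rho> y) * ennreal (weight b y) = ennreal (transfer_density b y)"
            using elim \<rho>_nonneg[of y] by (auto simp: weight_def ennreal_mult'[symmetric])
          moreover have "ennreal (transfer_density b y) * indicator {-1..1} y =
              ennreal (transfer_density b y) * indicator {-1<..<1} y"
            by (auto simp: transfer_density_def indicator_def)
          ultimately show ?case by (metis mult.assoc mult.commute)
        qed
      qed
      finally show ?thesis using nn_integral_branch_M[OF h] by simp
    qed
    show "-1 < g x \<and> g x < 1" if "-1 < x" "x < 1" "x \<noteq> 0" for x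
      using g_range[OF side, of x "0 < x"] mem_half_side[OF that] by auto
    show "-1 < psi b y \<and> psi b y < 1 \<and> psi b y \<noteq> 0 \<and> (0 < psi b y) = b \<and> g (psi b y) = y"
      if "-1 < y" "y < 1" for b y
      using psi_mem[of y b] half_sideD[of "psi b y" b] that by auto
    show "g x \<le> g y" if "-1 < x" "x \<le> y" "y < 1" "0 < x \<or> y < 0" for x y
    proof (rule g_le[OF side])
      show "x \<in> half (side (0 < x))" "y \<in> half (side (0 < x))"
        using that by (auto simp: half_def side_def)
    qed (rule that)
  qed (use sets_M AE_not_singleton in auto)
qed

sublocale full_branch M g weight psi
  by (rule full_branch)

lemma AE_interior: "AE x in M. \<forall>j. (g ^^ j) x \<in> {-1<..<1} - {0}"
proof -
  have "AE x in M. \<forall>j. (g ^^ j) x \<notin> {-1, 0, 1}"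
    by (rule AE_orbit_avoids) auto
  then show ?thesis
    using AE_space
  proof eventually_elim
    case (elim x)
    show ?case
    proof
      fix j
      have "(g ^^ j) x \<in> {-1..1}" using Tn_space[OF elim(2)] by (simp add: space_M_eq)
      moreover have "(g ^^ j) x \<notin> {-1, 0, 1}" using elim(1) by blast
      ultimately show "(g ^^ j) x \<in> {-1<..<1} - {0}" by auto
    qed
  qed
qed

text \<open>The weight of the branch of \<open>x\<close> at \<open>g x\<close> is
  \<open>\<rho> x / (deriv g x * \<rho> (g x))\<close>. Its logarithm splits where both densities
  are positive, which by invariance is almost everywhere.\<close>

lemma AE_info: "AE x in M. info x = ln (deriv g x) + (ln (\<rho> (g x)) - ln (\<rho> x))"
  using AE_interior AE_\<rho>_pos AE_Tn[OF AE_\<rho>_pos, of 1]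
proof eventually_elim
  case (elim x)
  have x: "x \<in> half (side (0 < x))"
    using elim(1)[rule_format, of 0] by (auto simp: half_def side_def)
  have d: "0 < deriv g x" by (rule deriv_pos[OF side x])
  have "weight (0 < x) (g x) = \<rho> x / deriv g x / \<rho> (g x)"
    using g_range[OF side x] by (simp add: weight_def transfer_density_def psi_g[OF x])
  then show ?case
    using elim(2,3) d by (simp add: info_def ln_div ln_mult)
qed

text \<open>Nothing is known about \<open>deriv g\<close> at -1, 0 and 1, so measurability is
  obtained by changing a Borel function on this finite set.\<close>

lemma ln_deriv_borel: "(\<lambda>x. ln \<bar>deriv g x\<bar>) \<in> borel_measurable M"
proof -
  define f where "f x = (if x \<in> half 1 \<union> half (-1) then deriv g x else 1)" for x
  have "f \<in> borel_measurable borel"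
    unfolding f_def
    by (intro borel_measurable_continuous_on_if continuous_on_open_Un half_open cont_deriv continuous_intros) auto
  then have f: "f \<in> borel_measurable M" by (rule borel_M)
  have "deriv g \<in> borel_measurable M"
  proof (rule measurable_discrete_difference[OF f, of "{-1, 0, 1}"])
    show "{x} \<in> sets M" if "x \<in> {-1, 0, 1}" for x
      using that unfolding sets_M by (auto simp: sets_restrict_space image_iff intro!: bexI[of _ "{x}"])
    show "f x = deriv g x" if "x \<in> space M" "x \<notin> {-1, 0, 1}" for x
      using that by (auto simp: f_def space_M_eq half_def)
  qed auto
  then show ?thesis by measurable
qed

text \<open>If a step multiplies the distance to the fixed point by at most \<open>C\<close>, an
  orbit landing at distance \<open>d < 1\<close> stays in that half for at least about
  \<open>- ln d / ln C\<close> steps.\<close>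

lemma integrable_ln_deriv:
  assumes "\<And>\<sigma>. \<bar>\<sigma>\<bar> = 1 \<Longrightarrow> \<exists>K\<ge>0. \<forall>x\<in>half \<sigma>.
    \<bar>ln (deriv g x)\<bar> \<le> K + K * \<bar>ln (1 + \<sigma> * g x)\<bar> \<and> 1 - \<sigma> * g x \<le> K * (1 - \<sigma> * x)"
  shows "integrable M (\<lambda>x. ln \<bar>deriv g x\<bar>)"
proof -
  have one: "\<exists>B. integrable M B \<and> (\<forall>x. 0 \<le> B x) \<and> (\<forall>x\<in>half \<sigma>. \<bar>ln (deriv g x)\<bar> \<le> B x)"
    if \<sigma>: "\<bar>\<sigma>\<bar> = 1" for \<sigma>
  proof -
    obtain K where K: "0 \<le> K" "\<And>x. x \<in> half \<sigma> \<Longrightarrow> \<bar>ln (deriv g x)\<bar> \<le> K + K * \<bar>ln (1 + \<sigma> * g x)\<bar>"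
      using assms[OF \<sigma>] by blast
    have m\<sigma>: "\<bar>- \<sigma>\<bar> = 1" using \<sigma> by simp
    obtain K' where K': "\<And>x. x \<in> half (- \<sigma>) \<Longrightarrow> 1 + \<sigma> * g x \<le> K' * (1 + \<sigma> * x)"
      using assms[OF m\<sigma>] by auto
    \<comment> \<open>The 2 ensures \<open>ln C > 0\<close>; the factor \<open>K'\<close> belongs to
      the opposite half, where the orbit stays after landing near \<open>- \<sigma>\<close>.\<close>
    define C where "C = max K' 2"
    have C: "K' \<le> C" "2 \<le> C" by (auto simp: C_def)
    define A where "A = {x\<in>space M. \<sigma> * x < 0}"
    have idM [measurable]: "(\<lambda>x. x) \<in> borel_measurable M" by (rule borel_M) auto
    have gM [measurable]: "g \<in> borel_measurable M"
      using measurable_compose[OF T idM] by simp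
    have A [measurable]: "A \<in> sets M" unfolding A_def by measurable
    \<comment> \<open>A lower bound for the length of the stay in \<open>A\<close> that begins at
      \<open>g x\<close>; the truncation at 0 covers landing points at distance more than 1.\<close>
    define f where "f x = max 0 (- ln (1 + \<sigma> * g x)) / ln C" for x
    have lnC: "0 < ln C" using C by simp
    have f [measurable]: "f \<in> borel_measurable M" unfolding f_def by measurable
    have int: "integrable M (\<lambda>x. indicator (space M - A) x * f x)"
    proof (rule integrable_excursion_time[OF A f])
      show "0 \<le> f x" for x unfolding f_def using lnC by simp
      show "AE x in M. x \<notin> A \<longrightarrow> (\<forall>n j. real n < f x \<and> 1 \<le> j \<and> j \<le> n \<longrightarrow> (g ^^ j) x \<in> A)"
        using AE_interior AE_space
      proof (eventually_elim, intro impI allI)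
        fix x n j assume int: "\<forall>j. (g ^^ j) x \<in> {-1<..<1} - {0}" and x: "x \<in> space M"
          and xA: "x \<notin> A" and nj: "real n < f x \<and> 1 \<le> j \<and> j \<le> n"
        define d where "d = 1 + \<sigma> * g x"
        have gx: "-1 < g x" "g x < 1" using int[rule_format, of 1] by auto
        have d: "0 < d" unfolding d_def using gx sgn_cases[OF \<sigma>] by auto
        have "real n * ln C < max 0 (- ln d)"
          using nj lnC by (simp add: f_def d_def pos_less_divide_eq)
        moreover have "0 \<le> real n * ln C" using lnC by simp
        ultimately have "real n * ln C + ln d < 0" by (simp add: max_def split: if_splits)
        then have "ln (C ^ n * d) < 0"
          using C d by (simp add: ln_mult ln_realpow)
        then have Cd: "C ^ n * d < 1"
          using C d by (subst (asm) ln_less_zero_iff) auto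
        have low: "C ^ i * d < 1" if "i \<le> n" for i
        proof -
          have "C ^ i \<le> C ^ n" using C that by (intro power_increasing) auto
          then have "C ^ i * d \<le> C ^ n * d" using d by (intro mult_right_mono) auto
          then show ?thesis using Cd by linarith
        qed
        \<comment> \<open>The landing point \<open>g x\<close> has distance \<open>d\<close>, which
          explains the shift by one in the exponent. As long as \<open>low\<close> keeps the
          distance below 1 the orbit is in the opposite half and \<open>K'\<close> applies
          again.\<close>
        have dist: "1 + \<sigma> * (g ^^ Suc i) x \<le> C ^ i * d" if "i \<le> n" for i
          using that
        proof (induction i)
          case 0
          then show ?case by (simp add: d_def)
        next
          case (Suc i)
          define z where "z = (g ^^ Suc i) x"
          have IH: "1 + \<sigma> * z \<le> C ^ i * d" using Suc by (simp add: z_def)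
          have "1 + \<sigma> * z < 1" using IH low[of i] Suc.prems by linarith
          moreover have "-1 < z" "z < 1" using int[rule_format, of "Suc i"] by (auto simp: z_def)
          ultimately have zh: "z \<in> half (- \<sigma>)" and pz: "0 < 1 + \<sigma> * z"
            using sgn_cases[OF \<sigma>] by (auto simp: half_def)
          have "1 + \<sigma> * g z \<le> K' * (1 + \<sigma> * z)" by (rule K'[OF zh])
          also have "\<dots> \<le> C * (1 + \<sigma> * z)" using C pz by (intro mult_right_mono) auto
          also have "\<dots> \<le> C * (C ^ i * d)" using C IH by (intro mult_left_mono) auto
          finally show ?case by (simp add: z_def mult.assoc)
        qed
        obtain i where i: "j = Suc i" using nj by (cases j) auto
        have "1 + \<sigma> * (g ^^ j) x < 1"
          using dist[of i] low[of i] nj i by auto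
        then show "(g ^^ j) x \<in> A"
          using Tn_space[OF x] by (simp add: A_def)
      qed
    qed
    \<comment> \<open>The term with \<open>ln 2\<close> accounts for distances between 1 and 2,
      where the logarithm is positive.\<close>
    define B where "B x = (K + K * ln 2) + K * ln C * (indicator (space M - A) x * f x)" for x
    show ?thesis
    proof (intro exI[of _ B] conjI allI ballI)
      show "integrable M B" unfolding B_def using int by simp
      show "0 \<le> B x" for x
        unfolding B_def f_def using K lnC by (intro add_nonneg_nonneg mult_nonneg_nonneg) auto
      fix x assume x: "x \<in> half \<sigma>"
      have xs: "x \<in> space M - A" using x sgn_cases[OF \<sigma>] by (auto simp: half_def space_M_eq A_def)
      have gx: "-1 < g x" "g x < 1" using g_range[OF \<sigma> x] by auto
      have d: "0 < 1 + \<sigma> * g x" "1 + \<sigma> * g x \<le> 2" using gx sgn_cases[OF \<sigma>] by auto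
      have "ln (1 + \<sigma> * g x) \<le> ln 2" using d by simp
      moreover have "0 \<le> ln (2::real)" by simp
      ultimately have "\<bar>ln (1 + \<sigma> * g x)\<bar> \<le> ln 2 + max 0 (- ln (1 + \<sigma> * g x))"
        by linarith
      also have "max 0 (- ln (1 + \<sigma> * g x)) = ln C * f x"
        using lnC by (simp add: f_def)
      finally have "\<bar>ln (1 + \<sigma> * g x)\<bar> \<le> ln 2 + ln C * f x" .
      then have "K * \<bar>ln (1 + \<sigma> * g x)\<bar> \<le> K * (ln 2 + ln C * f x)"
        using K(1) by (rule mult_left_mono)
      then show "\<bar>ln (deriv g x)\<bar> \<le> B x"
        using K(2)[OF x] xs by (simp add: B_def algebra_simps)
    qed
  qed
  obtain B1 where B1: "integrable M B1" "\<And>x. 0 \<le> B1 x" "\<And>x. x \<in> half 1 \<Longrightarrow> \<bar>ln (deriv g x)\<bar> \<le> B1 x"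
    using one[of 1] by auto
  obtain B2 where B2: "integrable M B2" "\<And>x. 0 \<le> B2 x" "\<And>x. x \<in> half (-1) \<Longrightarrow> \<bar>ln (deriv g x)\<bar> \<le> B2 x"
    using one[of "-1"] by auto
  show ?thesis
  proof (rule Bochner_Integration.integrable_bound[OF Bochner_Integration.integrable_add[OF B1(1) B2(1)] ln_deriv_borel])
    show "AE x in M. norm (ln \<bar>deriv g x\<bar>) \<le> norm (B1 x + B2 x)"
      using AE_interior
    proof eventually_elim
      case (elim x)
      have "x \<in> half 1 \<or> x \<in> half (-1)" using elim[rule_format, of 0] by (auto simp: half_def)
      then have "0 < deriv g x" "\<bar>ln (deriv g x)\<bar> \<le> B1 x + B2 x"
        using deriv_pos[of 1 x] deriv_pos[of "-1" x] B1(2,3)[of x] B2(2,3)[of x] by auto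
      then show ?case using B1(2)[of x] B2(2)[of x] by simp
    qed
  qed
qed

lemma entropy_formula:
  assumes int: "integrable M (\<lambda>x. ln \<bar>deriv g x\<bar>)"
  shows "metric_entropy M g = ereal (\<integral>x. ln \<bar>deriv g x\<bar> \<partial>M)"
proof -
  have \<rho>M [measurable]: "\<rho> \<in> borel_measurable M" by (rule borel_M[OF \<rho>])
  have info: "AE x in M. info x = ln \<bar>deriv g x\<bar> + (ln (\<rho> (g x)) - ln (\<rho> x))"
    using AE_info AE_interior
  proof eventually_elim
    case (elim x)
    have "x \<in> half (side (0 < x))"
      using elim(2)[rule_format, of 0] by (auto simp: half_def side_def)
    then show ?case using elim(1) deriv_pos[of "side (0 < x)" x] by simp
  qed
  have info_nonneg: "AE x in M. 0 \<le> info x"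
    using AE_weight_pos AE_Tn[OF AE_weight_sum, of 1]
  proof eventually_elim
    case (elim x)
    have "weight (0 < x) (g x) \<le> 1"
      using elim(2) w_nonneg[of True "g x"] w_nonneg[of False "g x"] by (cases "0 < x") auto
    then show ?case using elim(1) by (simp add: info_def)
  qed
  have le: "AE x in M. - ln \<bar>deriv g x\<bar> \<le> ln (\<rho> (g x)) - ln (\<rho> x)"
    using info info_nonneg by eventually_elim linarith
  have u: "(\<lambda>x. ln (\<rho> x)) \<in> borel_measurable M" by measurable
  note cob = integrable_coboundary[OF u integrable_minus[OF int] le] integral_coboundary[OF u integrable_minus[OF int] le]
  have sum: "integrable M (\<lambda>x. ln \<bar>deriv g x\<bar> + (ln (\<rho> (g x)) - ln (\<rho> x)))"
    using int cob(1) by (rule Bochner_Integration.integrable_add)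
  have info_meas: "info \<in> borel_measurable M"
    unfolding info_def using w_c by measurable
  have ii: "integrable M info"
    by (rule integrable_cong_AE_imp[OF sum info_meas]) (use info in \<open>auto elim: eventually_mono\<close>)
  have "(\<integral>x. info x \<partial>M) = (\<integral>x. ln \<bar>deriv g x\<bar> + (ln (\<rho> (g x)) - ln (\<rho> x)) \<partial>M)"
    by (rule integral_cong_AE[OF info_meas borel_measurable_integrable[OF sum] info])
  also have "\<dots> = (\<integral>x. ln \<bar>deriv g x\<bar> \<partial>M)"
    using Bochner_Integration.integral_add[OF int cob(1)] cob(2) by simp
  finally show ?thesis
    using metric_entropy_eq_integral_info[OF ii] by simp
qed

end

text \<open>The Radon-Nikodym derivative can be chosen real and is positive almost everywhere for
  \<open>\<mu>\<close>, so \<open>ln \<rho>\<close> is meaningful along almost every orbit.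
  Extension by 0 makes it a function on the line.\<close>

lemma acip_systemI:
  assumes A0: "cond_A0 g" and \<mu>: "ergodic_acip g \<mu>"
  obtains \<rho> where "acip_system g \<mu> \<rho>"
proof -
  let ?L = "restrict_space lborel II"
  have sets: "sets \<mu> = sets (restrict_space borel II)" and prob: "prob_space \<mu>"
    and inv: "g \<in> \<mu> \<rightarrow>\<^sub>M \<mu>" "distr \<mu> \<mu> g = \<mu>" and ac: "absolutely_continuous ?L \<mu>"
    using \<mu> by (auto simp: ergodic_acip_def invariant_measure_def)
  have setsL: "sets \<mu> = sets ?L"
    unfolding sets by (rule sets_restrict_space_cong) simp
  interpret prob_space \<mu> by (rule prob)
  have "finite_measure ?L"
    by (rule finite_measureI) (simp add: emeasure_restrict_space space_restrict_space)
  then interpret L: finite_measure ?L .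
  obtain D where D: "D \<in> borel_measurable ?L" "AE x in ?L. RN_deriv ?L \<mu> x = ennreal (D x)"
    "AE x in \<mu>. 0 < D x" "\<And>x. 0 \<le> D x"
    using L.real_RN_deriv[OF finite_measure_axioms ac setsL] by blast
  define \<rho> where "\<rho> x = indicator II x * D x" for x
  have dens: "density ?L (\<lambda>x. ennreal (D x)) = \<mu>"
  proof -
    have "density ?L (\<lambda>x. ennreal (D x)) = density ?L (RN_deriv ?L \<mu>)"
      by (rule density_cong) (use D in \<open>auto elim: eventually_mono\<close>)
    then show ?thesis using L.density_RN_deriv[OF ac setsL] by simp
  qed
  have "acip_system g \<mu> \<rho>"
  proof (intro acip_system.intro two_branch_if_A0[OF A0] pmp.intro prob pmp_axioms.intro inv acip_system_axioms.intro sets)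
    show "\<rho> \<in> borel_measurable borel"
      using D(1) unfolding \<rho>_def
      by (subst (asm) borel_measurable_restrict_space_iff) (auto simp: mult.commute)
    show "0 \<le> \<rho> x" for x using D(4) by (simp add: \<rho>_def)
    have sp: "space \<mu> = II" using sets_eq_imp_space_eq[OF sets] by (simp add: space_restrict_space)
    show "AE x in \<mu>. 0 < \<rho> x"
      using D(3) AE_space by eventually_elim (auto simp: \<rho>_def sp)
    fix F :: "real \<Rightarrow> ennreal" assume F: "F \<in> borel_measurable \<mu>"
    have FL: "F \<in> borel_measurable ?L"
      using F unfolding measurable_cong_sets[OF setsL refl] .
    have "(\<integral>\<^sup>+x. F x \<partial>\<mu>) = (\<integral>\<^sup>+x. F x \<partial>density ?L (\<lambda>x. ennreal (D x)))"
      by (simp add: dens)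
    also have "\<dots> = (\<integral>\<^sup>+x. ennreal (D x) * F x \<partial>?L)"
      by (rule nn_integral_density) (use D(1) FL in auto)
    also have "\<dots> = (\<integral>\<^sup>+x. ennreal (D x) * F x * indicator II x \<partial>lborel)"
      by (rule nn_integral_restrict_space) simp
    also have "\<dots> = (\<integral>\<^sup>+x. ennreal (\<rho> x) * F x * indicator II x \<partial>lborel)"
      by (rule nn_integral_cong) (auto simp: \<rho>_def indicator_def)
    finally show "(\<integral>\<^sup>+x. F x \<partial>\<mu>) = (\<integral>\<^sup>+x. ennreal (\<rho> x) * F x * indicator II x \<partial>lborel)" .
  qed
  then show ?thesis by (rule that)
qed

text \<open>Integrability is part of the claim because the Bochner integral of a function that is
  not integrable is 0 by convention.\<close>

theorem theoremC:
  fixes g :: "real \<Rightarrow> real" and \<mu> :: "real measure"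
  assumes "g \<in> class_F"
    and "ergodic_acip g \<mu>"
  shows "integrable \<mu> (\<lambda>x. ln \<bar>deriv g x\<bar>) \<and>
         metric_entropy \<mu> g = ereal (\<integral>x. ln \<bar>deriv g x\<bar> \<partial>\<mu>)"
proof -
  obtain \<iota> l1 l2 k1 k2 a1 a2 b1 b2 where A0: "cond_A0 g" and A1: "cond_A1 g \<iota> l1 l2 k1 k2 a1 a2 b1 b2"
    using assms(1) by (auto simp: class_F_def)
  obtain \<rho> where "acip_system g \<mu> \<rho>"
    using acip_systemI[OF A0 assms(2)] .
  then interpret acip_system g \<mu> \<rho> .
  have "integrable \<mu> (\<lambda>x. ln \<bar>deriv g x\<bar>)"
    by (rule integrable_ln_deriv) (rule branch_bounds_if_A1[OF A1])
  then show ?thesis using entropy_formula by simp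
qed

end
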